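(* Let $G$ be a group acting geometrically on a $\mathrm{CAT}(0)$ space $X$, and let $X_D$ be the curtain model of $X$. Let $H$ be any subgroup of $G$. If $|\partial_{X_D}H|=2$, then $H$ is virtually $\mathbb{Z}$.
   Context: All actions are by isometries. An action of $G$ on a $\mathrm{CAT}(0)$ space $(X,d)$ is geometric if it is properly discontinuous (for every $x\in X$, $r>0$ only finitely many $g\in G$ satisfy $d(g\cdot x,x)\le r$) and co-compact. Virtually $\mathbb{Z}$ means having a finite index subgroup isomorphic to $\mathbb{Z}$. Limit set. Let $(Z,d_Z)$ be a Gromov hyperbolic space with base point $w$ and Gromov product $(y|z)_w=\frac12(d_Z(w,y)+d_Z(w,z)-d_Z(y,z))$. A sequence $(x_n)$ is Cauchy–Gromov if $(x_n|x_m)_w\to\infty$ as $n,m\to\infty$; two such sequences are equivalent, $(y_n)\sim(z_n)$, if $(y_n|z_n)_w\to\infty$; the Gromov boundary $\partial Z$ is the set of equivalence classes. For a group $H$ acting on $Z$, the limit set is $\partial_Z H=\{[(y_n)]\in\partial Z \mid (y_n)\sim(h_n\cdot z)\text{ for some } z\in Z,\ h_n\in H\}$. The curtain model $X_D$ defined below is Gromov hyperbolic (four point condition), and $H$ acts on it by the induced action. Curtain model. Let $X$ be a $\mathrm{CAT}(0)$ space. For a geodesic $\alpha:I\to X$ ($I\subseteq\mathbb{R}$ a closed interval) with closest-point projection $\pi_\alpha$ onto $\alpha$, and $r$ with $[r-1/2,r+1/2]$ in the interior of $I$, the curtain dual to $\alpha$ at $r$ is $h=h_{\alpha,r}=\pi_\alpha^{-1}(\alpha[r-1/2,r+1/2])$.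 Its halfspaces are $h^-=\pi_\alpha^{-1}\alpha(I\cap(-\infty,r-1/2))$ and $h^+=\pi_\alpha^{-1}\alpha(I\cap(r+1/2,\infty))$. The curtain $h$ separates subsets $A,B\subseteq X$ if one lies in $h^-$ and the other in $h^+$. A set $\{h_i\}$ of curtains (indexed by consecutive integers) is a chain if $h_i$ separates $h_{i-1}$ from $h_{i+1}$ for all $i$; a chain separates $A$ from $B$ if each $h_i$ does. For $L\in\mathbb{N}$, $L\geq 1$, disjoint curtains $h,h'$ are $L$-separated if every chain all of whose members meet both $h$ and $h'$ has cardinality at most $L$. An $L$-chain is a chain of curtains in which each pair is $L$-separated. Set $d_L(x,x)=0$ and, for $x\ne y$, $d_L(x,y)=1+\max\{|c| : c \text{ is an } L\text{-chain separating } x \text{ from } y\}$. Fix a sequence $\lambda_L\in(0,1)$ with $\sum_{L\ge1}\lambda_L<\sum_{L\ge1}L\lambda_L<\sum_{L\ge1}L^2\lambda_L=\Lambda<\infty$. The curtain model is $X_D:=(X,D)$ with $D(x,y)=\sum_{L=1}^\infty\lambda_L d_L(x,y)$. Every isometry of $X$ is an isometry of $X_D$, so an action on $X$ induces an action on $X_D$. *)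

theory Defs
  imports "HOL-Analysis.Analysis" "HOL-Algebra.Group_Action" "HOL-Algebra.Elementary_Groups"
begin

section \<open>CAT(0) spaces\<close>

context Metric_space
begin

definition geodesic :: "real set \<Rightarrow> (real \<Rightarrow> 'a) \<Rightarrow> bool" where
  "geodesic I \<alpha> \<longleftrightarrow> is_interval I \<and> closed I \<and> \<alpha> \<in> I \<rightarrow> M \<and>
     (\<forall>s\<in>I. \<forall>t\<in>I. d (\<alpha> s) (\<alpha> t) = \<bar>s - t\<bar>)"

definition geodesic_segment :: "'a set \<Rightarrow> 'a \<Rightarrow> 'a \<Rightarrow> bool" where
  "geodesic_segment S x y \<longleftrightarrow>
     (\<exists>l \<alpha>. 0 \<le> l \<and> geodesic {0..l} \<alpha> \<and> \<alpha> 0 = x \<and> \<alpha> l = y \<and> S = \<alpha> ` {0..l})"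

end

text \<open>
  In \<open>comparison\<close>, the points \<open>x'\<close>, \<open>y'\<close>, \<open>z'\<close> span a Euclidean comparison triangle for the
  geodesic triangle with sides \<open>S\<close>, \<open>T\<close>, \<open>U\<close>, and \<open>p'\<close>, \<open>q'\<close> are the comparison points of \<open>p\<close>, \<open>q\<close>.
  Two points on different sides always lie on two sides with a common vertex, called \<open>x\<close> here;
  for two points on the same side the CAT(0) inequality is an equality.
  Completeness is not assumed.
\<close>

locale CAT0_space = Metric_space +
  assumes geodesic_space: "\<lbrakk>x \<in> M; y \<in> M\<rbrakk> \<Longrightarrow> \<exists>S. geodesic_segment S x y"
    and comparison:
      "\<And>x y z S T U p q (x'::real^2) y' z' p' q'.
        \<lbrakk>geodesic_segment S x y; geodesic_segment T x z; geodesic_segment U y z;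
         dist x' y' = d x y; dist x' z' = d x z; dist y' z' = d y z;
         p \<in> S; p' \<in> closed_segment x' y'; dist x' p' = d x p;
         q \<in> T; q' \<in> closed_segment x' z'; dist x' q' = d x q\<rbrakk>
        \<Longrightarrow> d p q \<le> dist p' q'"


section \<open>Curtains and the curtain model\<close>

context Metric_space
begin

definition nearest_point :: "'a set \<Rightarrow> 'a \<Rightarrow> 'a" where
  "nearest_point S x = (THE p. p \<in> S \<and> (\<forall>q\<in>S. d x p \<le> d x q))"

text \<open>The preimage, under the projection to the geodesic, of its part with parameters in \<open>J\<close>:\<close>

definition proj_preimage :: "real set \<Rightarrow> (real \<Rightarrow> 'a) \<Rightarrow> real set \<Rightarrow> 'a set" where
  "proj_preimage I \<alpha> J = {x \<in> M. nearest_point (\<alpha> ` I) x \<in> \<alpha> ` (I \<inter> J)}"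

definition dual_curtain :: "real set \<Rightarrow> (real \<Rightarrow> 'a) \<Rightarrow> real \<Rightarrow> 'a set" where
  "dual_curtain I \<alpha> r = proj_preimage I \<alpha> {r - 1/2 .. r + 1/2}"

definition minus_halfspace :: "real set \<Rightarrow> (real \<Rightarrow> 'a) \<Rightarrow> real \<Rightarrow> 'a set" where
  "minus_halfspace I \<alpha> r = proj_preimage I \<alpha> {..< r - 1/2}"

definition plus_halfspace :: "real set \<Rightarrow> (real \<Rightarrow> 'a) \<Rightarrow> real \<Rightarrow> 'a set" where
  "plus_halfspace I \<alpha> r = proj_preimage I \<alpha> {r + 1/2 <..}"

definition curtain_at :: "real set \<Rightarrow> (real \<Rightarrow> 'a) \<Rightarrow> real \<Rightarrow> 'a set \<Rightarrow> bool" where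
  "curtain_at I \<alpha> r h \<longleftrightarrow>
     geodesic I \<alpha> \<and> {r - 1/2 .. r + 1/2} \<subseteq> interior I \<and> h = dual_curtain I \<alpha> r"

text \<open>
  A curtain is a set of points; this is what the cardinality of a chain counts. In a CAT(0) space
  the two halfspaces are the connected components of the complement of the curtain, so, up to
  order, they do not depend on the geodesic that is chosen in \<open>curtain_separates\<close>.
\<close>

definition curtain :: "'a set \<Rightarrow> bool" where
  "curtain h \<longleftrightarrow> (\<exists>I \<alpha> r. curtain_at I \<alpha> r h)"

definition curtain_separates :: "'a set \<Rightarrow> 'a set \<Rightarrow> 'a set \<Rightarrow> bool" where
  "curtain_separates h A B \<longleftrightarrow>
     (\<exists>I \<alpha> r. curtain_at I \<alpha> r h \<and>
        (A \<subseteq> minus_halfspace I \<alpha> r \<and> B \<subseteq> plus_halfspace I \<alpha> r \<or>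
         A \<subseteq> plus_halfspace I \<alpha> r \<and> B \<subseteq> minus_halfspace I \<alpha> r))"

text \<open>
  The index set \<open>J\<close> is a possibly empty or infinite set of consecutive integers. The condition is
  imposed at the indices that have both neighbours in \<open>J\<close>.
\<close>

definition curtain_chain :: "'a set set \<Rightarrow> bool" where
  "curtain_chain c \<longleftrightarrow>
     (\<exists>(J::int set) h. (\<forall>i\<in>J. \<forall>k\<in>J. {i..k} \<subseteq> J) \<and> c = h ` J \<and> (\<forall>i\<in>J. curtain (h i)) \<and>
        (\<forall>i\<in>J. i - 1 \<in> J \<longrightarrow> i + 1 \<in> J \<longrightarrow> curtain_separates (h i) (h (i - 1)) (h (i + 1))))"

definition L_separated :: "nat \<Rightarrow> 'a set \<Rightarrow> 'a set \<Rightarrow> bool" where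
  "L_separated L h h' \<longleftrightarrow> curtain h \<and> curtain h' \<and> h \<inter> h' = {} \<and>
     (\<forall>c. curtain_chain c \<longrightarrow> (\<forall>k\<in>c. k \<inter> h \<noteq> {} \<and> k \<inter> h' \<noteq> {}) \<longrightarrow> finite c \<and> card c \<le> L)"

definition L_chain :: "nat \<Rightarrow> 'a set set \<Rightarrow> bool" where
  "L_chain L c \<longleftrightarrow> curtain_chain c \<and> (\<forall>h\<in>c. \<forall>h'\<in>c. h \<noteq> h' \<longrightarrow> L_separated L h h')"

definition chain_separates :: "'a set set \<Rightarrow> 'a set \<Rightarrow> 'a set \<Rightarrow> bool" where
  "chain_separates c A B \<longleftrightarrow> (\<forall>h\<in>c. curtain_separates h A B)"

text \<open>
  The empty chain is admitted, so the set below contains 0; in a CAT(0) space it is bounded by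
  the distance of the two points.
\<close>

definition L_dist :: "nat \<Rightarrow> 'a \<Rightarrow> 'a \<Rightarrow> nat" where
  "L_dist L x y =
     (if x = y then 0 else 1 + Max {card c | c. L_chain L c \<and> chain_separates c {x} {y}})"

definition curtain_dist :: "(nat \<Rightarrow> real) \<Rightarrow> 'a \<Rightarrow> 'a \<Rightarrow> real" where
  "curtain_dist lam x y = (\<Sum>n. lam (Suc n) * real (L_dist (Suc n) x y))"

end

text \<open>Weights are indexed by \<open>L \<ge> 1\<close>; the value at 0 plays no role.\<close>

definition curtain_weights :: "(nat \<Rightarrow> real) \<Rightarrow> bool" where
  "curtain_weights lam \<longleftrightarrow> (\<forall>L\<ge>1. 0 < lam L \<and> lam L < 1) \<and>
     summable (\<lambda>n. (real (Suc n))\<^sup>2 * lam (Suc n)) \<and>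
     (\<Sum>n. lam (Suc n)) < (\<Sum>n. real (Suc n) * lam (Suc n)) \<and>
     (\<Sum>n. real (Suc n) * lam (Suc n)) < (\<Sum>n. (real (Suc n))\<^sup>2 * lam (Suc n))"


section \<open>Gromov boundary and limit sets\<close>

definition gromov_product :: "('a \<Rightarrow> 'a \<Rightarrow> real) \<Rightarrow> 'a \<Rightarrow> 'a \<Rightarrow> 'a \<Rightarrow> real" where
  "gromov_product dZ w y z = (dZ w y + dZ w z - dZ y z) / 2"

definition cauchy_gromov :: "'a set \<Rightarrow> ('a \<Rightarrow> 'a \<Rightarrow> real) \<Rightarrow> 'a \<Rightarrow> (nat \<Rightarrow> 'a) set" where
  "cauchy_gromov Z dZ w = {x. range x \<subseteq> Z \<and>
     filterlim (\<lambda>(n, m). gromov_product dZ w (x n) (x m)) at_top (sequentially \<times>\<^sub>F sequentially)}"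

definition gromov_equiv ::
  "'a set \<Rightarrow> ('a \<Rightarrow> 'a \<Rightarrow> real) \<Rightarrow> 'a \<Rightarrow> ((nat \<Rightarrow> 'a) \<times> (nat \<Rightarrow> 'a)) set" where
  "gromov_equiv Z dZ w = {(y, z). y \<in> cauchy_gromov Z dZ w \<and> z \<in> cauchy_gromov Z dZ w \<and>
     filterlim (\<lambda>n. gromov_product dZ w (y n) (z n)) at_top sequentially}"

definition gromov_boundary ::
  "'a set \<Rightarrow> ('a \<Rightarrow> 'a \<Rightarrow> real) \<Rightarrow> 'a \<Rightarrow> (nat \<Rightarrow> 'a) set set" where
  "gromov_boundary Z dZ w = cauchy_gromov Z dZ w // gromov_equiv Z dZ w"

definition limit_set ::
  "'a set \<Rightarrow> ('a \<Rightarrow> 'a \<Rightarrow> real) \<Rightarrow> 'a \<Rightarrow> ('g \<Rightarrow> 'a \<Rightarrow> 'a) \<Rightarrow> 'g set \<Rightarrow> (nat \<Rightarrow> 'a) set set" where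
  "limit_set Z dZ w \<phi> H = {\<xi> \<in> gromov_boundary Z dZ w.
     \<exists>y\<in>\<xi>. \<exists>z\<in>Z. \<exists>h. range h \<subseteq> H \<and> (y, \<lambda>n. \<phi> (h n) z) \<in> gromov_equiv Z dZ w}"


section \<open>Groups\<close>

locale geometric_action = group_action G M \<phi> + Metric_space M d
  for G :: "('g, 'm) monoid_scheme" (structure) and M :: "'a set" and d and \<phi> +
  assumes isometric: "\<lbrakk>g \<in> carrier G; x \<in> M; y \<in> M\<rbrakk> \<Longrightarrow> d (\<phi> g x) (\<phi> g y) = d x y"
    and properly_discontinuous:
      "\<lbrakk>x \<in> M; 0 < r\<rbrakk> \<Longrightarrow> finite {g \<in> carrier G. d (\<phi> g x) x \<le> r}"
    and cocompact: "\<exists>K. compactin mtopology K \<and> (\<Union>g\<in>carrier G. \<phi> g ` K) = M"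

definition virtually_Z :: "('g, 'm) monoid_scheme \<Rightarrow> bool" where
  "virtually_Z A \<longleftrightarrow>
     (\<exists>K. subgroup K A \<and> finite (rcosets\<^bsub>A\<^esub> K) \<and> A\<lparr>carrier := K\<rparr> \<cong> integer_group)"

end

theory Submission
  imports Defs "HOL-Algebra.Multiplicative_Group"
begin

text \<open>
  A set of pairwise disjoint curtains that separate two points is linearly nested, hence a chain.
  Fix a base point \<open>w\<close> and let \<open>r L x y\<close> be the maximal number of pairwise \<open>L\<close>-separated curtains
  that separate \<open>w\<close> from both \<open>x\<close> and \<open>y\<close>. Gluing such families shows that \<open>r L\<close> is the Gromov
  product of \<open>d_L\<close> up to an error linear in \<open>L\<close>, and that \<open>r L x z\<close> is at least
  \<open>min (r L x y) (r L y z)\<close> up to such an error, with the same alternative for all \<open>L\<close>. As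
  \<open>\<Sum>L. L * lam L\<close> converges, the curtain model is hyperbolic. Five pairwise \<open>L\<close>-separated curtains
  are a bottleneck: two geodesics that cross them come within \<open>2 L + 2\<close> of each other.

  Let \<open>\<xi>\<close>, \<open>\<eta>\<close> be the two limit points of \<open>H\<close>. By the bottleneck property there is a constant \<open>C\<close>
  such that the CAT(0) geodesics from sequences tending to \<open>\<xi>\<close> to sequences tending to \<open>\<eta>\<close>
  eventually pass within \<open>C\<close> of \<open>w\<close>. Since \<open>H\<close> permutes \<open>\<xi>\<close> and \<open>\<eta>\<close>, the same constant serves for
  every point of the orbit of \<open>w\<close>. So the Busemann function of \<open>\<xi>\<close> determines the position along the
  orbit up to a bounded error, and it is a proper quasimorphism on the stabilizer of \<open>\<xi>\<close>, which has
  index at most 2. A power of any element with a large value comes uniformly close to every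
  element of \<open>H\<close>.
\<close>

section \<open>Projection to geodesics in CAT(0) spaces\<close>


text \<open>The limit set lives in the metric \<open>D\<close>, while properness of the action is a
  statement about \<open>d\<close>; the bottleneck is the bridge. It turns a gap between two Gromov
  products of \<open>D\<close> into a point of a CAT(0) geodesic whose \<open>d\<close>-distance
  from \<open>w\<close> is bounded in terms of a single reference point. Neither a geodesic line
  from \<xi> to \<eta> nor a limit defining a Busemann function is constructed: all statements
  concern late members of sequences, with uniform additive errors. \<open>D\<close> is a sum over
  all levels \<open>L\<close>, and a minimum does not pass through a sum; hence the hyperbolic
  alternative must not depend on \<open>L\<close>. Conversely, a gap in the sum must show at some
  single level, and that level is bounded by a distance because more than \<open>L\<close> disjoint
  curtains then fit between two points. Five is two plus one plus two: a geodesic through the middle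
  curtain is well placed on one side of it, it is not known which, and on that side two
  \<open>L\<close>-separated curtains are used. In the quasimorphism estimate only the left factor
  has to fix \<xi>; so the criterion applies to \<open>H\<close> itself and not just to the
  stabilizer.\<close>

lemma comparison_triangle:
  fixes a b c :: real
  assumes "0 \<le> a" "0 \<le> b" "0 \<le> c" "a \<le> b + c" "b \<le> a + c" "c \<le> a + b"
  obtains x y z :: "real^2" where "dist x y = a" "dist x z = b" "dist y z = c"
proof -
  \<comment> \<open>Law of cosines: \<open>u\<close> is the coordinate of \<open>z\<close> along the
    side from \<open>x\<close> to \<open>y\<close>. For \<open>a = 0\<close> division by zero gives
    \<open>u = 0\<close>, and then \<open>b = c\<close>.\<close>
  define u where "u = (a\<^sup>2 + b\<^sup>2 - c\<^sup>2) / (2 * a)"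
  define v where "v = sqrt (b\<^sup>2 - u\<^sup>2)"
  have u: "2 * a * u = a\<^sup>2 + b\<^sup>2 - c\<^sup>2"
  proof (cases "a = 0")
    case True
    then have "b = c" using assms by simp
    then show ?thesis using True by simp
  qed (simp add: u_def)
  have "\<bar>u\<bar> \<le> b"
  proof (cases "a = 0")
    case False
    then have a: "a > 0" using assms by simp
    have "(a - b)\<^sup>2 \<le> c\<^sup>2" using assms by (intro abs_le_square_iff[THEN iffD1]) auto
    moreover have "c\<^sup>2 \<le> (a + b)\<^sup>2" using assms by (intro power_mono) auto
    ultimately have "a * u \<le> a * b" "a * (-b) \<le> a * u"
      using u by (auto simp: power2_eq_square algebra_simps)
    then have "u \<le> b" "- b \<le> u" using a by (simp_all only: mult_le_cancel_left_pos)
    then show ?thesis by (simp add: abs_le_iff)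
  qed (use assms in \<open>simp add: u_def\<close>)
  then have "u\<^sup>2 \<le> b\<^sup>2" using assms(2) by (metis abs_le_square_iff abs_of_nonneg)
  then have v: "v\<^sup>2 = b\<^sup>2 - u\<^sup>2" by (simp add: v_def)
  have *: "dist x y = e" if "(x$1 - y$1)\<^sup>2 + (x$2 - y$2)\<^sup>2 = e\<^sup>2" "0 \<le> e" for x y :: "real^2" and e
    using that by (simp add: dist_vec_def L2_set_def UNIV_2 dist_real_def real_sqrt_unique)
  show ?thesis
  proof (rule that[of "vector [0,0]" "vector [a,0]" "vector [u,v]"])
    show "dist (vector [0,0] :: real^2) (vector [a,0]) = a"
      by (rule *) (use assms in auto)
    show "dist (vector [0,0] :: real^2) (vector [u,v]) = b"
      by (rule *) (use assms v in auto)
    show "dist (vector [a,0] :: real^2) (vector [u,v]) = c"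
      by (rule *) (use assms v u in \<open>auto simp: power2_eq_square algebra_simps\<close>)
  qed
qed

text \<open>Stewart's theorem, the Euclidean equality behind \<open>CN_inequality\<close>.\<close>

lemma dist_convex_combination_sq:
  fixes x y z :: "'a::real_inner"
  shows "(dist ((1 - t) *\<^sub>R x + t *\<^sub>R y) z)\<^sup>2 =
    (1 - t) * (dist x z)\<^sup>2 + t * (dist y z)\<^sup>2 - t * (1 - t) * (dist x y)\<^sup>2"
proof -
  define u v where "u = x - z" and "v = y - z"
  have "(1 - t) *\<^sub>R x + t *\<^sub>R y - z = (1 - t) *\<^sub>R u + t *\<^sub>R v"
    by (simp add: u_def v_def algebra_simps)
  moreover have "(norm ((1 - t) *\<^sub>R u + t *\<^sub>R v))\<^sup>2 =
      (1 - t)\<^sup>2 * (u \<bullet> u) + 2 * (t * (1 - t)) * (u \<bullet> v) + t\<^sup>2 * (v \<bullet> v)"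
    unfolding power2_norm_eq_inner inner_add_left inner_add_right inner_scaleR_left inner_scaleR_right
      inner_commute[of v u] by (simp add: power2_eq_square algebra_simps)
  moreover have "x - y = u - v" by (simp add: u_def v_def)
  moreover have "(norm (u - v))\<^sup>2 = u \<bullet> u - 2 * (u \<bullet> v) + v \<bullet> v"
    unfolding power2_norm_eq_inner inner_diff_left inner_diff_right inner_commute[of v u] by simp
  ultimately show ?thesis
    unfolding dist_norm u_def[symmetric] v_def[symmetric]
    by (simp add: power2_norm_eq_inner[symmetric]) (simp add: power2_eq_square algebra_simps)
qed

section \<open>Geodesics and nearest points in a metric space\<close>

context Metric_space
begin

lemma geodesicD:
  assumes "geodesic I \<alpha>"
  shows "is_interval I" "closed I" "\<And>s. s \<in> I \<Longrightarrow> \<alpha> s \<in> M"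
    "\<And>s t. s \<in> I \<Longrightarrow> t \<in> I \<Longrightarrow> d (\<alpha> s) (\<alpha> t) = \<bar>s - t\<bar>"
  using assms by (simp_all add: geodesic_def Pi_iff)

lemma geodesic_interval:
  assumes "geodesic I \<alpha>" "a \<in> I" "b \<in> I"
  shows "{a..b} \<subseteq> I"
  using geodesicD(1)[OF assms(1)] assms(2,3) unfolding is_interval_1 by (meson atLeastAtMost_iff subsetI)

lemma geodesic_inj:
  assumes "geodesic I \<alpha>" shows "inj_on \<alpha> I"
proof (rule inj_onI)
  fix s t assume "s \<in> I" "t \<in> I" "\<alpha> s = \<alpha> t"
  then show "s = t" using geodesicD(4)[OF assms, of s t] geodesicD(4)[OF assms, of t t] by simp
qed

lemma geodesic_reverse:
  assumes "geodesic {0..l} \<alpha>" shows "geodesic {0..l} (\<lambda>t. \<alpha> (l - t))"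
proof -
  have "\<bar>s - t\<bar> = \<bar>l - s - (l - t)\<bar>" for s t by simp
  then show ?thesis using assms unfolding geodesic_def by (auto simp: Pi_iff)
qed

lemma geodesic_segment_subpath:
  assumes "geodesic I \<alpha>" "a \<in> I" "b \<in> I" "a \<le> b"
  shows "geodesic_segment (\<alpha> ` {a..b}) (\<alpha> a) (\<alpha> b)"
  unfolding geodesic_segment_def
proof (intro exI conjI)
  have sub: "{a..b} \<subseteq> I" using geodesic_interval assms by blast
  show "0 \<le> b - a" using assms by simp
  show "geodesic {0..b - a} (\<lambda>t. \<alpha> (a + t))"
    unfolding geodesic_def
  proof (intro conjI ballI funcsetI)
    fix s assume s: "s \<in> {0..b - a}"
    then have s': "a + s \<in> I" using sub by (auto intro!: subsetD[OF sub])
    then show "\<alpha> (a + s) \<in> M" using geodesicD(3)[OF assms(1)] by blast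
    fix t assume t: "t \<in> {0..b - a}"
    then have "a + t \<in> I" using sub by (auto intro!: subsetD[OF sub])
    then show "d (\<alpha> (a + s)) (\<alpha> (a + t)) = \<bar>s - t\<bar>" using geodesicD(4)[OF assms(1) s'] by simp
  qed (auto simp: is_interval_1)
  have "(\<lambda>t. a + t) ` {0..b - a} = {a..b}" by (auto intro!: image_eqI[of _ _ "_ - a"])
  then show "\<alpha> ` {a..b} = (\<lambda>t. \<alpha> (a + t)) ` {0..b - a}"
    by (metis image_image)
qed simp_all

lemma dist_geodesic_lipschitz:
  assumes "geodesic I \<alpha>" "x \<in> M" "s \<in> I" "t \<in> I"
  shows "\<bar>d x (\<alpha> s) - d x (\<alpha> t)\<bar> \<le> \<bar>s - t\<bar>"
  using triangle[of x "\<alpha> s" "\<alpha> t"] triangle[of x "\<alpha> t" "\<alpha> s"] geodesicD(3)[OF assms(1)]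
    geodesicD(4)[OF assms(1,3,4)] geodesicD(4)[OF assms(1,4,3)] assms by simp

lemma nearest_on_geodesic_exists:
  assumes g: "geodesic I \<alpha>" and "I \<noteq> {}" and x: "x \<in> M"
  shows "\<exists>t\<in>I. \<forall>s\<in>I. d x (\<alpha> t) \<le> d x (\<alpha> s)"
proof -
  obtain t0 where t0: "t0 \<in> I" using assms by blast
  \<comment> \<open>\<open>I\<close> may be unbounded, but a parameter farther than \<open>R\<close>
    from \<open>t0\<close> cannot be nearer to \<open>x\<close> than \<open>t0\<close> is; the
    minimum is sought in a compact part.\<close>
  define R where "R = 2 * d x (\<alpha> t0)"
  have "compact (I \<inter> cball t0 R)" using geodesicD(2)[OF g] by (simp add: closed_Int_compact)
  moreover have "t0 \<in> I \<inter> cball t0 R" using t0 by (simp add: R_def)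
  moreover have "continuous_on (I \<inter> cball t0 R) (\<lambda>t. d x (\<alpha> t))"
    unfolding continuous_on_iff dist_real_def
  proof (intro ballI allI impI)
    fix s e :: real assume s: "s \<in> I \<inter> cball t0 R" and "e > 0"
    then show "\<exists>\<delta>>0. \<forall>t\<in>I \<inter> cball t0 R. \<bar>t - s\<bar> < \<delta> \<longrightarrow> \<bar>d x (\<alpha> t) - d x (\<alpha> s)\<bar> < e"
      using dist_geodesic_lipschitz[OF g x] by (intro exI[of _ e]) fastforce
  qed
  ultimately obtain t where t: "t \<in> I \<inter> cball t0 R"
    "\<And>s. s \<in> I \<inter> cball t0 R \<Longrightarrow> d x (\<alpha> t) \<le> d x (\<alpha> s)"
    using continuous_attains_inf[of "I \<inter> cball t0 R" "\<lambda>t. d x (\<alpha> t)"] by blast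
  have "d x (\<alpha> t) \<le> d x (\<alpha> s)" if s: "s \<in> I" for s
  proof (cases "s \<in> cball t0 R")
    case False
    then have "2 * d x (\<alpha> t0) < \<bar>s - t0\<bar>" by (simp add: dist_real_def R_def abs_minus_commute)
    also have "\<dots> = d (\<alpha> s) (\<alpha> t0)" using geodesicD(4)[OF g s t0] by simp
    also have "\<dots> \<le> d x (\<alpha> s) + d x (\<alpha> t0)"
      using triangle[of "\<alpha> s" x "\<alpha> t0"] geodesicD(3)[OF g] s t0 x by (simp add: commute)
    finally have "d x (\<alpha> t0) \<le> d x (\<alpha> s)" by simp
    moreover have "d x (\<alpha> t) \<le> d x (\<alpha> t0)" using t(2) \<open>t0 \<in> I \<inter> cball t0 R\<close> by blast
    ultimately show ?thesis by simp
  qed (use t s in blast)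
  then show ?thesis using t(1) by blast
qed

text \<open>Working with the parameter instead of the point makes curtains and halfspaces preimages
  of real intervals. Uniqueness needs the CAT(0) inequality and comes later, hence
  \<open>SOME\<close>.\<close>

definition nearest_param :: "real set \<Rightarrow> (real \<Rightarrow> 'a) \<Rightarrow> 'a \<Rightarrow> real" where
  "nearest_param I \<alpha> x = (SOME t. t \<in> I \<and> (\<forall>s\<in>I. d x (\<alpha> t) \<le> d x (\<alpha> s)))"

lemma nearest_param:
  assumes "geodesic I \<alpha>" "I \<noteq> {}" "x \<in> M"
  shows nearest_param_in: "nearest_param I \<alpha> x \<in> I"
    and nearest_param_le: "\<And>s. s \<in> I \<Longrightarrow> d x (\<alpha> (nearest_param I \<alpha> x)) \<le> d x (\<alpha> s)"
proof -
  have "nearest_param I \<alpha> x \<in> I \<and> (\<forall>s\<in>I. d x (\<alpha> (nearest_param I \<alpha> x)) \<le> d x (\<alpha> s))"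
    unfolding nearest_param_def
    by (rule someI_ex) (use nearest_on_geodesic_exists[OF assms] in blast)
  then show "nearest_param I \<alpha> x \<in> I"
    "\<And>s. s \<in> I \<Longrightarrow> d x (\<alpha> (nearest_param I \<alpha> x)) \<le> d x (\<alpha> s)" by blast+
qed

end

section \<open>Nearest points under the CAT(0) inequality\<close>

context CAT0_space
begin

text \<open>The comparison axiom with the second point at the vertex \<open>z\<close>. Multiplying
  through by \<open>b - a\<close> avoids a division and admits the degenerate segment.\<close>

lemma CN_inequality:
  assumes g: "geodesic I \<alpha>" and ab: "a \<in> I" "b \<in> I" and s: "a \<le> s" "s \<le> b" and z: "z \<in> M"
  shows "(b - a) * (d z (\<alpha> s))\<^sup>2 \<le>
    (b - s) * (d z (\<alpha> a))\<^sup>2 + (s - a) * (d z (\<alpha> b))\<^sup>2 - (s - a) * (b - s) * (b - a)"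
proof (cases "a = b")
  case False
  then have lt: "a < b" using s by simp
  have sI: "s \<in> I" using geodesic_interval[OF g ab] s by auto
  note M = geodesicD(3)[OF g]
  define x y where "x = \<alpha> a" and "y = \<alpha> b"
  have xy: "x \<in> M" "y \<in> M" using M ab by (auto simp: x_def y_def)
  have dxy: "d x y = b - a" using geodesicD(4)[OF g ab] lt by (simp add: x_def y_def)
  have S: "geodesic_segment (\<alpha> ` {a..b}) x y"
    using geodesic_segment_subpath[OF g ab] lt by (simp add: x_def y_def)
  obtain T where T: "geodesic_segment T x z" using geodesic_space xy z by blast
  obtain U where U: "geodesic_segment U y z" using geodesic_space xy z by blast
  obtain x' y' z' :: "real^2" where tri: "dist x' y' = d x y" "dist x' z' = d x z" "dist y' z' = d y z"
    using comparison_triangle[of "d x y" "d x z" "d y z"] triangle[of x y z] triangle[of x z y]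
      triangle[of y x z] xy z by (auto simp: commute)
  define t where "t = (s - a) / (b - a)"
  have t: "0 \<le> t" "t \<le> 1" using s lt by (auto simp: t_def field_simps)
  define p' where "p' = (1 - t) *\<^sub>R x' + t *\<^sub>R y'"
  have p': "p' \<in> closed_segment x' y'" using t by (auto simp: p'_def closed_segment_def)
  have "dist x' p' = t * dist x' y'"
  proof -
    have "x' - p' = t *\<^sub>R (x' - y')" by (simp add: p'_def algebra_simps)
    then show ?thesis using t by (simp add: dist_norm)
  qed
  also have "\<dots> = s - a" using lt by (simp add: tri dxy t_def)
  also have "\<dots> = d x (\<alpha> s)" using geodesicD(4)[OF g ab(1) sI] s by (simp add: x_def)
  finally have dp: "dist x' p' = d x (\<alpha> s)" .
  have "z \<in> T" using T by (auto simp: geodesic_segment_def)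
  then have "d (\<alpha> s) z \<le> dist p' z'"
    using comparison[OF S T U tri _ p' dp _ _ tri(2)] s by auto
  then have "(d (\<alpha> s) z)\<^sup>2 \<le> (dist p' z')\<^sup>2" by (intro power_mono) auto
  also have "\<dots> = (1 - t) * (d x z)\<^sup>2 + t * (d y z)\<^sup>2 - t * (1 - t) * (b - a)\<^sup>2"
    unfolding p'_def dist_convex_combination_sq by (simp add: tri dxy)
  finally have "(b - a) * (d (\<alpha> s) z)\<^sup>2
     \<le> (b - a) * ((1 - t) * (d x z)\<^sup>2 + t * (d y z)\<^sup>2 - t * (1 - t) * (b - a)\<^sup>2)"
    using lt by (intro mult_left_mono) auto
  also have "\<dots> = ((b - a) * (1 - t)) * (d x z)\<^sup>2 + ((b - a) * t) * (d y z)\<^sup>2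
      - ((b - a) * t) * ((b - a) * (1 - t)) * (b - a)"
    by (simp add: algebra_simps power2_eq_square)
  also have "(b - a) * t = s - a" using lt by (simp add: t_def)
  also have "(b - a) * (1 - t) = b - s" using lt by (simp add: t_def field_simps)
  finally show ?thesis by (simp add: x_def y_def commute)
qed (use s in auto)

text \<open>First variation at the minimum: \<open>CN_inequality\<close> at the point
  \<open>t + e * (s - t)\<close>, compared with the minimal value, gives the claim with a factor
  \<open>1 - e\<close>, and \<open>e\<close> tends to 0.\<close>

lemma nearest_param_right_angle:
  assumes g: "geodesic I \<alpha>" and x: "x \<in> M" and t: "t \<in> I" "\<And>s. s \<in> I \<Longrightarrow> d x (\<alpha> t) \<le> d x (\<alpha> s)"
    and s: "s \<in> I"
  shows "(d x (\<alpha> t))\<^sup>2 + (s - t)\<^sup>2 \<le> (d x (\<alpha> s))\<^sup>2"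
proof (cases "s = t")
  case False
  have main: "(d x (\<alpha> t))\<^sup>2 + (1 - e) * (s - t)\<^sup>2 \<le> (d x (\<alpha> s))\<^sup>2" if e: "0 < e" "e \<le> 1" for e
  proof -
    define m where "m = t + e * (s - t)"
    define a b where "a = min s t" and "b = max s t"
    have ab: "a \<in> I" "b \<in> I" using s t by (auto simp: a_def b_def min_def max_def)
    have m: "a \<le> m" "m \<le> b"
    proof -
      have "m \<in> closed_segment t s" using e by (auto simp: m_def closed_segment_def algebra_simps intro!: exI[of _ e])
      then show "a \<le> m" "m \<le> b" by (auto simp: closed_segment_eq_real_ivl a_def b_def split: if_splits)
    qed
    have mI: "m \<in> I" using m geodesic_interval[OF g ab] by auto
    have le: "(d x (\<alpha> t))\<^sup>2 \<le> (d x (\<alpha> m))\<^sup>2" using t(2)[OF mI] by (intro power_mono) auto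
    have "\<bar>s - t\<bar> * (d x (\<alpha> m))\<^sup>2 \<le> \<bar>s - t\<bar> * ((1 - e) * (d x (\<alpha> t))\<^sup>2 + e * (d x (\<alpha> s))\<^sup>2
        - e * (1 - e) * (s - t)\<^sup>2)"
      using CN_inequality[OF g ab m x]
      by (cases "s < t") (auto simp: a_def b_def m_def power2_eq_square algebra_simps)
    then have "(d x (\<alpha> m))\<^sup>2 \<le> (1 - e) * (d x (\<alpha> t))\<^sup>2 + e * (d x (\<alpha> s))\<^sup>2
        - e * (1 - e) * (s - t)\<^sup>2"
      using False by (simp add: mult_le_cancel_left_pos)
    with le have "(d x (\<alpha> t))\<^sup>2 \<le> (1 - e) * (d x (\<alpha> t))\<^sup>2 + e * (d x (\<alpha> s))\<^sup>2
        - e * (1 - e) * (s - t)\<^sup>2" by linarith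
    then have "e * ((d x (\<alpha> t))\<^sup>2 + (1 - e) * (s - t)\<^sup>2) \<le> e * (d x (\<alpha> s))\<^sup>2"
      by (simp add: algebra_simps)
    then show ?thesis using e by simp
  qed
  show ?thesis
  proof (rule field_le_epsilon)
    fix e :: real assume "e > 0"
    define e' where "e' = min 1 (e / (s - t)\<^sup>2)"
    have pos: "(s - t)\<^sup>2 > 0" using False by simp
    have e': "0 < e'" "e' \<le> 1" using \<open>e > 0\<close> pos by (auto simp: e'_def)
    have "e' * (s - t)\<^sup>2 \<le> (e / (s - t)\<^sup>2) * (s - t)\<^sup>2" using pos by (intro mult_right_mono) (auto simp: e'_def)
    also have "\<dots> = e" using False by simp
    finally show "(d x (\<alpha> t))\<^sup>2 + (s - t)\<^sup>2 \<le> (d x (\<alpha> s))\<^sup>2 + e"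
      using main[OF e'] by (simp add: algebra_simps)
  qed
qed simp

lemma nearest_param_unique:
  assumes "geodesic I \<alpha>" "x \<in> M" "t \<in> I" "\<And>s. s \<in> I \<Longrightarrow> d x (\<alpha> t) \<le> d x (\<alpha> s)"
  shows "nearest_param I \<alpha> x = t"
proof -
  let ?u = "nearest_param I \<alpha> x"
  have u: "?u \<in> I" "d x (\<alpha> ?u) \<le> d x (\<alpha> t)"
    using nearest_param[OF assms(1) _ assms(2)] assms(3) by blast+
  have "(d x (\<alpha> ?u))\<^sup>2 \<le> (d x (\<alpha> t))\<^sup>2" using u by (intro power_mono) auto
  then have "(?u - t)\<^sup>2 \<le> 0"
    using nearest_param_right_angle[OF assms u(1)] by linarith
  then show ?thesis by simp
qed

lemma nearest_point_geodesic:
  assumes g: "geodesic I \<alpha>" "I \<noteq> {}" "x \<in> M"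
  shows "nearest_point (\<alpha> ` I) x = \<alpha> (nearest_param I \<alpha> x)"
  unfolding nearest_point_def
proof (rule the_equality)
  show "\<alpha> (nearest_param I \<alpha> x) \<in> \<alpha> ` I \<and> (\<forall>q\<in>\<alpha> ` I. d x (\<alpha> (nearest_param I \<alpha> x)) \<le> d x q)"
    using nearest_param[OF g] by auto
  show "p = \<alpha> (nearest_param I \<alpha> x)" if "p \<in> \<alpha> ` I \<and> (\<forall>q\<in>\<alpha> ` I. d x p \<le> d x q)" for p
    using that nearest_param_unique[OF g(1,3)] by fastforce
qed

lemma proj_preimage_iff:
  assumes "geodesic I \<alpha>" "I \<noteq> {}"
  shows "x \<in> proj_preimage I \<alpha> J \<longleftrightarrow> x \<in> M \<and> nearest_param I \<alpha> x \<in> J"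
proof (cases "x \<in> M")
  case True
  then have "\<alpha> (nearest_param I \<alpha> x) \<in> \<alpha> ` (I \<inter> J) \<longleftrightarrow> nearest_param I \<alpha> x \<in> J"
    using geodesic_inj[OF assms(1)] nearest_param_in[OF assms True] by (auto dest: inj_onD)
  then show ?thesis using True nearest_point_geodesic[OF assms True] by (simp add: proj_preimage_def)
qed (simp add: proj_preimage_def)

lemma nearest_param_self:
  assumes "geodesic I \<alpha>" "t \<in> I"
  shows "nearest_param I \<alpha> (\<alpha> t) = t"
proof (rule nearest_param_unique[OF assms(1) geodesicD(3)[OF assms] assms(2)])
  show "d (\<alpha> t) (\<alpha> t) \<le> d (\<alpha> t) (\<alpha> s)" for s using geodesicD(4)[OF assms(1,2,2)] by simp
qed

text \<open>The hypothesis \<open>eq\<close> puts \<open>y\<close> on a geodesic from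
  \<open>x\<close> to its foot. So each fibre of the projection contains the segments from its
  points to the foot, which is what makes preimages of intervals connected.\<close>

lemma nearest_param_on_segment:
  assumes g: "geodesic I \<alpha>" "I \<noteq> {}" and x: "x \<in> M" and y: "y \<in> M"
    and eq: "d x y + d y (\<alpha> (nearest_param I \<alpha> x)) \<le> d x (\<alpha> (nearest_param I \<alpha> x))"
  shows "nearest_param I \<alpha> y = nearest_param I \<alpha> x"
proof (rule nearest_param_unique[OF g(1) y nearest_param_in[OF g x]])
  fix s assume s: "s \<in> I"
  have "d x (\<alpha> s) \<le> d x y + d y (\<alpha> s)" using triangle[OF x y geodesicD(3)[OF g(1) s]] .
  then show "d y (\<alpha> (nearest_param I \<alpha> x)) \<le> d y (\<alpha> s)"
    using nearest_param_le[OF g x s] eq by simp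
qed

lemma obtain_geodesic:
  assumes "x \<in> M" "y \<in> M"
  obtains \<alpha> where "geodesic {0..d x y} \<alpha>" "\<alpha> 0 = x" "\<alpha> (d x y) = y"
proof -
  obtain S where "geodesic_segment S x y" using geodesic_space assms by blast
  then obtain l \<alpha> where l: "0 \<le> l" "geodesic {0..l} \<alpha>" "\<alpha> 0 = x" "\<alpha> l = y"
    unfolding geodesic_segment_def by blast
  moreover have "d x y = l" using geodesicD(4)[OF l(2), of 0 l] l by simp
  ultimately show ?thesis using that by blast
qed

text \<open>Diagonals against sides. \<open>CN_inequality\<close> at the midpoint \<open>m\<close>
  of one diagonal bounds the distances from \<open>m\<close> to the other two vertices, and their
  distance is bounded by way of \<open>m\<close>.\<close>

lemma quadrilateral_inequality:
  assumes M: "x \<in> M" "p \<in> M" "q \<in> M" "y \<in> M"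
  shows "(d x q)\<^sup>2 + (d y p)\<^sup>2 \<le> (d x p)\<^sup>2 + (d p q)\<^sup>2 + (d q y)\<^sup>2 + (d y x)\<^sup>2"
proof -
  define l where "l = d x q"
  obtain \<alpha> where \<alpha>: "geodesic {0..l} \<alpha>" "\<alpha> 0 = x" "\<alpha> l = q" using obtain_geodesic M l_def by metis
  define m where "m = \<alpha> (l/2)"
  have l: "0 \<le> l" by (simp add: l_def)
  have m: "m \<in> M" using geodesicD(3)[OF \<alpha>(1)] l by (simp add: m_def)
  have mid: "4 * (d z m)\<^sup>2 \<le> 2 * (d z x)\<^sup>2 + 2 * (d z q)\<^sup>2 - l\<^sup>2" if z: "z \<in> M" for z
  proof (cases "l = 0")
    case True
    then show ?thesis using \<alpha> by (simp add: m_def)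
  next
    case False
    then have "l > 0" using l by simp
    have "l * (d z m)\<^sup>2 \<le> l/2 * (d z x)\<^sup>2 + l/2 * (d z q)\<^sup>2 - l/2 * (l/2) * l"
      using CN_inequality[OF \<alpha>(1), of 0 l "l/2" z] z l by (simp add: m_def \<alpha>)
    then have "l * (4 * (d z m)\<^sup>2) \<le> l * (2 * (d z x)\<^sup>2 + 2 * (d z q)\<^sup>2 - l\<^sup>2)"
      by (simp add: algebra_simps power2_eq_square)
    then show ?thesis using \<open>l > 0\<close> by simp
  qed
  have "(d y p)\<^sup>2 \<le> (d y m + d p m)\<^sup>2"
    using triangle[OF M(4) m M(2)] unfolding commute[of m p] by (intro power_mono) auto
  also have "\<dots> \<le> 2 * (d y m)\<^sup>2 + 2 * (d p m)\<^sup>2"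
    using sum_squares_bound[of "d y m" "d p m"] by (simp add: power2_sum)
  finally show ?thesis using mid[OF M(4)] mid[OF M(2)]
    unfolding l_def commute[of y q] commute[of p x] by linarith
qed

text \<open>Add the right-angle inequalities at the two feet to the quadrilateral inequality for
  \<open>x\<close>, the two feet and \<open>y\<close>; all squares cancel but those of the two sides
  being compared.\<close>

lemma nearest_param_lipschitz:
  assumes g: "geodesic I \<alpha>" "I \<noteq> {}" and x: "x \<in> M" and y: "y \<in> M"
  shows "\<bar>nearest_param I \<alpha> x - nearest_param I \<alpha> y\<bar> \<le> d x y"
proof -
  let ?s = "nearest_param I \<alpha> x" and ?t = "nearest_param I \<alpha> y"
  have st: "?s \<in> I" "?t \<in> I" using nearest_param_in g x y by auto
  note M = geodesicD(3)[OF g(1)] and D = geodesicD(4)[OF g(1)]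
  have 1: "(d x (\<alpha> ?s))\<^sup>2 + (?t - ?s)\<^sup>2 \<le> (d x (\<alpha> ?t))\<^sup>2"
    using nearest_param_right_angle[OF g(1) x st(1) nearest_param_le[OF g x] st(2)] by blast
  have 2: "(d y (\<alpha> ?t))\<^sup>2 + (?s - ?t)\<^sup>2 \<le> (d y (\<alpha> ?s))\<^sup>2"
    using nearest_param_right_angle[OF g(1) y st(2) nearest_param_le[OF g y] st(1)] by blast
  have 3: "(?s - ?t)\<^sup>2 = (?t - ?s)\<^sup>2" by (simp add: power2_commute)
  have "(?s - ?t)\<^sup>2 \<le> (d x y)\<^sup>2"
    using 1 2 3 quadrilateral_inequality[OF x M[OF st(1)] M[OF st(2)] y]
    unfolding D[OF st] power2_abs commute[of "\<alpha> ?t" y] commute[of y x] by linarith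
  then show ?thesis by (simp add: abs_le_square_iff[symmetric])
qed

text \<open>The angle at \<open>\<alpha> 0\<close> is acute: the squared distance is smaller at the
  foot than at the start, and by convexity it stays below its initial value all the way to the
  foot.\<close>

lemma nearest_param_ne_start:
  assumes g: "geodesic {0..l} \<alpha>" "0 \<le> l" and x: "x \<in> M" and s: "nearest_param {0..l} \<alpha> x \<noteq> 0"
  shows "\<exists>s>0. s \<le> l \<and> (\<forall>e. 0 < e \<and> e \<le> s \<longrightarrow> d x (\<alpha> e) < d x (\<alpha> 0))"
proof -
  let ?s = "nearest_param {0..l} \<alpha> x"
  have ne: "{0..l} \<noteq> {}" using g by simp
  have sI: "?s \<in> {0..l}" using nearest_param_in[OF g(1) ne x] .
  have "d x (\<alpha> e) < d x (\<alpha> 0)" if e: "0 < e" "e \<le> ?s" for e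
  proof -
    have le: "(d x (\<alpha> ?s))\<^sup>2 \<le> (d x (\<alpha> 0))\<^sup>2"
      using nearest_param_le[OF g(1) ne x, of 0] g by (intro power_mono) auto
    have lt: "(d x (\<alpha> ?s))\<^sup>2 < (d x (\<alpha> 0))\<^sup>2"
      using nearest_param_right_angle[OF g(1) x sI nearest_param_le[OF g(1) ne x], of 0] s g
      by (smt (verit) atLeastAtMost_iff zero_less_power2)
    have "?s * (d x (\<alpha> e))\<^sup>2 \<le> (?s - e) * (d x (\<alpha> 0))\<^sup>2 + e * (d x (\<alpha> ?s))\<^sup>2 - e * (?s - e) * ?s"
      using CN_inequality[OF g(1), of 0 ?s e x] sI e x g by simp
    also have "\<dots> < ?s * (d x (\<alpha> 0))\<^sup>2"
    proof -
      have "0 \<le> e * (?s - e) * ?s" using e by simp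
      moreover have "e * (d x (\<alpha> ?s))\<^sup>2 < e * (d x (\<alpha> 0))\<^sup>2" using lt e by simp
      ultimately show ?thesis by (simp add: algebra_simps)
    qed
    finally have "(d x (\<alpha> e))\<^sup>2 < (d x (\<alpha> 0))\<^sup>2" using e by simp
    then show ?thesis by (simp add: power_less_imp_less_base)
  qed
  then show ?thesis using sI s by (intro exI[of _ ?s]) auto
qed

text \<open>The angles at \<open>p\<close> on the two sides of the geodesic \<open>[x, y]\<close> add up to at least \<open>\<pi>\<close>, so one of
  them is not acute.\<close>

lemma nearest_param_start_or:
  assumes g: "geodesic {0..l} \<alpha>" "0 \<le> l" and xy: "x \<in> M" "y \<in> M"
    and eq: "d x (\<alpha> 0) + d (\<alpha> 0) y = d x y"
  shows "nearest_param {0..l} \<alpha> x = 0 \<or> nearest_param {0..l} \<alpha> y = 0"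
proof (rule ccontr)
  assume "\<not> ?thesis"
  then obtain s t where s: "0 < s" "s \<le> l" "\<And>e. 0 < e \<Longrightarrow> e \<le> s \<Longrightarrow> d x (\<alpha> e) < d x (\<alpha> 0)"
    and t: "0 < t" "t \<le> l" "\<And>e. 0 < e \<Longrightarrow> e \<le> t \<Longrightarrow> d y (\<alpha> e) < d y (\<alpha> 0)"
    using nearest_param_ne_start[OF g xy(1)] nearest_param_ne_start[OF g xy(2)] by auto
  define e where "e = min s t"
  have "d x (\<alpha> e) < d x (\<alpha> 0)" "d y (\<alpha> e) < d y (\<alpha> 0)" "\<alpha> e \<in> M"
    using s t geodesicD(3)[OF g(1)] by (auto simp: e_def)
  then show False using triangle[of x "\<alpha> e" y] xy eq by (simp add: commute)
qed

text \<open>The right angle at the foot of a perpendicular can be read from either side.\<close>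

lemma nearest_param_perpendicular:
  assumes b: "geodesic I \<beta>" "I \<noteq> {}" and p: "p \<in> M"
    and g: "geodesic {0..l} \<alpha>" "0 \<le> l" "\<alpha> 0 = \<beta> (nearest_param I \<beta> p)" "\<alpha> l = p" and s: "s \<in> I"
  shows "nearest_param {0..l} \<alpha> (\<beta> s) = 0"
proof (rule nearest_param_unique[OF g(1)])
  show bs: "\<beta> s \<in> M" using geodesicD(3)[OF b(1) s] .
  show "0 \<in> {0..l}" using g by simp
  let ?t = "nearest_param I \<beta> p"
  have tI: "?t \<in> I" using nearest_param_in[OF b p] .
  fix e assume e: "e \<in> {0..l}"
  have eM: "\<alpha> e \<in> M" using geodesicD(3)[OF g(1) e] .
  have "d p (\<alpha> e) + d (\<alpha> e) (\<alpha> 0) = d p (\<alpha> 0)"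
    using geodesicD(4)[OF g(1), of l e] geodesicD(4)[OF g(1), of e 0] geodesicD(4)[OF g(1), of l 0] e g(2,4) by simp
  then have eq: "nearest_param I \<beta> (\<alpha> e) = ?t"
    using nearest_param_on_segment[OF b p eM] g by simp
  have "(d (\<alpha> e) (\<beta> ?t))\<^sup>2 + (s - ?t)\<^sup>2 \<le> (d (\<alpha> e) (\<beta> s))\<^sup>2"
    using nearest_param_right_angle[OF b(1) eM tI _ s] nearest_param_le[OF b eM] eq by simp
  then have "(s - ?t)\<^sup>2 \<le> (d (\<alpha> e) (\<beta> s))\<^sup>2" by (smt (verit) zero_le_power2)
  moreover have "(d (\<beta> s) (\<beta> ?t))\<^sup>2 = (s - ?t)\<^sup>2" using geodesicD(4)[OF b(1) s tI] by simp
  ultimately have "(d (\<beta> s) (\<alpha> 0))\<^sup>2 \<le> (d (\<beta> s) (\<alpha> e))\<^sup>2" using g by (simp add: commute)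
  then show "d (\<beta> s) (\<alpha> 0) \<le> d (\<beta> s) (\<alpha> e)" by (simp add: power2_le_iff_abs_le)
qed

end


section \<open>Curtains and their halfspaces\<close>

context Metric_space
begin

lemma geodesic_image_connected:
  assumes g: "geodesic I \<alpha>" and J: "J \<subseteq> I" "is_interval J"
  shows "connectedin mtopology (\<alpha> ` J)"
proof (rule connectedin_continuous_map_image)
  show "continuous_map (top_of_set I) mtopology \<alpha>"
    unfolding continuous_map_to_metric
  proof (intro ballI allI impI)
    fix s e :: real assume s: "s \<in> topspace (top_of_set I)" and e: "e > 0"
    have "\<alpha> t \<in> mball (\<alpha> s) e" if "t \<in> I \<inter> ball s e" for t
      using that s geodesicD(3,4)[OF g] by (auto simp: dist_real_def)
    moreover have "openin (top_of_set I) (I \<inter> ball s e)" by (simp add: openin_open_Int)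
    ultimately show "\<exists>U. openin (top_of_set I) U \<and> s \<in> U \<and> (\<forall>t\<in>U. \<alpha> t \<in> mball (\<alpha> s) e)"
      using s e by (intro exI[of _ "I \<inter> ball s e"]) auto
  qed
  show "connectedin (top_of_set I) J"
    using J by (auto simp: connectedin_subtopology is_interval_connected)
qed

text \<open>A curtain with its two halfspaces, in either order, and with the geodesic forgotten. By
  \<open>wall_unique\<close> the choice of geodesic does not matter.\<close>

definition wall :: "'a set \<Rightarrow> 'a set \<Rightarrow> 'a set \<Rightarrow> bool" where
  "wall k A B \<longleftrightarrow> (\<exists>I \<alpha> r. curtain_at I \<alpha> r k \<and>
     (A = minus_halfspace I \<alpha> r \<and> B = plus_halfspace I \<alpha> r \<or>
      A = plus_halfspace I \<alpha> r \<and> B = minus_halfspace I \<alpha> r))"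

lemma wall_sym: "wall k A B \<Longrightarrow> wall k B A"
  unfolding wall_def by blast

lemma curtain_imp_wall: "curtain k \<Longrightarrow> \<exists>A B. wall k A B"
  unfolding wall_def curtain_def by blast

lemma curtain_separates_iff: "curtain_separates k S T \<longleftrightarrow> (\<exists>A B. wall k A B \<and> S \<subseteq> A \<and> T \<subseteq> B)"
proof
  assume "curtain_separates k S T"
  then obtain I \<alpha> r where c: "curtain_at I \<alpha> r k"
    and "S \<subseteq> minus_halfspace I \<alpha> r \<and> T \<subseteq> plus_halfspace I \<alpha> r \<or>
      S \<subseteq> plus_halfspace I \<alpha> r \<and> T \<subseteq> minus_halfspace I \<alpha> r"
    unfolding curtain_separates_def by blast
  moreover have "wall k (minus_halfspace I \<alpha> r) (plus_halfspace I \<alpha> r)"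
    "wall k (plus_halfspace I \<alpha> r) (minus_halfspace I \<alpha> r)" using c unfolding wall_def by blast+
  ultimately show "\<exists>A B. wall k A B \<and> S \<subseteq> A \<and> T \<subseteq> B" by blast
next
  assume "\<exists>A B. wall k A B \<and> S \<subseteq> A \<and> T \<subseteq> B"
  then obtain A B where "wall k A B" "S \<subseteq> A" "T \<subseteq> B" by blast
  then obtain I \<alpha> r where "curtain_at I \<alpha> r k"
    "S \<subseteq> minus_halfspace I \<alpha> r \<and> T \<subseteq> plus_halfspace I \<alpha> r \<or>
      S \<subseteq> plus_halfspace I \<alpha> r \<and> T \<subseteq> minus_halfspace I \<alpha> r"
    unfolding wall_def by blast
  then show "curtain_separates k S T" unfolding curtain_separates_def by blast
qed

lemma curtain_separatesE:
  assumes "curtain_separates k S T"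
  obtains A B where "wall k A B" "S \<subseteq> A" "T \<subseteq> B"
  using assms unfolding curtain_separates_iff by blast

lemma curtain_separatesI: "wall k A B \<Longrightarrow> S \<subseteq> A \<Longrightarrow> T \<subseteq> B \<Longrightarrow> curtain_separates k S T"
  unfolding curtain_separates_iff by blast

lemma curtain_separates_curtain: "curtain_separates k S T \<Longrightarrow> curtain k"
  unfolding curtain_separates_def curtain_def by blast

lemma curtain_separates_sym: "curtain_separates k S T \<Longrightarrow> curtain_separates k T S"
  by (erule curtain_separatesE) (rule curtain_separatesI[OF wall_sym])

lemma curtain_separates_mono:
  "curtain_separates k S T \<Longrightarrow> S' \<subseteq> S \<Longrightarrow> T' \<subseteq> T \<Longrightarrow> curtain_separates k S' T'"
  unfolding curtain_separates_iff by blast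

end

context CAT0_space
begin

lemma segment_to_projection:
  assumes g: "geodesic I \<alpha>" "I \<noteq> {}" and x: "x \<in> M"
  shows "\<exists>T. connectedin mtopology T \<and> x \<in> T \<and> \<alpha> (nearest_param I \<alpha> x) \<in> T \<and>
    (\<forall>y\<in>T. nearest_param I \<alpha> y = nearest_param I \<alpha> x)"
proof -
  define q where "q = \<alpha> (nearest_param I \<alpha> x)"
  have q: "q \<in> M" using geodesicD(3)[OF g(1) nearest_param_in[OF g x]] by (simp add: q_def)
  obtain \<gamma> where \<gamma>: "geodesic {0..d x q} \<gamma>" "\<gamma> 0 = x" "\<gamma> (d x q) = q" using obtain_geodesic[OF x q] .
  have "nearest_param I \<alpha> y = nearest_param I \<alpha> x" if y: "y \<in> \<gamma> ` {0..d x q}" for y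
  proof (rule nearest_param_on_segment[OF g x])
    obtain t where t: "t \<in> {0..d x q}" "y = \<gamma> t" using y by blast
    show "y \<in> M" using geodesicD(3)[OF \<gamma>(1) t(1)] t by simp
    show "d x y + d y (\<alpha> (nearest_param I \<alpha> x)) \<le> d x (\<alpha> (nearest_param I \<alpha> x))"
      using geodesicD(4)[OF \<gamma>(1), of 0 t] geodesicD(4)[OF \<gamma>(1), of t "d x q"] t \<gamma>(2,3)
      by (simp add: q_def)
  qed
  moreover have "connectedin mtopology (\<gamma> ` {0..d x q})"
    by (rule geodesic_image_connected[OF \<gamma>(1)]) (auto simp: is_interval_cc)
  moreover have "x \<in> \<gamma> ` {0..d x q}" "q \<in> \<gamma> ` {0..d x q}"
    using \<gamma>(2,3) by (force intro: image_eqI[of _ _ 0], force intro: image_eqI[of _ _ "d x q"])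
  ultimately show ?thesis unfolding q_def[symmetric] by blast
qed

text \<open>Two points of the preimage are joined by their segments to the geodesic, along which the
  projection is constant, and by the piece \<open>W\<close> of the geodesic itself.\<close>

lemma nearest_param_vimage_connected:
  assumes g: "geodesic I \<alpha>" "I \<noteq> {}" and J: "is_interval J"
  shows "connectedin mtopology {x \<in> M. nearest_param I \<alpha> x \<in> J}" (is "connectedin _ ?S")
  unfolding connectedin_def
proof (intro conjI)
  show "?S \<subseteq> topspace mtopology" by auto
  show "connected_space (subtopology mtopology ?S)"
    unfolding connected_space_subconnected connectedin_subtopology
  proof (intro ballI)
    fix x y assume "x \<in> topspace (subtopology mtopology ?S)" "y \<in> topspace (subtopology mtopology ?S)"
    then have xy: "x \<in> M" "y \<in> M" "nearest_param I \<alpha> x \<in> J" "nearest_param I \<alpha> y \<in> J" by auto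
    obtain T where T: "connectedin mtopology T" "x \<in> T" "\<alpha> (nearest_param I \<alpha> x) \<in> T"
      "\<And>y. y \<in> T \<Longrightarrow> nearest_param I \<alpha> y = nearest_param I \<alpha> x"
      using segment_to_projection[OF g xy(1)] by blast
    obtain U where U: "connectedin mtopology U" "y \<in> U" "\<alpha> (nearest_param I \<alpha> y) \<in> U"
      "\<And>z. z \<in> U \<Longrightarrow> nearest_param I \<alpha> z = nearest_param I \<alpha> y"
      using segment_to_projection[OF g xy(2)] by blast
    define W where "W = \<alpha> ` (I \<inter> J)"
    have "is_interval (I \<inter> J)" using J geodesicD(1)[OF g(1)] by (rule is_interval_Int[rotated])
    then have W: "connectedin mtopology W"
      unfolding W_def by (intro geodesic_image_connected[OF g(1)]) auto
    have "\<alpha> (nearest_param I \<alpha> x) \<in> W" "\<alpha> (nearest_param I \<alpha> y) \<in> W"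
      using nearest_param_in[OF g] xy by (auto simp: W_def)
    then have "connectedin mtopology (T \<union> W)" "connectedin mtopology (U \<union> W)"
      using connectedin_Un T(1,3) U(1,3) W by (blast, blast)
    then have "connectedin mtopology ((T \<union> W) \<union> (U \<union> W))"
      using \<open>\<alpha> (nearest_param I \<alpha> x) \<in> W\<close> connectedin_Un by blast
    moreover have "(T \<union> W) \<union> (U \<union> W) \<subseteq> ?S"
    proof -
      have "T \<subseteq> M" "U \<subseteq> M"
        using connectedin_subset_topspace[OF T(1)] connectedin_subset_topspace[OF U(1)] by simp_all
      moreover have "W \<subseteq> ?S"
        using geodesicD(3)[OF g(1)] nearest_param_self[OF g(1)] by (fastforce simp: W_def)
      moreover have "T \<subseteq> ?S" "U \<subseteq> ?S" using T(4) U(4) xy(3,4) \<open>T \<subseteq> M\<close> \<open>U \<subseteq> M\<close> by auto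
      ultimately show ?thesis by blast
    qed
    ultimately show "\<exists>S. (connectedin mtopology S \<and> S \<subseteq> ?S) \<and> x \<in> S \<and> y \<in> S"
      using T(2) U(2) by blast
  qed
qed

text \<open>The function \<open>g\<close> is the signed distance from the centre of the curtain to the projection.\<close>

lemma wall_function:
  assumes "wall k A B"
  shows "\<exists>g :: 'a \<Rightarrow> real. (\<forall>x\<in>M. \<forall>y\<in>M. \<bar>g x - g y\<bar> \<le> d x y) \<and>
    k = {x \<in> M. \<bar>g x\<bar> \<le> 1/2} \<and> A = {x \<in> M. g x < -1/2} \<and> B = {x \<in> M. g x > 1/2} \<and>
    (\<forall>J. is_interval J \<longrightarrow> connectedin mtopology {x \<in> M. g x \<in> J}) \<and> k \<noteq> {}"
proof -
  obtain I \<alpha> r where c: "curtain_at I \<alpha> r k"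
    and AB: "A = minus_halfspace I \<alpha> r \<and> B = plus_halfspace I \<alpha> r \<or>
      A = plus_halfspace I \<alpha> r \<and> B = minus_halfspace I \<alpha> r"
    using assms unfolding wall_def by blast
  have g: "geodesic I \<alpha>" and int: "{r - 1/2 .. r + 1/2} \<subseteq> interior I"
    and k: "k = dual_curtain I \<alpha> r" using c unfolding curtain_at_def by blast+
  have rI: "r \<in> I" using int interior_subset by fastforce
  then have ne: "I \<noteq> {}" by blast
  let ?t = "nearest_param I \<alpha>"
  have k': "k = {x \<in> M. \<bar>?t x - r\<bar> \<le> 1/2}"
  proof -
    have "u \<in> {r - 1/2 .. r + 1/2} \<longleftrightarrow> \<bar>u - r\<bar> \<le> 1/2" for u
      unfolding atLeastAtMost_iff abs_le_iff by auto
    then show ?thesis unfolding k dual_curtain_def using proj_preimage_iff[OF g ne] by blast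
  qed
  have m: "minus_halfspace I \<alpha> r = {x \<in> M. ?t x - r < - 1/2}"
    and p: "plus_halfspace I \<alpha> r = {x \<in> M. ?t x - r > 1/2}"
    unfolding minus_halfspace_def plus_halfspace_def by (auto simp: proj_preimage_iff[OF g ne])
  have lip: "\<bar>(?t x - r) - (?t y - r)\<bar> \<le> d x y" "\<bar>(r - ?t x) - (r - ?t y)\<bar> \<le> d x y"
    if "x \<in> M" "y \<in> M" for x y
    using nearest_param_lipschitz[OF g ne that] by simp_all
  have con: "connectedin mtopology {x \<in> M. ?t x - r \<in> J}" "connectedin mtopology {x \<in> M. r - ?t x \<in> J}"
    if J: "is_interval J" for J
  proof -
    have "is_interval ((+) r ` J)" using J is_interval_translation by blast
    moreover have "?t x - r \<in> J \<longleftrightarrow> ?t x \<in> (+) r ` J" for x by (auto intro: image_eqI[of _ _ "?t x - r"])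
    ultimately show "connectedin mtopology {x \<in> M. ?t x - r \<in> J}"
      using nearest_param_vimage_connected[OF g ne] by simp
    have "is_interval ((-) r ` J)" using J by (rule is_interval_minus_translation[THEN iffD2, rule_format])
    moreover have "r - ?t x \<in> J \<longleftrightarrow> ?t x \<in> (-) r ` J" for x by (auto intro: image_eqI[of _ _ "r - ?t x"])
    ultimately show "connectedin mtopology {x \<in> M. r - ?t x \<in> J}"
      using nearest_param_vimage_connected[OF g ne] by simp
  qed
  have on: "\<alpha> s \<in> M \<and> ?t (\<alpha> s) = s" if "s \<in> I" for s
    using geodesicD(3)[OF g that] nearest_param_self[OF g that] by simp
  have k_ne: "k \<noteq> {}" unfolding k' using on[OF rI] by fastforce
  from AB show ?thesis
  proof
    assume AB: "A = minus_halfspace I \<alpha> r \<and> B = plus_halfspace I \<alpha> r"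
    show ?thesis
      by (intro exI[of _ "\<lambda>x. ?t x - r"]) (use AB lip(1) k' m p con(1) k_ne in blast)
  next
    assume AB: "A = plus_halfspace I \<alpha> r \<and> B = minus_halfspace I \<alpha> r"
    have "k = {x \<in> M. \<bar>r - ?t x\<bar> \<le> 1/2}" using k' by (simp add: abs_minus_commute)
    moreover have "A = {x \<in> M. r - ?t x < - 1/2}" "B = {x \<in> M. r - ?t x > 1/2}" using AB m p by auto
    ultimately show ?thesis
      by (intro exI[of _ "\<lambda>x. r - ?t x"]) (use AB lip(2) con(2) k_ne in blast)
  qed
qed

lemma wall_partition:
  assumes "wall k A B"
  shows "A \<union> k \<union> B = M" "A \<inter> B = {}" "A \<inter> k = {}" "B \<inter> k = {}"
proof -
  obtain g :: "'a \<Rightarrow> real" where g: "k = {x \<in> M. \<bar>g x\<bar> \<le> 1/2}" "A = {x \<in> M. g x < -1/2}"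
    "B = {x \<in> M. g x > 1/2}"
    using wall_function[OF assms] by blast
  have "u < -1/2 \<or> \<bar>u\<bar> \<le> 1/2 \<or> u > 1/2" "\<not> (u < -1/2 \<and> u > 1/2)" "\<not> (u < -1/2 \<and> \<bar>u\<bar> \<le> 1/2)"
    "\<not> (u > 1/2 \<and> \<bar>u\<bar> \<le> 1/2)" for u :: real by linarith+
  then show "A \<union> k \<union> B = M" "A \<inter> B = {}" "A \<inter> k = {}" "B \<inter> k = {}" unfolding g by blast+
qed

lemma wall_nonempty: "wall k A B \<Longrightarrow> k \<noteq> {}"
  using wall_function by blast

lemma wall_connected:
  assumes "wall k A B"
  shows "connectedin mtopology A" "connectedin mtopology k" "connectedin mtopology (A \<union> k)"
proof -
  obtain g :: "'a \<Rightarrow> real" where g: "k = {x \<in> M. \<bar>g x\<bar> \<le> 1/2}" "A = {x \<in> M. g x < -1/2}"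
    "\<And>J. is_interval J \<Longrightarrow> connectedin mtopology {x \<in> M. g x \<in> J}"
    using wall_function[OF assms] by blast
  have "A = {x \<in> M. g x \<in> {..< -1/2}}" "k = {x \<in> M. g x \<in> {-1/2..1/2}}"
    "A \<union> k = {x \<in> M. g x \<in> {..1/2}}" using g(1,2) by auto
  then show "connectedin mtopology A" "connectedin mtopology k" "connectedin mtopology (A \<union> k)"
    using g(3)[of "{..< -1/2}"] g(3)[of "{-1/2..1/2}"] g(3)[of "{..1/2}"]
    by (simp_all only: is_interval_io is_interval_cc is_interval_ic)
qed

lemma wall_open:
  assumes "wall k A B" shows "openin mtopology A"
proof -
  obtain g :: "'a \<Rightarrow> real" where g: "\<And>x y. x \<in> M \<Longrightarrow> y \<in> M \<Longrightarrow> \<bar>g x - g y\<bar> \<le> d x y"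
    "A = {x \<in> M. g x < -1/2}"
    using wall_function[OF assms] by blast
  have "\<exists>r>0. mball x r \<subseteq> A" if "x \<in> A" for x
  proof (intro exI conjI subsetI)
    show "0 < - 1/2 - g x" using that g by simp
    fix y assume "y \<in> mball x (- 1/2 - g x)"
    then show "y \<in> A" using g(1)[of x y] g(2) by auto
  qed
  then show ?thesis unfolding openin_mtopology using g(2) by auto
qed

lemma wall_crossing:
  assumes w: "wall k A B" and C: "connectedin mtopology C" "C \<inter> A \<noteq> {}" "C \<inter> B \<noteq> {}"
  shows "C \<inter> k \<noteq> {}"
proof
  assume "C \<inter> k = {}"
  moreover have "C \<subseteq> M" using connectedin_subset_topspace[OF C(1)] by simp
  ultimately have "C \<subseteq> A \<union> B" using wall_partition[OF w] by blast
  then show False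
    using connectedinD[OF C(1) wall_open[OF w] wall_open[OF wall_sym[OF w]]] C(2,3) wall_partition(2)[OF w]
    by blast
qed

lemma wall_connected_side:
  assumes w: "wall k A B" and C: "connectedin mtopology C" "C \<inter> k = {}" "C \<inter> A \<noteq> {}"
  shows "C \<subseteq> A"
  using wall_crossing[OF w C(1)] C(2,3) wall_partition(1)[OF w] connectedin_subset_topspace[OF C(1)]
  by auto

text \<open>A halfspace is connected and misses \<open>k\<close>, so it cannot leave a halfspace of
  the other description that it meets. This allows separations by the same curtain, given by
  different geodesics, to be merged.\<close>

lemma wall_unique:
  assumes w: "wall k A B" and w': "wall k A' B'" and ne: "A \<inter> A' \<noteq> {}"
  shows "A = A'" "B = B'"
proof -
  have "A \<subseteq> A'" using wall_connected_side[OF w' wall_connected(1)[OF w]] ne wall_partition(3)[OF w] by blast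
  moreover have "A' \<subseteq> A" using wall_connected_side[OF w wall_connected(1)[OF w']] ne wall_partition(3)[OF w'] by blast
  ultimately show "A = A'" by blast
  moreover have "B = M - (A \<union> k)" using wall_partition[OF w] by blast
  moreover have "B' = M - (A' \<union> k)" using wall_partition[OF w'] by blast
  ultimately show "B = B'" by simp
qed

lemma curtain_nonempty: "curtain k \<Longrightarrow> k \<noteq> {}"
  using curtain_imp_wall wall_nonempty by blast

lemma curtain_connected: "curtain k \<Longrightarrow> connectedin mtopology k"
  using curtain_imp_wall wall_connected(2) by blast

lemma curtain_subset: "curtain k \<Longrightarrow> k \<subseteq> M"
  using curtain_connected connectedin_subset_topspace by fastforce

lemma curtain_separates_disjoint:
  assumes "curtain_separates k S T" shows "S \<inter> T = {}"
proof -
  obtain A B where "wall k A B" "S \<subseteq> A" "T \<subseteq> B" using assms by (rule curtain_separatesE)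
  then show ?thesis using wall_partition(2) by blast
qed

lemma curtain_separates_crossing:
  assumes "curtain_separates k S T" "connectedin mtopology C" "C \<inter> S \<noteq> {}" "C \<inter> T \<noteq> {}"
  shows "C \<inter> k \<noteq> {}"
  proof -
  obtain A B where "wall k A B" "S \<subseteq> A" "T \<subseteq> B" using assms(1) by (rule curtain_separatesE)
  then show ?thesis using wall_crossing[OF _ assms(2)] assms(3,4) by blast
qed

lemma curtain_separates_extend:
  assumes "curtain_separates k S T" "connectedin mtopology C" "C \<inter> k = {}" "C \<inter> S \<noteq> {}"
  shows "curtain_separates k (S \<union> C) T"
proof -
  obtain A B where w: "wall k A B" "S \<subseteq> A" "T \<subseteq> B" using assms(1) by (rule curtain_separatesE)
  then have "C \<subseteq> A" using wall_connected_side[OF w(1) assms(2,3)] assms(4) by blast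
  then show ?thesis using w by (blast intro: curtain_separatesI)
qed

lemma curtain_separates_merge:
  assumes "curtain_separates k S T" "curtain_separates k S' T'" "S \<inter> S' \<noteq> {}"
  shows "curtain_separates k (S \<union> S') (T \<union> T')"
proof -
  obtain A B where w: "wall k A B" "S \<subseteq> A" "T \<subseteq> B" using assms(1) by (rule curtain_separatesE)
  obtain A' B' where w': "wall k A' B'" "S' \<subseteq> A'" "T' \<subseteq> B'" using assms(2) by (rule curtain_separatesE)
  have "A \<inter> A' \<noteq> {}" using assms(3) w w' by blast
  from wall_unique[OF w(1) w'(1) this] show ?thesis using w w' by (blast intro: curtain_separatesI)
qed

lemma curtain_separates_cases:
  assumes "curtain_separates k S T" "y \<in> M"
  shows "y \<in> k \<or> curtain_separates k (insert y S) T \<or> curtain_separates k S (insert y T)"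
proof -
  obtain A B where w: "wall k A B" "S \<subseteq> A" "T \<subseteq> B" using assms(1) by (rule curtain_separatesE)
  then have "y \<in> A \<or> y \<in> k \<or> y \<in> B" using wall_partition(1) assms(2) by blast
  then show ?thesis using w by (blast intro: curtain_separatesI)
qed

section \<open>Families of disjoint curtains\<close>

text \<open>The relation \<open>curtain_separates a {w} (insert x k)\<close> serves as the order
  "\<open>a\<close> comes before \<open>k\<close> on the way from \<open>w\<close> to
  \<open>x\<close>". It can be read from \<open>k\<close> as well, because \<open>a\<close> together
  with the side of \<open>w\<close> is connected and misses \<open>k\<close>.\<close>

lemma curtain_before_flip:
  assumes a: "curtain_separates a {w} (insert x k)" and k: "curtain_separates k {w} {x}"
  shows "curtain_separates k (insert w a) {x}"
proof -
  obtain A B where w: "wall a A B" "w \<in> A" "insert x k \<subseteq> B"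
    using a by (auto elim!: curtain_separatesE)
  have "(A \<union> a) \<inter> k = {}" using w wall_partition[OF w(1)] by blast
  then have "curtain_separates k ({w} \<union> (A \<union> a)) {x}"
    using w by (intro curtain_separates_extend[OF k wall_connected(3)[OF w(1)]]) auto
  then show ?thesis by (rule curtain_separates_mono) auto
qed

text \<open>\<open>k\<close> is connected and misses \<open>a\<close>, so it lies on one side of
  \<open>a\<close>. On the side of \<open>w\<close>, the flip with \<open>w\<close> and
  \<open>x\<close> exchanged yields the reverse order.\<close>

lemma curtain_before_total:
  assumes a: "curtain_separates a {w} {x}" and k: "curtain_separates k {w} {x}" and "a \<inter> k = {}"
  shows "curtain_separates a {w} (insert x k) \<or> curtain_separates k {w} (insert x a)"
proof -
  obtain A B where w: "wall a A B" "w \<in> A" "x \<in> B" using a by (auto elim!: curtain_separatesE)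
  have kc: "curtain k" using k curtain_separates_curtain by blast
  consider "k \<inter> A \<noteq> {}" | "k \<inter> B \<noteq> {}"
    using curtain_nonempty[OF kc] curtain_subset[OF kc] wall_partition[OF w(1)] assms(3) by blast
  then show ?thesis
  proof cases
    case 1
    have "k \<subseteq> A" using wall_connected_side[OF w(1) curtain_connected[OF kc]] 1 assms(3) by blast
    then have "curtain_separates a {x} (insert w k)"
      by (intro curtain_separatesI[OF wall_sym[OF w(1)]]) (use w(2,3) in auto)
    then have "curtain_separates k (insert x a) {w}"
      by (rule curtain_before_flip[OF _ curtain_separates_sym[OF k]])
    then show ?thesis by (rule disjI2[OF curtain_separates_sym])
  next
    case 2
    have "k \<subseteq> B"
      using wall_connected_side[OF wall_sym[OF w(1)] curtain_connected[OF kc]] 2 assms(3) by blast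
    then show ?thesis using w by (blast intro: curtain_separatesI)
  qed
qed

text \<open>The far side of \<open>b\<close> is connected, contains \<open>x\<close> and
  \<open>e\<close>, and misses \<open>a\<close>; so it stays on the side of \<open>x\<close> as seen
  from \<open>a\<close>.\<close>

lemma curtain_before_trans:
  assumes ab: "curtain_separates a {w} (insert x b)" and be: "curtain_separates b {w} (insert x e)"
  shows "curtain_separates a {w} (insert x e)"
proof -
  obtain A B where w: "wall b A B" "w \<in> A" "insert x e \<subseteq> B" using be by (auto elim!: curtain_separatesE)
  have "curtain_separates b (insert w a) {x}"
    by (rule curtain_before_flip[OF ab curtain_separates_mono[OF be]]) auto
  then obtain A' B' where w': "wall b A' B'" "insert w a \<subseteq> A'" by (auto elim!: curtain_separatesE)
  have "A = A'" using wall_unique(1)[OF w(1) w'(1)] w(2) w'(2) by blast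
  then have "B \<inter> a = {}" using wall_partition[OF w(1)] w'(2) by blast
  then have "curtain_separates a ({x} \<union> B) {w}"
    using w(3) curtain_separates_sym[OF curtain_separates_mono[OF ab, of "{w}" "{x}"]]
    by (intro curtain_separates_extend wall_connected(1)[OF wall_sym[OF w(1)]]) auto
  then show ?thesis
    by (rule curtain_separates_mono[OF curtain_separates_sym]) (use w(3) in auto)
qed

text \<open>In contrast to \<open>curtain_chain\<close> there are no indices: for two points the
  order is recovered in \<open>sorted_curtains\<close>. This makes subfamilies and unions easy to
  handle.\<close>

definition disjoint_separating :: "'a set set \<Rightarrow> 'a set \<Rightarrow> 'a set \<Rightarrow> bool" where
  "disjoint_separating c S T \<longleftrightarrow> (\<forall>h\<in>c. \<forall>h'\<in>c. h \<noteq> h' \<longrightarrow> h \<inter> h' = {}) \<and> chain_separates c S T"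

lemma disjoint_separatingD:
  assumes "disjoint_separating c S T"
  shows "\<And>h h'. h \<in> c \<Longrightarrow> h' \<in> c \<Longrightarrow> h \<noteq> h' \<Longrightarrow> h \<inter> h' = {}"
    "\<And>h. h \<in> c \<Longrightarrow> curtain_separates h S T"
  using assms unfolding disjoint_separating_def chain_separates_def by blast+

lemma disjoint_separating_subset:
  "disjoint_separating c S T \<Longrightarrow> c' \<subseteq> c \<Longrightarrow> disjoint_separating c' S T"
  unfolding disjoint_separating_def chain_separates_def by blast

lemma first_curtain:
  assumes "finite c" "c \<noteq> {}" "disjoint_separating c {w} {x}"
  shows "\<exists>a\<in>c. \<forall>k\<in>c - {a}. curtain_separates a {w} (insert x k)"
  using assms
proof (induction c rule: finite_ne_induct)
  case (insert k c)
  then obtain a where a: "a \<in> c" "\<forall>k\<in>c - {a}. curtain_separates a {w} (insert x k)"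
    using disjoint_separating_subset[OF insert.prems, of c] by blast
  have "a \<noteq> k" using a(1) insert.hyps by blast
  then have "a \<inter> k = {}" "curtain_separates a {w} {x}" "curtain_separates k {w} {x}"
    using a(1) disjoint_separatingD[OF insert.prems] by simp_all
  from curtain_before_total[OF this(2,3,1)] show ?case
  proof
    assume "curtain_separates a {w} (insert x k)"
    then show ?thesis using a by (intro bexI[of _ a]) auto
  next
    assume k: "curtain_separates k {w} (insert x a)"
    then have "curtain_separates k {w} (insert x b)" if "b \<in> c" for b
      using a(2) curtain_before_trans[OF k] that by (cases "b = a") auto
    then show ?thesis by (intro bexI[of _ k]) auto
  qed
qed simp

lemma sorted_curtains:
  assumes "finite c" "disjoint_separating c {w} {x}"
  shows "\<exists>xs. set xs = c \<and> distinct xs \<and> sorted_wrt (\<lambda>a k. curtain_separates a {w} (insert x k)) xs"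
  using assms
proof (induction "card c" arbitrary: c)
  case 0
  then show ?case by (intro exI[of _ "[]"]) auto
next
  case (Suc n)
  have "c \<noteq> {}" using Suc.hyps(2) by auto
  from first_curtain[OF Suc.prems(1) this Suc.prems(2)]
  obtain a where a: "a \<in> c" "\<forall>k\<in>c - {a}. curtain_separates a {w} (insert x k)"
    by blast
  have "n = card (c - {a})" using Suc.hyps(2) a(1) Suc.prems(1) by simp
  then obtain xs where "set xs = c - {a}" "distinct xs"
    "sorted_wrt (\<lambda>a k. curtain_separates a {w} (insert x k)) xs"
    using Suc.hyps(1)[of "c - {a}"] Suc.prems disjoint_separating_subset[of c _ _ "c - {a}"] by auto
  then show ?case using a by (intro exI[of _ "a # xs"]) auto
qed

text \<open>This removes the ordering from the definition of \<open>L_dist\<close>: only pairwise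
  separation has to be checked for the families built later.\<close>

lemma disjoint_separating_imp_chain:
  assumes "finite c" "disjoint_separating c {w} {x}"
  shows "curtain_chain c"
proof -
  obtain xs where xs: "set xs = c" "sorted_wrt (\<lambda>a k. curtain_separates a {w} (insert x k)) xs"
    using sorted_curtains[OF assms] by blast
  define J where "J = {0..<int (length xs)}"
  define h where "h i = xs ! nat i" for i :: int
  have hc: "curtain_separates (h i) {w} {x}" if "i \<in> J" for i
  proof (rule disjoint_separatingD(2)[OF assms(2)])
    show "h i \<in> c" using that xs(1) nth_mem[of "nat i" xs] by (auto simp: J_def h_def nat_less_iff)
  qed
  have less: "curtain_separates (h i) {w} (insert x (h j))" if "i \<in> J" "j \<in> J" "i < j" for i j
    using that sorted_wrt_nth_less[OF xs(2), of "nat i" "nat j"] unfolding J_def h_def by auto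
  show ?thesis
    unfolding curtain_chain_def
  proof (intro exI[of _ J] exI[of _ h] conjI ballI impI)
    show "{i..k} \<subseteq> J" if "i \<in> J" "k \<in> J" for i k using that by (auto simp: J_def)
    show "c = h ` J"
    proof -
      have "h ` J = (\<lambda>i. xs ! i) ` {..<length xs}"
        unfolding J_def h_def
        by (auto simp: nat_less_iff image_iff) (metis atLeastLessThan_iff int_nat_eq nat_int of_nat_0_le_iff of_nat_less_iff)
      then show ?thesis using xs(1) by (auto simp: set_conv_nth)
    qed
    show "curtain (h i)" if "i \<in> J" for i using hc[OF that] curtain_separates_curtain by blast
    fix i assume i: "i \<in> J" "i - 1 \<in> J" "i + 1 \<in> J"
    have "curtain_separates (h i) (insert w (h (i - 1))) {x}"
      by (rule curtain_before_flip[OF less[OF i(2,1)] hc[OF i(1)]]) simp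
    from curtain_separates_merge[OF this less[OF i(1,3)]]
    have "curtain_separates (h i) (insert w (h (i - 1)) \<union> {w}) ({x} \<union> insert x (h (i + 1)))" by simp
    then show "curtain_separates (h i) (h (i - 1)) (h (i + 1))"
      by (rule curtain_separates_mono) auto
  qed
qed

text \<open>A curtain crossed by a geodesic contains a piece of it of length 1, so curtains that are
  disjoint have centres more than 1/2 apart.\<close>

lemma geodesic_crosses_curtain:
  assumes k: "curtain_separates k {x} {y}" and \<gamma>: "geodesic {0..l} \<gamma>" "0 \<le> l" "\<gamma> 0 = x" "\<gamma> l = y"
  shows "\<exists>t\<in>{0..l}. \<forall>s\<in>{0..l}. \<bar>s - t\<bar> \<le> 1/2 \<longrightarrow> \<gamma> s \<in> k"
proof -
  obtain A B where w: "wall k A B" "x \<in> A" "y \<in> B" using k by (auto elim!: curtain_separatesE)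
  obtain g :: "'a \<Rightarrow> real" where g: "\<And>x y. x \<in> M \<Longrightarrow> y \<in> M \<Longrightarrow> \<bar>g x - g y\<bar> \<le> d x y"
    "k = {x \<in> M. \<bar>g x\<bar> \<le> 1/2}" "A = {x \<in> M. g x < -1/2}" "B = {x \<in> M. g x > 1/2}"
    using wall_function[OF w(1)] by blast
  have lip: "\<bar>g (\<gamma> s) - g (\<gamma> t)\<bar> \<le> \<bar>s - t\<bar>" if "s \<in> {0..l}" "t \<in> {0..l}" for s t
    using g(1)[of "\<gamma> s" "\<gamma> t"] geodesicD(3)[OF \<gamma>(1)] geodesicD(4)[OF \<gamma>(1) that] that by simp
  have "continuous_on {0..l} (\<lambda>t. g (\<gamma> t))"
    unfolding continuous_on_iff dist_real_def
  proof (intro ballI allI impI)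
    fix s e :: real assume s: "s \<in> {0..l}" and "e > 0"
    show "\<exists>\<delta>>0. \<forall>t\<in>{0..l}. \<bar>t - s\<bar> < \<delta> \<longrightarrow> \<bar>g (\<gamma> t) - g (\<gamma> s)\<bar> < e"
    proof (intro exI[of _ e] conjI ballI impI)
      fix t assume "t \<in> {0..l}" "\<bar>t - s\<bar> < e"
      then show "\<bar>g (\<gamma> t) - g (\<gamma> s)\<bar> < e" using lip[of t s] s by simp
    qed fact
  qed
  moreover have "g (\<gamma> 0) \<le> 0" "0 \<le> g (\<gamma> l)" using w(2,3) g(3,4) \<gamma> by auto
  ultimately obtain t where t: "0 \<le> t" "t \<le> l" "g (\<gamma> t) = 0"
    using IVT'[of "\<lambda>t. g (\<gamma> t)" 0 0 l] \<gamma>(2) by blast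
  have "\<gamma> s \<in> k" if "s \<in> {0..l}" "\<bar>s - t\<bar> \<le> 1/2" for s
    using lip[of s t] that t geodesicD(3)[OF \<gamma>(1)] g(2) by auto
  then show ?thesis using t(1,2) by (intro bexI[of _ t]) auto
qed

lemma disjoint_separating_bound:
  assumes c: "disjoint_separating c {x} {y}" and xy: "x \<in> M" "y \<in> M"
  shows "finite c" "real (card c) \<le> 2 * d x y + 1"
proof -
  define l where "l = d x y"
  obtain \<gamma> where \<gamma>: "geodesic {0..l} \<gamma>" "\<gamma> 0 = x" "\<gamma> l = y" using obtain_geodesic[OF xy] l_def by metis
  have l: "0 \<le> l" by (simp add: l_def)
  have "\<forall>k\<in>c. \<exists>t\<in>{0..l}. \<forall>s\<in>{0..l}. \<bar>s - t\<bar> \<le> 1/2 \<longrightarrow> \<gamma> s \<in> k"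
    using geodesic_crosses_curtain[OF _ \<gamma>(1) l \<gamma>(2,3)] c
    disjoint_separatingD(2)[OF c] by blast
  then obtain t where t: "\<And>k. k \<in> c \<Longrightarrow> t k \<in> {0..l}"
    "\<And>k s. k \<in> c \<Longrightarrow> s \<in> {0..l} \<Longrightarrow> \<bar>s - t k\<bar> \<le> 1/2 \<Longrightarrow> \<gamma> s \<in> k"
    by metis
  \<comment> \<open>Equal values put the two centres within 1/2 of each other, and then the curtains
    share the point \<open>\<gamma> (t k')\<close>.\<close>
  define f where "f k = \<lfloor>2 * t k\<rfloor>" for k
  have inj: "inj_on f c"
  proof (rule inj_onI)
    fix k k' assume k: "k \<in> c" "k' \<in> c" "f k = f k'"
    then have "\<bar>t k' - t k\<bar> \<le> 1/2" unfolding f_def by linarith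
    then have "\<gamma> (t k') \<in> k" "\<gamma> (t k') \<in> k'" using t k by auto
    then show "k = k'" using disjoint_separatingD(1)[OF c k(1,2)] by blast
  qed
  have img: "f ` c \<subseteq> {0..\<lfloor>2 * l\<rfloor>}" using t(1) by (auto simp: f_def intro!: floor_mono)
  then show "finite c" using inj finite_imageD finite_subset by blast
  have "card c = card (f ` c)" using inj by (simp add: card_image)
  also have "\<dots> \<le> card {0..\<lfloor>2 * l\<rfloor>}" using img by (intro card_mono) auto
  also have "\<dots> = nat (\<lfloor>2 * l\<rfloor> + 1)" by simp
  finally have "int (card c) \<le> \<lfloor>2 * l\<rfloor> + 1" using l by linarith
  then show "real (card c) \<le> 2 * d x y + 1" unfolding l_def by linarith
qed

end


context CAT0_space
begin

section \<open>Counting separating families\<close>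

text \<open>An \<open>L_chain\<close> that separates \<open>S\<close> from \<open>T\<close>, without
  its chain condition: when both sets contain a point of the space, finiteness and disjointness
  already imply it.\<close>

definition L_family :: "nat \<Rightarrow> 'a set set \<Rightarrow> 'a set \<Rightarrow> 'a set \<Rightarrow> bool" where
  "L_family L c S T \<longleftrightarrow> finite c \<and> (\<forall>h\<in>c. \<forall>h'\<in>c. h \<noteq> h' \<longrightarrow> L_separated L h h') \<and>
     (\<forall>h\<in>c. curtain_separates h S T)"

text \<open>With \<open>S = {w}\<close> and \<open>T = {x, y}\<close> this is the integer that
  stands in for the Gromov product.\<close>

definition max_separating :: "nat \<Rightarrow> 'a set \<Rightarrow> 'a set \<Rightarrow> nat" where
  "max_separating L S T = Max {card c | c. L_family L c S T}"

lemma L_familyD: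
  assumes "L_family L c S T"
  shows "finite c" "\<And>h h'. h \<in> c \<Longrightarrow> h' \<in> c \<Longrightarrow> h \<noteq> h' \<Longrightarrow> L_separated L h h'"
    "\<And>h. h \<in> c \<Longrightarrow> curtain_separates h S T"
  using assms unfolding L_family_def by blast+

lemma L_family_subset: "L_family L c S T \<Longrightarrow> c' \<subseteq> c \<Longrightarrow> L_family L c' S T"
  unfolding L_family_def using finite_subset by blast

lemma L_family_sym: "L_family L c S T \<Longrightarrow> L_family L c T S"
  unfolding L_family_def using curtain_separates_sym by metis

lemma L_family_mono: "L_family L c S T \<Longrightarrow> S' \<subseteq> S \<Longrightarrow> T' \<subseteq> T \<Longrightarrow> L_family L c S' T'"
  unfolding L_family_def using curtain_separates_mono by metis

lemma L_family_disjoint_separating: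
  assumes "L_family L c S T" "x \<in> S" "y \<in> T"
  shows "disjoint_separating c {x} {y}"
  unfolding disjoint_separating_def chain_separates_def
proof (intro conjI ballI impI)
  show "h \<inter> h' = {}" if "h \<in> c" "h' \<in> c" "h \<noteq> h'" for h h'
    using L_familyD(2)[OF assms(1) that] by (simp add: L_separated_def)
  show "curtain_separates h {x} {y}" if "h \<in> c" for h
    by (rule curtain_separates_mono[OF L_familyD(3)[OF assms(1) that]]) (use assms in auto)
qed

lemma L_family_card_le:
  assumes "L_family L c S T" "x \<in> S" "y \<in> T" "x \<in> M" "y \<in> M"
  shows "real (card c) \<le> 2 * d x y + 1"
  using disjoint_separating_bound(2)[OF L_family_disjoint_separating[OF assms(1-3)] assms(4,5)] .

lemma
  assumes "x \<in> S" "y \<in> T" "x \<in> M" "y \<in> M"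
  shows max_separating_attained: "\<exists>c. L_family L c S T \<and> card c = max_separating L S T"
    and max_separating_ge: "L_family L c S T \<Longrightarrow> card c \<le> max_separating L S T"
proof -
  let ?A = "{card c | c. L_family L c S T}"
  have "?A \<subseteq> {..nat \<lfloor>2 * d x y + 1\<rfloor>}"
  proof
    fix n assume "n \<in> ?A"
    then have "real n \<le> 2 * d x y + 1" using L_family_card_le[OF _ assms] by auto
    then show "n \<in> {..nat \<lfloor>2 * d x y + 1\<rfloor>}" unfolding atMost_iff by (rule le_nat_floor)
  qed
  then have fin: "finite ?A" using finite_subset by blast
  have "L_family L {} S T" by (simp add: L_family_def)
  then have "?A \<noteq> {}" by blast
  from Max_in[OF fin this] have "\<exists>c. Max ?A = card c \<and> L_family L c S T" by simp
  then show "\<exists>c. L_family L c S T \<and> card c = max_separating L S T"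
    unfolding max_separating_def by metis
  show "card c \<le> max_separating L S T" if "L_family L c S T"
    unfolding max_separating_def by (rule Max_ge[OF fin]) (use that in blast)
qed

lemma max_separating_le:
  assumes "x \<in> S" "y \<in> T" "x \<in> M" "y \<in> M"
  shows "real (max_separating L S T) \<le> 2 * d x y + 1"
  using max_separating_attained[OF assms, of L] L_family_card_le[OF _ assms] by metis

lemma max_separating_self:
  assumes "x \<in> M" shows "max_separating L {x} {x} = 0"
proof -
  obtain c where c: "L_family L c {x} {x}" "card c = max_separating L {x} {x}"
    using max_separating_attained[of x "{x}" x "{x}" L] assms by auto
  have "h \<notin> c" for h
    using L_familyD(3)[OF c(1), of h] curtain_separates_disjoint[of h "{x}" "{x}"] by auto
  then have "c = {}" by blast
  then show ?thesis using c(2) by simp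
qed

lemma max_separating_sym: "max_separating L S T = max_separating L T S"
  unfolding max_separating_def using L_family_sym by metis

lemma L_dist_eq:
  "L_dist L x y = (if x = y then 0 else 1 + max_separating L {x} {y})" if "x \<in> M" "y \<in> M"
proof -
  have "L_chain L c \<and> chain_separates c {x} {y} \<longleftrightarrow> L_family L c {x} {y}" for c
  proof
    assume c: "L_chain L c \<and> chain_separates c {x} {y}"
    then have "disjoint_separating c {x} {y}"
      unfolding disjoint_separating_def L_chain_def by (auto simp: L_separated_def)
    then have "finite c" using disjoint_separating_bound(1) that by blast
    then show "L_family L c {x} {y}"
      using c unfolding L_family_def L_chain_def chain_separates_def by simp
  next
    assume c: "L_family L c {x} {y}"
    have "disjoint_separating c {x} {y}" by (rule L_family_disjoint_separating[OF c]) auto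
    then show "L_chain L c \<and> chain_separates c {x} {y}"
      using c disjoint_separating_imp_chain[of c x y]
      unfolding L_family_def L_chain_def chain_separates_def by simp
  qed
  then show ?thesis unfolding L_dist_def max_separating_def by simp
qed

lemma L_dist_bounds:
  assumes "x \<in> M" "y \<in> M"
  shows "max_separating L {x} {y} \<le> L_dist L x y" "L_dist L x y \<le> max_separating L {x} {y} + 1"
  using L_dist_eq[OF assms, of L] max_separating_self[OF assms(1), of L] by auto

lemma L_separated_card_le:
  assumes "L_separated L h h'" "finite K" "disjoint_separating K {u} {v}"
    and "\<And>k. k \<in> K \<Longrightarrow> k \<inter> h \<noteq> {} \<and> k \<inter> h' \<noteq> {}"
  shows "card K \<le> L"
  using assms(1) disjoint_separating_imp_chain[OF assms(2,3)] assms(4) unfolding L_separated_def by blast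

lemma curtain_chain_curtain: "curtain_chain c \<Longrightarrow> k \<in> c \<Longrightarrow> curtain k"
  unfolding curtain_chain_def by blast

text \<open>\<open>b\<close> lies between \<open>k\<close> and \<open>k'\<close>: a curtain that
  meets both is connected and has to cross \<open>b\<close>, so the bound for \<open>k\<close> and
  \<open>b\<close> applies to it.\<close>

lemma L_separated_beyond:
  assumes hb: "L_separated L k b" and k': "curtain k'" and b: "wall b A B" "k \<subseteq> B" "k' \<subseteq> A"
  shows "L_separated L k k'"
  unfolding L_separated_def
proof (intro conjI allI impI)
  show "curtain k" using hb by (simp add: L_separated_def)
  show "k \<inter> k' = {}" using b wall_partition[OF b(1)] by blast
  fix c assume c: "curtain_chain c" "\<forall>m\<in>c. m \<inter> k \<noteq> {} \<and> m \<inter> k' \<noteq> {}"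
  have "m \<inter> b \<noteq> {}" if "m \<in> c" for m
    using c(2) b(2,3) that
    by (intro wall_crossing[OF b(1) curtain_connected[OF curtain_chain_curtain[OF c(1) that]]]) blast+
  then have "\<forall>m\<in>c. m \<inter> k \<noteq> {} \<and> m \<inter> b \<noteq> {}" using c(2) by blast
  then have "finite c \<and> card c \<le> L" using hb c(1) by (simp add: L_separated_def)
  then show "finite c" "card c \<le> L" by auto
qed (fact k')

text \<open>Discarding the two curtains of \<open>c\<close> that are closest to \<open>w\<close>, and the curtains of \<open>c'\<close> that
  meet the second of them, makes the union of the two families \<open>L\<close>-separated.\<close>

lemma L_family_glue:
  assumes c: "L_family L c {x} {w, y}" and c': "L_family L c' {y} {w, x}"
  shows "\<exists>e. L_family L e {x} {y} \<and> card c + card c' \<le> card e + L + 2"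
proof (cases "card c \<le> 1")
  case True
  have "L_family L c' {x} {y}" by (rule L_family_mono[OF L_family_sym[OF c']]) auto
  then show ?thesis using True by (intro exI[of _ c']) auto
next
  case False
  note fin = L_familyD(1)[OF c] L_familyD(1)[OF c']
  have sep: "disjoint_separating c {w} {x}"
    using L_family_disjoint_separating[OF L_family_sym[OF c]] by simp
  have "c \<noteq> {}" using False by auto
  from first_curtain[OF fin(1) this sep]
  obtain a where a: "a \<in> c" "\<And>k. k \<in> c - {a} \<Longrightarrow> curtain_separates a {w} (insert x k)" by blast
  have "c - {a} \<noteq> {}"
  proof
    assume "c - {a} = {}"
    then have "c = {a}" using a(1) by blast
    then show False using False by simp
  qed
  from first_curtain[OF _ this disjoint_separating_subset[OF sep]] fin(1)
  obtain b where b: "b \<in> c - {a}" "\<And>k. k \<in> c - {a} - {b} \<Longrightarrow> curtain_separates b {w} (insert x k)"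
    by blast
  have Lab: "L_separated L a b" using L_familyD(2)[OF c a(1)] b(1) by blast
  \<comment> \<open>\<open>k'\<close> separates \<open>y\<close> from \<open>w\<close>, so it cuts
    every halfspace that contains both.\<close>
  have meets: "k' \<inter> A \<noteq> {}" if "k' \<in> c'" "wall h A B" "w \<in> A" "y \<in> A" for k' h A B
    using curtain_separates_crossing[OF L_familyD(3)[OF c' that(1)] wall_connected(1)[OF that(2)]] that
    by blast
  \<comment> \<open>A curtain of \<open>c'\<close> that reaches \<open>b\<close> starts on the near
    side of \<open>a\<close> and must cross \<open>a\<close> too; hence there are at most
    \<open>L\<close> of them.\<close>
  define bad where "bad = {k' \<in> c'. k' \<inter> b \<noteq> {}}"
  have "card bad \<le> L"
  proof (rule L_separated_card_le[OF Lab])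
    show "finite bad" using fin(2) by (simp add: bad_def)
    show "disjoint_separating bad {y} {w}"
      by (rule disjoint_separating_subset[OF L_family_disjoint_separating[OF c']]) (auto simp: bad_def)
    fix k' assume k': "k' \<in> bad"
    then have "k' \<in> c'" and kb: "k' \<inter> b \<noteq> {}" by (auto simp: bad_def)
    have "curtain_separates a ({w, y} \<union> {w}) ({x} \<union> insert x b)"
      by (rule curtain_separates_merge[OF curtain_separates_sym[OF L_familyD(3)[OF c a(1)]] a(2)[OF b(1)]]) simp
    then obtain A B where w: "wall a A B" "{w, y} \<union> {w} \<subseteq> A" "{x} \<union> insert x b \<subseteq> B"
      by (rule curtain_separatesE)
    have "k' \<inter> A \<noteq> {}" using meets[OF \<open>k' \<in> c'\<close> w(1)] w(2) by simp
    moreover have "k' \<inter> B \<noteq> {}" using kb w(3) by blast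
    moreover have "curtain k'" using curtain_separates_curtain L_familyD(3)[OF c' \<open>k' \<in> c'\<close>] by blast
    ultimately have "k' \<inter> a \<noteq> {}" using wall_crossing[OF w(1) curtain_connected] by blast
    then show "k' \<inter> a \<noteq> {} \<and> k' \<inter> b \<noteq> {}" using kb by blast
  qed
  define e where "e = (c - {a, b}) \<union> (c' - bad)"
  \<comment> \<open>\<open>k\<close> lies beyond \<open>b\<close> and \<open>k'\<close>, which
    misses \<open>b\<close>, lies before it; so \<open>b\<close> shields them from each
    other.\<close>
  have cross: "L_separated L k k' \<and> L_separated L k' k \<and> k \<noteq> k'"
    if k: "k \<in> c - {a, b}" and k': "k' \<in> c' - bad" for k k'
  proof -
    have "k \<in> c - {a} - {b}" "b \<in> c" using k b(1) by auto
    then have "curtain_separates b ({w, y} \<union> {w}) ({x} \<union> insert x k)"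
      by (intro curtain_separates_merge[OF curtain_separates_sym[OF L_familyD(3)[OF c]] b(2)]) auto
    then obtain A B where w: "wall b A B" "{w, y} \<union> {w} \<subseteq> A" "{x} \<union> insert x k \<subseteq> B"
      by (rule curtain_separatesE)
    have ck': "curtain k'" using curtain_separates_curtain L_familyD(3)[OF c'] k' by blast
    have "k' \<inter> A \<noteq> {}" using meets[OF _ w(1)] w(2) k' by simp
    then have kA: "k' \<subseteq> A"
      using k' by (intro wall_connected_side[OF w(1) curtain_connected[OF ck']]) (auto simp: bad_def)
    have kB: "k \<subseteq> B" using w(3) by blast
    have "L_separated L k b" using L_familyD(2)[OF c] k b(1) by blast
    then have *: "L_separated L k k'" by (rule L_separated_beyond[OF _ ck' w(1) kB kA])
    moreover have "L_separated L k' k" using * unfolding L_separated_def by (simp add: Int_commute conj_commute)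
    moreover have "k \<noteq> k'" using * curtain_nonempty unfolding L_separated_def by blast
    ultimately show ?thesis by blast
  qed
  have "L_family L e {x} {y}"
    unfolding L_family_def
  proof (intro conjI ballI impI)
    show "finite e" using fin by (simp add: e_def)
    show "curtain_separates h {x} {y}" if "h \<in> e" for h
    proof (cases "h \<in> c")
      case True
      then show ?thesis using curtain_separates_mono[OF L_familyD(3)[OF c]] by simp
    next
      case False
      then have "h \<in> c'" using that by (simp add: e_def)
      from curtain_separates_sym[OF L_familyD(3)[OF c' this]]
      show ?thesis by (rule curtain_separates_mono) auto
    qed
    show "L_separated L h h'" if h: "h \<in> e" "h' \<in> e" "h \<noteq> h'" for h h'
    proof -
      consider "h \<in> c - {a, b}" "h' \<in> c - {a, b}" | "h \<in> c - {a, b}" "h' \<in> c' - bad"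
        | "h \<in> c' - bad" "h' \<in> c - {a, b}" | "h \<in> c' - bad" "h' \<in> c' - bad"
        using h(1,2) unfolding e_def by blast
      then show ?thesis
      proof cases
        case 1
        then show ?thesis using L_familyD(2)[OF c _ _ h(3)] by blast
      next
        case 2
        then show ?thesis using cross by blast
      next
        case 3
        then show ?thesis using cross by blast
      next
        case 4
        then show ?thesis using L_familyD(2)[OF c' _ _ h(3)] by blast
      qed
    qed
  qed
  moreover have "card c + card c' \<le> card e + L + 2"
  proof -
    have "card e = card (c - {a, b}) + card (c' - bad)"
      unfolding e_def using fin cross by (intro card_Un_disjoint) auto
    moreover have "card c \<le> card (c - {a, b}) + 2"
    proof -
      have "card c \<le> card ((c - {a, b}) \<union> {a, b})" using fin by (intro card_mono) auto
      also have "\<dots> \<le> card (c - {a, b}) + card {a, b}" by (rule card_Un_le)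
      also have "card {a, b} \<le> 2" by (simp add: card_insert_if)
      finally show ?thesis by simp
    qed
    moreover have "card c' \<le> card (c' - bad) + L"
    proof -
      have "card c' \<le> card ((c' - bad) \<union> bad)" using fin by (intro card_mono) (auto simp: bad_def)
      also have "\<dots> \<le> card (c' - bad) + card bad" by (rule card_Un_le)
      finally show ?thesis using \<open>card bad \<le> L\<close> by simp
    qed
    ultimately show ?thesis by simp
  qed
  ultimately show ?thesis by blast
qed

text \<open>Sort the curtains by the side of \<open>y\<close>. They are disjoint, so at most one
  contains \<open>y\<close>, which is the \<open>+ 1\<close>.\<close>

lemma L_family_split:
  assumes c: "L_family L c S T" and "y \<in> M"
  shows "\<exists>c1 c2. c1 \<subseteq> c \<and> c2 \<subseteq> c \<and> L_family L c1 (insert y S) T \<and> L_family L c2 S (insert y T) \<and>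
    card c \<le> card c1 + card c2 + 1"
proof -
  define c1 where "c1 = {k \<in> c. curtain_separates k (insert y S) T}"
  define c2 where "c2 = {k \<in> c. curtain_separates k S (insert y T)}"
  define c3 where "c3 = {k \<in> c. y \<in> k}"
  have fin: "finite c" using L_familyD(1)[OF c] .
  have "k = k'" if "k \<in> c3" "k' \<in> c3" for k k'
    using L_familyD(2)[OF c, of k k'] that by (auto simp: c3_def L_separated_def)
  then have "card c3 \<le> 1" by (simp add: card_le_Suc0_iff_eq fin c3_def)
  have "c \<subseteq> (c1 \<union> c2) \<union> c3"
    using curtain_separates_cases[OF L_familyD(3)[OF c] assms(2)] unfolding c1_def c2_def c3_def by blast
  then have "card c \<le> card ((c1 \<union> c2) \<union> c3)" using fin by (intro card_mono) (auto simp: c1_def c2_def c3_def)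
  also have "\<dots> \<le> card (c1 \<union> c2) + card c3" by (rule card_Un_le)
  also have "\<dots> \<le> card c1 + card c2 + 1" using card_Un_le[of c1 c2] \<open>card c3 \<le> 1\<close> by simp
  finally have "card c \<le> card c1 + card c2 + 1" .
  moreover have "L_family L c1 (insert y S) T"
    using L_family_subset[OF c, of c1] by (auto simp: L_family_def c1_def)
  moreover have "L_family L c2 S (insert y T)"
    using L_family_subset[OF c, of c2] by (auto simp: L_family_def c2_def)
  ultimately show ?thesis by (intro exI[of _ c1] exI[of _ c2]) (auto simp: c1_def c2_def)
qed

section \<open>Gromov products of \<open>L_dist\<close> as numbers of separating curtains\<close>

context
  fixes w x y :: 'a and L :: nat
  assumes M: "w \<in> M" "x \<in> M" "y \<in> M"
begin

lemma max_separating_triangle: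
  "max_separating L {x} {y} \<le> max_separating L {x} {w} + max_separating L {w} {y} + 1"
proof -
  obtain c where c: "L_family L c {x} {y}" "card c = max_separating L {x} {y}"
    using max_separating_attained[of x "{x}" y "{y}" L] M by auto
  obtain c1 c2 where s: "L_family L c1 (insert w {x}) {y}" "L_family L c2 {x} (insert w {y})"
    "card c \<le> card c1 + card c2 + 1" using L_family_split[OF c(1) M(1)] by blast
  have "card c1 \<le> max_separating L {w} {y}"
    by (rule max_separating_ge[of w _ y]) (use M L_family_mono[OF s(1)] in auto)
  moreover have "card c2 \<le> max_separating L {x} {w}"
    by (rule max_separating_ge[of x _ w]) (use M L_family_mono[OF s(2)] in auto)
  ultimately show ?thesis using s(3) c(2) by simp
qed

text \<open>Among the curtains between \<open>w\<close> and \<open>x\<close>, those with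
  \<open>y\<close> on the far side count towards \<open>{x, y}\<close>; the others cut off
  \<open>x\<close> alone. Likewise for \<open>y\<close>. The two families that cut off a single
  point are glued to a family between \<open>x\<close> and \<open>y\<close>. The constant is 2 for
  the splits and \<open>L + 2\<close> for the gluing.\<close>

lemma max_separating_tripod_le:
  "max_separating L {w} {x} + max_separating L {w} {y} \<le>
    2 * max_separating L {w} {x, y} + max_separating L {x} {y} + L + 4"
proof -
  obtain c where c: "L_family L c {w} {x}" "card c = max_separating L {w} {x}"
    using max_separating_attained[of w "{w}" x "{x}" L] M by auto
  obtain c' where c': "L_family L c' {w} {y}" "card c' = max_separating L {w} {y}"
    using max_separating_attained[of w "{w}" y "{y}" L] M by auto
  obtain c1 c2 where s: "L_family L c1 {y, w} {x}" "L_family L c2 {w} {y, x}"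
    "card c \<le> card c1 + card c2 + 1" using L_family_split[OF c(1) M(3)] by blast
  obtain c1' c2' where s': "L_family L c1' {x, w} {y}" "L_family L c2' {w} {x, y}"
    "card c' \<le> card c1' + card c2' + 1" using L_family_split[OF c'(1) M(2)] by blast
  have "L_family L c1 {x} {w, y}" "L_family L c1' {y} {w, x}"
    using L_family_sym[OF s(1)] L_family_sym[OF s'(1)] by (simp_all add: insert_commute)
  from L_family_glue[OF this] obtain e where e: "L_family L e {x} {y}"
    "card c1 + card c1' \<le> card e + L + 2" by blast
  have "card e \<le> max_separating L {x} {y}"
    by (rule max_separating_ge[of x _ y]) (use M e in auto)
  moreover have "card c2 \<le> max_separating L {w} {x, y}"
    by (rule max_separating_ge[of w _ y]) (use M s(2) in \<open>auto simp: insert_commute\<close>)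
  moreover have "card c2' \<le> max_separating L {w} {x, y}"
    by (rule max_separating_ge[of w _ y]) (use M s'(2) in auto)
  ultimately show ?thesis using s(3) s'(3) c(2) c'(2) e(2) by simp
qed

text \<open>The family \<open>e\<close> is glued twice: with the curtains of \<open>f\<close> that
  cut off \<open>x\<close> it yields a family between \<open>w\<close> and \<open>x\<close>, with
  those that cut off \<open>y\<close> a family between \<open>w\<close> and \<open>y\<close>. The
  cost is \<open>L + 2\<close> per gluing and 1 for the split.\<close>

lemma max_separating_tripod_ge:
  "2 * max_separating L {w} {x, y} + max_separating L {x} {y} \<le>
    max_separating L {w} {x} + max_separating L {w} {y} + 2 * L + 5"
proof -
  obtain e where e: "L_family L e {w} {x, y}" "card e = max_separating L {w} {x, y}"
    using max_separating_attained[of w "{w}" y "{x, y}" L] M by auto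
  obtain f where f: "L_family L f {x} {y}" "card f = max_separating L {x} {y}"
    using max_separating_attained[of x "{x}" y "{y}" L] M by auto
  obtain f1 f2 where s: "L_family L f1 {w, x} {y}" "L_family L f2 {x} {w, y}"
    "card f \<le> card f1 + card f2 + 1" using L_family_split[OF f(1) M(1)] by blast
  have "L_family L e {w} {y, x}" "L_family L f2 {x} {y, w}"
    using e(1) s(2) by (simp_all add: insert_commute)
  from L_family_glue[OF this] obtain g where g: "L_family L g {w} {x}"
    "card e + card f2 \<le> card g + L + 2" by blast
  have "L_family L e {w} {x, y}" "L_family L f1 {y} {x, w}"
    using e(1) L_family_sym[OF s(1)] by (simp_all add: insert_commute)
  from L_family_glue[OF this] obtain g' where g': "L_family L g' {w} {y}"
    "card e + card f1 \<le> card g' + L + 2" by blast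
  have "card g \<le> max_separating L {w} {x}"
    by (rule max_separating_ge[of w _ x]) (use M g in auto)
  moreover have "card g' \<le> max_separating L {w} {y}"
    by (rule max_separating_ge[of w _ y]) (use M g' in auto)
  ultimately show ?thesis using s(3) e(2) f(2) g(2) g'(2) by simp
qed

text \<open>Writing r for the count, twice the product lies between \<open>2 r - 2 L - 6\<close> and
  \<open>2 r + L + 6\<close>; the summand 1 in \<open>L_dist\<close> enters only through these
  constants.\<close>

lemma gromov_product_L_dist:
  "\<bar>gromov_product (\<lambda>x y. real (L_dist L x y)) w x y - real (max_separating L {w} {x, y})\<bar> \<le> real L + 3"
proof -
  note b = max_separating_tripod_le max_separating_tripod_ge
    L_dist_bounds[OF M(1,2), of L] L_dist_bounds[OF M(1,3), of L] L_dist_bounds[OF M(2,3), of L]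
  note b' = b[THEN of_nat_mono[where 'a = real], unfolded of_nat_add of_nat_mult of_nat_numeral of_nat_1]
  show ?thesis
    unfolding gromov_product_def abs_le_iff using b' by (simp add: field_simps)
qed

end

lemma L_dist_triangle:
  assumes "x \<in> M" "y \<in> M" "z \<in> M"
  shows "L_dist L x z \<le> L_dist L x y + L_dist L y z"
  using max_separating_triangle[OF assms(2,1,3), of L] by (simp add: L_dist_eq assms)

lemma L_dist_sym: "x \<in> M \<Longrightarrow> y \<in> M \<Longrightarrow> L_dist L x y = L_dist L y x"
  using max_separating_sym[of L "{x}" "{y}"] by (auto simp: L_dist_eq)

lemma L_dist_le: "x \<in> M \<Longrightarrow> y \<in> M \<Longrightarrow> real (L_dist L x y) \<le> 2 * d x y + 2"
  using L_dist_bounds(2)[of x y L] max_separating_le[of x "{x}" y "{y}" L] by simp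

text \<open>The four points lie in the four quadrants of any pair of curtains from the two families,
  so every curtain of \<open>c'\<close> crosses every curtain of \<open>c\<close>. Two members of
  \<open>c\<close> already limit \<open>c'\<close>.\<close>

lemma L_family_quadrant:
  assumes c: "L_family L c {w, z} {x, y}" and c': "L_family L' c' {w, x} {y, z}" and "2 \<le> card c"
  shows "card c' \<le> L"
proof -
  obtain a b where ab: "a \<in> c" "b \<in> c" "a \<noteq> b"
    using assms(3) L_familyD(1)[OF c] by (metis card_le_Suc0_iff_eq not_less_eq_eq numeral_2_eq_2)
  have meet: "k' \<inter> k \<noteq> {}" if k': "k' \<in> c'" and k: "k \<in> c" for k k'
  proof -
    obtain A B where w: "wall k A B" "{w, z} \<subseteq> A" "{x, y} \<subseteq> B"
      using L_familyD(3)[OF c k] by (rule curtain_separatesE)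
    note s = L_familyD(3)[OF c' k']
    have "k' \<inter> A \<noteq> {}"
      using curtain_separates_crossing[OF s wall_connected(1)[OF w(1)]] w(2) by blast
    moreover have "k' \<inter> B \<noteq> {}"
      using curtain_separates_crossing[OF s wall_connected(1)[OF wall_sym[OF w(1)]]] w(3) by blast
    ultimately show ?thesis
      using wall_crossing[OF w(1) curtain_connected[OF curtain_separates_curtain[OF s]]] by blast
  qed
  show ?thesis
  proof (rule L_separated_card_le[OF L_familyD(2)[OF c ab] L_familyD(1)[OF c']])
    show "disjoint_separating c' {w} {y}" using L_family_disjoint_separating[OF c'] by simp
    show "k \<inter> a \<noteq> {} \<and> k \<inter> b \<noteq> {}" if "k \<in> c'" for k
      using meet[OF that] ab by blast
  qed
qed

text \<open>The same alternative holds for all \<open>L\<close>, so it survives summation over \<open>L\<close>.\<close>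

lemma max_separating_hyperbolic:
  assumes M: "w \<in> M" "x \<in> M" "y \<in> M" "z \<in> M"
  shows "(\<forall>L. max_separating L {w} {x, y} \<le> max_separating L {w} {x, z} + L + 2) \<or>
    (\<forall>L. max_separating L {w} {y, z} \<le> max_separating L {w} {x, z} + L + 2)"
proof (rule ccontr)
  assume "\<not> ?thesis"
  then obtain L L' where
    L: "max_separating L {w} {x, z} + L + 2 < max_separating L {w} {x, y}" and
    L': "max_separating L' {w} {x, z} + L' + 2 < max_separating L' {w} {y, z}" by (auto simp: not_le)
  obtain c where c: "L_family L c {w} {x, y}" "card c = max_separating L {w} {x, y}"
    using max_separating_attained[of w "{w}" y "{x, y}" L] M by auto
  obtain c' where c': "L_family L' c' {w} {y, z}" "card c' = max_separating L' {w} {y, z}"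
    using max_separating_attained[of w "{w}" y "{y, z}" L'] M by auto
  obtain c1 c2 where s: "L_family L c1 {z, w} {x, y}" "L_family L c2 {w} {z, x, y}"
    "card c \<le> card c1 + card c2 + 1" using L_family_split[OF c(1) M(4)] by blast
  obtain c1' c2' where s': "L_family L' c1' {x, w} {y, z}" "L_family L' c2' {w} {x, y, z}"
    "card c' \<le> card c1' + card c2' + 1" using L_family_split[OF c'(1) M(2)] by blast
  have "card c2 \<le> max_separating L {w} {x, z}"
    by (rule max_separating_ge[of w _ x]) (use M L_family_mono[OF s(2)] in auto)
  then have c1: "L + 2 \<le> card c1" using s(3) c(2) L by simp
  have "card c2' \<le> max_separating L' {w} {x, z}"
    by (rule max_separating_ge[of w _ x]) (use M L_family_mono[OF s'(2)] in auto)
  then have c1': "L' + 2 \<le> card c1'" using s'(3) c'(2) L' by simp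
  have f: "L_family L c1 {w, z} {x, y}" "L_family L' c1' {w, x} {y, z}"
    "L_family L c1 {w, z} {y, x}" "L_family L' c1' {w, x} {z, y}"
    using s(1) s'(1) by (simp_all add: insert_commute)
  \<comment> \<open>The two families cross, and each is bounded by the level of the other:
    \<open>L' + 2 \<le> L\<close> and \<open>L + 2 \<le> L'\<close>. So it does not matter that the
    two alternatives fail at different levels.\<close>
  have "card c1' \<le> L" using L_family_quadrant[OF f(1,2)] c1 by simp
  moreover have "card c1 \<le> L'" using L_family_quadrant[OF f(4,3)] c1' by simp
  ultimately show False using c1 c1' by simp
qed

end

section \<open>The curtain model\<close>

locale curtain_model = CAT0_space +
  fixes lam :: "nat \<Rightarrow> real"
  assumes weights: "curtain_weights lam"
begin

abbreviation D :: "'a \<Rightarrow> 'a \<Rightarrow> real" where "D \<equiv> curtain_dist lam"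

abbreviation gp :: "'a \<Rightarrow> 'a \<Rightarrow> 'a \<Rightarrow> real" where "gp \<equiv> gromov_product D"

text \<open>The weighted sum of a defect of \<open>L + 10\<close> at each level. The 10 is large
  enough for all additive constants that occur, and for the slack asked for in
  \<open>exists_separating_level\<close>.\<close>

definition error :: real where "error = (\<Sum>n. lam (Suc n) * (real (Suc n) + 10))"

definition sep_sum :: "'a \<Rightarrow> 'a \<Rightarrow> 'a \<Rightarrow> real" where
  "sep_sum w x y = (\<Sum>n. lam (Suc n) * real (max_separating (Suc n) {w} {x, y}))"

lemma lam_pos: "0 < lam (Suc n)"
  using weights unfolding curtain_weights_def by simp

lemma summable_error: "summable (\<lambda>n. lam (Suc n) * (real (Suc n) + 10))"
proof (rule summable_comparison_test')
  show "summable (\<lambda>n. 11 * ((real (Suc n))\<^sup>2 * lam (Suc n)))"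
    using weights unfolding curtain_weights_def by (intro summable_mult) simp
  fix n
  have "m + 10 \<le> 11 * m\<^sup>2" if "1 \<le> m" for m :: real
    using mult_right_mono[of 1 m m] that unfolding power2_eq_square by linarith
  from this[of "real (Suc n)"] have "real (Suc n) + 10 \<le> 11 * (real (Suc n))\<^sup>2" by simp
  then have "lam (Suc n) * (real (Suc n) + 10) \<le> lam (Suc n) * (11 * (real (Suc n))\<^sup>2)"
    using lam_pos[of n] by (intro mult_left_mono) auto
  then show "norm (lam (Suc n) * (real (Suc n) + 10)) \<le> 11 * ((real (Suc n))\<^sup>2 * lam (Suc n))"
    using lam_pos[of n] by (simp add: mult_ac)
qed

lemma error_nonneg: "0 \<le> error"
  unfolding error_def using lam_pos by (intro suminf_nonneg summable_error) (simp add: less_imp_le)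

lemma summable_bounded:
  assumes "\<And>n. \<bar>f n\<bar> \<le> C * (real (Suc n) + 10)"
  shows "summable (\<lambda>n. lam (Suc n) * f n)"
proof (rule summable_comparison_test')
  show "summable (\<lambda>n. C * (lam (Suc n) * (real (Suc n) + 10)))" by (intro summable_mult summable_error)
  show "norm (lam (Suc n) * f n) \<le> C * (lam (Suc n) * (real (Suc n) + 10))" for n
    using mult_left_mono[OF assms[of n], of "lam (Suc n)"] lam_pos[of n] by (simp add: abs_mult mult_ac)
qed

lemma summable_const: "summable (\<lambda>n. lam (Suc n) * f n)" if "\<And>n. \<bar>f n\<bar> \<le> C" for f and C :: real
proof (rule summable_bounded)
  fix n
  have "0 \<le> C" using that[of n] by linarith
  then have "C * 1 \<le> C * (real (Suc n) + 10)" by (intro mult_left_mono) auto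
  then show "\<bar>f n\<bar> \<le> C * (real (Suc n) + 10)" using that[of n] by linarith
qed

lemma summable_L_dist: "x \<in> M \<Longrightarrow> y \<in> M \<Longrightarrow> summable (\<lambda>n. lam (Suc n) * real (L_dist (Suc n) x y))"
  by (rule summable_const[of _ "2 * d x y + 2"]) (use L_dist_le in simp)

lemma summable_sep: "w \<in> M \<Longrightarrow> x \<in> M \<Longrightarrow> summable (\<lambda>n. lam (Suc n) * real (max_separating (Suc n) {w} {x, y}))"
  by (rule summable_const[of _ "2 * d w x + 1"]) (use max_separating_le[of w "{w}" x "{x, y}"] in simp)

lemma suminf_le_error:
  assumes f: "summable (\<lambda>n. lam (Suc n) * f n)" and g: "summable (\<lambda>n. lam (Suc n) * g n)"
    and "\<And>n. f n \<le> g n + (real (Suc n) + 10)"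
  shows "(\<Sum>n. lam (Suc n) * f n) \<le> (\<Sum>n. lam (Suc n) * g n) + error"
proof -
  have "(\<Sum>n. lam (Suc n) * f n) \<le> (\<Sum>n. lam (Suc n) * g n + lam (Suc n) * (real (Suc n) + 10))"
  proof (rule suminf_le[OF _ f summable_add[OF g summable_error]])
    show "lam (Suc n) * f n \<le> lam (Suc n) * g n + lam (Suc n) * (real (Suc n) + 10)" for n
      using mult_left_mono[OF assms(3)[of n], of "lam (Suc n)"] lam_pos[of n] by (simp add: distrib_left)
  qed
  also have "\<dots> = (\<Sum>n. lam (Suc n) * g n) + error"
    unfolding error_def by (rule suminf_add[symmetric, OF g summable_error])
  finally show ?thesis .
qed

lemma D_self: "D x x = 0"
  by (simp add: curtain_dist_def L_dist_def)

lemma D_sym: "x \<in> M \<Longrightarrow> y \<in> M \<Longrightarrow> D x y = D y x"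
  by (simp add: curtain_dist_def L_dist_sym)

lemma D_triangle:
  assumes "x \<in> M" "y \<in> M" "z \<in> M" shows "D x z \<le> D x y + D y z"
proof -
  have "D x z \<le> (\<Sum>n. lam (Suc n) * real (L_dist (Suc n) x y) + lam (Suc n) * real (L_dist (Suc n) y z))"
    unfolding curtain_dist_def
  proof (rule suminf_le)
    fix n
    have "real (L_dist (Suc n) x z) \<le> real (L_dist (Suc n) x y) + real (L_dist (Suc n) y z)"
      using L_dist_triangle[OF assms, of "Suc n"] by linarith
    from mult_left_mono[OF this, of "lam (Suc n)"] lam_pos[of n]
    show "lam (Suc n) * real (L_dist (Suc n) x z) \<le>
      lam (Suc n) * real (L_dist (Suc n) x y) + lam (Suc n) * real (L_dist (Suc n) y z)"
      by (simp add: distrib_left)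
  qed (intro summable_add summable_L_dist assms)+
  also have "\<dots> = D x y + D y z"
    unfolding curtain_dist_def by (rule suminf_add[symmetric]) (intro summable_L_dist assms)+
  finally show ?thesis .
qed

lemma gp_eq_suminf:
  assumes "w \<in> M" "x \<in> M" "y \<in> M"
  shows "gp w x y = (\<Sum>n. lam (Suc n) * gromov_product (\<lambda>x y. real (L_dist (Suc n) x y)) w x y)"
    and "summable (\<lambda>n. lam (Suc n) * gromov_product (\<lambda>x y. real (L_dist (Suc n) x y)) w x y)"
proof -
  let ?f = "\<lambda>x y n. lam (Suc n) * real (L_dist (Suc n) x y)"
  have s: "(\<lambda>n. (?f w x n + ?f w y n - ?f x y n) / 2) sums ((D w x + D w y - D x y) / 2)"
    unfolding curtain_dist_def
    by (intro sums_divide sums_diff sums_add summable_sums summable_L_dist assms)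
  have "(?f w x n + ?f w y n - ?f x y n) / 2 =
      lam (Suc n) * gromov_product (\<lambda>x y. real (L_dist (Suc n) x y)) w x y" for n
    by (simp add: gromov_product_def algebra_simps add_divide_distrib diff_divide_distrib)
  with s have s: "(\<lambda>n. lam (Suc n) * gromov_product (\<lambda>x y. real (L_dist (Suc n) x y)) w x y) sums gp w x y"
    by (simp add: gromov_product_def)
  then show "gp w x y = (\<Sum>n. lam (Suc n) * gromov_product (\<lambda>x y. real (L_dist (Suc n) x y)) w x y)"
    "summable (\<lambda>n. lam (Suc n) * gromov_product (\<lambda>x y. real (L_dist (Suc n) x y)) w x y)"
    by (simp_all add: sums_iff)
qed

lemma gp_sep_sum:
  assumes "w \<in> M" "x \<in> M" "y \<in> M"
  shows "gp w x y \<le> sep_sum w x y + error" "sep_sum w x y \<le> gp w x y + error"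
proof -
  have *: "\<bar>gromov_product (\<lambda>x y. real (L_dist (Suc n) x y)) w x y - real (max_separating (Suc n) {w} {x, y})\<bar>
    \<le> real (Suc n) + 3" for n
    by (rule gromov_product_L_dist[OF assms])
  show "gp w x y \<le> sep_sum w x y + error" "sep_sum w x y \<le> gp w x y + error"
    unfolding gp_eq_suminf(1)[OF assms] sep_sum_def
    by (intro suminf_le_error gp_eq_suminf(2) summable_sep assms; use * in \<open>smt (verit)\<close>)+
qed

text \<open>One \<open>error\<close> for the alternative between the counts, and two for passing
  from \<open>gp\<close> to \<open>sep_sum\<close> and back.\<close>

lemma gp_hyperbolic:
  assumes "w \<in> M" "x \<in> M" "y \<in> M" "z \<in> M"
  shows "min (gp w x y) (gp w y z) \<le> gp w x z + 3 * error"
proof -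
  have le: "sep_sum w a b \<le> sep_sum w x z + error"
    if "\<forall>L. max_separating L {w} {a, b} \<le> max_separating L {w} {x, z} + L + 2" "a \<in> M" for a b
    unfolding sep_sum_def
  proof (intro suminf_le_error summable_sep assms that(2))
    fix n show "real (max_separating (Suc n) {w} {a, b})
      \<le> real (max_separating (Suc n) {w} {x, z}) + (real (Suc n) + 10)"
      using that(1)[rule_format, of "Suc n"] by linarith
  qed
  have "sep_sum w x y \<le> sep_sum w x z + error \<or> sep_sum w y z \<le> sep_sum w x z + error"
    using max_separating_hyperbolic[OF assms] le assms by blast
  then show ?thesis
    using gp_sep_sum[OF assms(1,2,3)] gp_sep_sum[OF assms(1,3,4)] gp_sep_sum[OF assms(1,2,4)] by linarith
qed

text \<open>If every level failed, summation would contradict the gap between the products. At the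
  level found, many curtains separate \<open>w\<close> from \<open>x\<close> and \<open>x0\<close>
  but not from \<open>y\<close>; the slack \<open>L + 10\<close> leaves the five that
  \<open>bottleneck\<close> needs and also bounds \<open>L\<close> by a distance.\<close>

lemma exists_separating_level:
  assumes "w \<in> M" "x \<in> M" "x0 \<in> M" "y \<in> M" and gp: "gp w x0 y + 3 * error < gp w x x0"
  shows "\<exists>L. max_separating L {w} {x0, y} + L + 10 < max_separating L {w} {x, x0}"
proof (rule ccontr)
  assume "\<not> ?thesis"
  then have *: "max_separating L {w} {x, x0} \<le> max_separating L {w} {x0, y} + L + 10" for L
    using not_less by blast
  have "sep_sum w x x0 \<le> sep_sum w x0 y + error"
    unfolding sep_sum_def
  proof (intro suminf_le_error summable_sep assms)
    fix n show "real (max_separating (Suc n) {w} {x, x0})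
      \<le> real (max_separating (Suc n) {w} {x0, y}) + (real (Suc n) + 10)"
      using *[of "Suc n"] by linarith
  qed
  then show False using gp gp_sep_sum[OF assms(1-3)] gp_sep_sum[OF assms(1,3,4)] by linarith
qed

end


context CAT0_space
begin

section \<open>Bottlenecks\<close>

text \<open>Uniqueness of geodesics: for a point with equality in the triangle inequality the bound
  of \<open>CN_inequality\<close> is 0, so it is the point of \<gamma> at its distance from
  \<open>x\<close>.\<close>

lemma between_dist:
  assumes M: "x \<in> M" "y \<in> M" "p \<in> M" "q \<in> M"
    and p: "d x p + d p y = d x y" and q: "d x q + d q y = d x y"
  shows "d p q = \<bar>d x p - d x q\<bar>"
proof -
  define l where "l = d x y"
  obtain \<gamma> where \<gamma>: "geodesic {0..l} \<gamma>" "\<gamma> 0 = x" "\<gamma> l = y" using obtain_geodesic[OF M(1,2)] l_def by metis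
  have on: "r = \<gamma> (d x r)" if r: "r \<in> M" "d x r + d r y = l" for r
  proof (cases "l = 0")
    case True
    then have "d x r = 0" "x = r" using r nonneg[of x r] nonneg[of r y] zero[OF M(1) r(1)] by linarith+
    then show ?thesis using \<gamma> by simp
  next
    case False
    define t where "t = d x r"
    have t: "0 \<le> t" "t \<le> l" "d r y = l - t" using r nonneg[of r y] by (auto simp: t_def)
    have "0 < l" using False nonneg[of x y] unfolding l_def by linarith
    then have l: "0 < l" "0 \<in> {0..l}" "l \<in> {0..l}" by auto
    have "(l - 0) * (d r (\<gamma> t))\<^sup>2 \<le> (l - t) * (d r (\<gamma> 0))\<^sup>2 + (t - 0) * (d r (\<gamma> l))\<^sup>2 - (t - 0) * (l - t) * (l - 0)"
      by (rule CN_inequality[OF \<gamma>(1) l(2,3) t(1,2) r(1)])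
    also have "\<dots> = 0"
      using t by (simp add: \<gamma> commute[of r x] t_def[symmetric]) (simp add: power2_eq_square algebra_simps)
    finally have "(d r (\<gamma> t))\<^sup>2 \<le> 0" using l(1) by (simp add: mult_le_0_iff)
    then have "d r (\<gamma> t) = 0" by simp
    moreover have "\<gamma> t \<in> M" using geodesicD(3)[OF \<gamma>(1)] t by simp
    ultimately show ?thesis using zero[OF r(1)] t_def by simp
  qed
  have "d x p \<le> l" "d x q \<le> l" using p q nonneg[of p y] nonneg[of q y] unfolding l_def by linarith+
  then have "d x p \<in> {0..l}" "d x q \<in> {0..l}" by auto
  from geodesicD(4)[OF \<gamma>(1) this] show ?thesis using on[OF M(3)] on[OF M(4)] p q l_def by simp
qed

lemma nearest_param_reverse:
  assumes g: "geodesic {0..l} \<alpha>" "0 \<le> l" and x: "x \<in> M"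
  shows "nearest_param {0..l} \<alpha> x = l - nearest_param {0..l} (\<lambda>t. \<alpha> (l - t)) x"
proof (rule nearest_param_unique[OF g(1) x])
  let ?t = "nearest_param {0..l} (\<lambda>t. \<alpha> (l - t)) x"
  note r = geodesic_reverse[OF g(1)]
  have ne: "{0..l} \<noteq> {}" using g by simp
  show "l - ?t \<in> {0..l}" using nearest_param_in[OF r ne x] by simp
  show "d x (\<alpha> (l - ?t)) \<le> d x (\<alpha> s)" if "s \<in> {0..l}" for s
    using nearest_param_le[OF r ne x, of "l - s"] that by simp
qed

lemma dual_curtain_family:
  assumes g: "geodesic {0..l} \<alpha>" and l: "2 * real m \<le> l"
  shows "\<exists>K. finite K \<and> card K = m \<and>
    disjoint_separating K {x \<in> M. nearest_param {0..l} \<alpha> x = 0} {x \<in> M. nearest_param {0..l} \<alpha> x = l}"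
proof -
  have ne: "{0..l} \<noteq> {}" using l by (simp add: order_trans[OF _ l])
  \<comment> \<open>Spacing 2 keeps curtains of width 1 disjoint; the last one ends at
    \<open>2 * m - 1/2\<close>, before the end of the geodesic.\<close>
  define r where "r j = 2 * real j + 1" for j :: nat
  define h where "h j = dual_curtain {0..l} \<alpha> (r j)" for j
  have at: "curtain_at {0..l} \<alpha> (r j) (h j)" if "j < m" for j
  proof -
    have "real (Suc j) \<le> real m" using that by simp
    then have "r j + 1 \<le> l" using l unfolding r_def by simp
    moreover have "r j \<ge> 1" by (simp add: r_def)
    ultimately show ?thesis unfolding curtain_at_def h_def using g by auto
  qed
  have h: "x \<in> h j \<longleftrightarrow> x \<in> M \<and> nearest_param {0..l} \<alpha> x \<in> {r j - 1/2..r j + 1/2}" for x j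
    unfolding h_def dual_curtain_def by (rule proj_preimage_iff[OF g ne])
  have sep: "curtain_separates (h j) {x \<in> M. nearest_param {0..l} \<alpha> x = 0} {x \<in> M. nearest_param {0..l} \<alpha> x = l}"
    if "j < m" for j
  proof -
    have "real (Suc j) \<le> real m" using that by simp
    then have "r j + 1/2 < l" using l unfolding r_def by simp
    moreover have "r j - 1/2 > 0" by (simp add: r_def)
    ultimately have "{x \<in> M. nearest_param {0..l} \<alpha> x = 0} \<subseteq> minus_halfspace {0..l} \<alpha> (r j)"
      "{x \<in> M. nearest_param {0..l} \<alpha> x = l} \<subseteq> plus_halfspace {0..l} \<alpha> (r j)"
      unfolding minus_halfspace_def plus_halfspace_def using proj_preimage_iff[OF g ne] by auto
    then show ?thesis unfolding curtain_separates_def using at[OF that] by blast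
  qed
  have disj: "h i \<inter> h j = {}" if "i < j" for i j
  proof -
    have "real (Suc i) \<le> real j" using that by simp
    then have "r i + 1/2 < r j - 1/2" unfolding r_def by simp
    then show ?thesis using h by fastforce
  qed
  have inj: "inj_on h {..<m}"
  proof (rule inj_onI)
    fix i j assume ij: "i \<in> {..<m}" "j \<in> {..<m}" "h i = h j"
    have "h i \<noteq> {}" using curtain_nonempty[OF curtain_separates_curtain[OF sep]] ij by simp
    then show "i = j" using disj[of i j] disj[of j i] ij(3) by (cases i j rule: linorder_cases) auto
  qed
  have "disjoint_separating (h ` {..<m}) {x \<in> M. nearest_param {0..l} \<alpha> x = 0} {x \<in> M. nearest_param {0..l} \<alpha> x = l}"
    unfolding disjoint_separating_def chain_separates_def
  proof (intro conjI ballI impI)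
    fix k k' assume "k \<in> h ` {..<m}" "k' \<in> h ` {..<m}" "k \<noteq> k'"
    then obtain i j where "k = h i" "k' = h j" "i \<noteq> j" by blast
    then show "k \<inter> k' = {}" using disj[of i j] disj[of j i] by (cases i j rule: linorder_cases) auto
  qed (use sep in blast)
  then show ?thesis using inj by (intro exI[of _ "h ` {..<m}"]) (simp add: card_image)
qed

text \<open>Both \<open>h\<close> and \<open>h'\<close> are connected and have points projecting to
  either end of \<alpha>, so they cross every curtain dual to \<alpha>. A longer \<alpha> would have
  room for \<open>L + 1\<close> disjoint dual curtains.\<close>

lemma L_separated_bridge_short:
  assumes L: "L_separated L h h'" and g: "geodesic {0..l} \<alpha>" "0 \<le> l"
    and h: "x \<in> h" "nearest_param {0..l} \<alpha> x = 0" "y \<in> h" "nearest_param {0..l} \<alpha> y = l"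
    and h': "x' \<in> h'" "nearest_param {0..l} \<alpha> x' = 0" "y' \<in> h'" "nearest_param {0..l} \<alpha> y' = l"
  shows "l \<le> 2 * real L + 2"
proof (rule ccontr)
  assume "\<not> ?thesis"
  then have "2 * real (L + 1) \<le> l" by simp
  from dual_curtain_family[OF g(1) this] obtain K where K: "finite K" "card K = L + 1"
    "disjoint_separating K {x \<in> M. nearest_param {0..l} \<alpha> x = 0} {x \<in> M. nearest_param {0..l} \<alpha> x = l}"
    by blast
  have c: "curtain h" "curtain h'" using L by (simp_all add: L_separated_def)
  have sub: "h \<subseteq> M" "h' \<subseteq> M" using c curtain_subset by auto
  have "card K \<le> L"
  proof (rule L_separated_card_le[OF L K(1)])
    show "disjoint_separating K {x} {y}"
      unfolding disjoint_separating_def chain_separates_def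
    proof (intro conjI ballI impI)
      show "k \<inter> k' = {}" if "k \<in> K" "k' \<in> K" "k \<noteq> k'" for k k'
        using disjoint_separatingD(1)[OF K(3) that] .
      show "curtain_separates k {x} {y}" if "k \<in> K" for k
        by (rule curtain_separates_mono[OF disjoint_separatingD(2)[OF K(3) that]]) (use h sub in auto)
    qed
    fix k assume k: "k \<in> K"
    have "h \<inter> k \<noteq> {}"
      by (rule curtain_separates_crossing[OF disjoint_separatingD(2)[OF K(3) k] curtain_connected[OF c(1)]])
        (use h sub in auto)
    moreover have "h' \<inter> k \<noteq> {}"
      by (rule curtain_separates_crossing[OF disjoint_separatingD(2)[OF K(3) k] curtain_connected[OF c(2)]])
        (use h' sub in auto)
    ultimately show "k \<inter> h \<noteq> {} \<and> k \<inter> h' \<noteq> {}" by blast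
  qed
  then show False using K(2) by simp
qed

lemma five_curtains:
  assumes c: "disjoint_separating c {a} {b}" "finite c" "5 \<le> card c"
  obtains h1 h2 h3 h4 h5 where "h1 \<in> c" "h2 \<in> c" "h3 \<in> c" "h4 \<in> c" "h5 \<in> c" "h1 \<noteq> h2" "h4 \<noteq> h5"
    "curtain_separates h1 {a} (insert b h3)" "curtain_separates h2 {a} (insert b h3)"
    "curtain_separates h4 (insert a h3) {b}" "curtain_separates h5 (insert a h3) {b}"
proof -
  obtain xs where xs: "set xs = c" "distinct xs"
    "sorted_wrt (\<lambda>h k. curtain_separates h {a} (insert b k)) xs"
    using sorted_curtains[OF c(2,1)] by blast
  have len: "5 \<le> length xs" using distinct_card[OF xs(2)] xs(1) c(3) by simp
  have less: "curtain_separates (xs ! i) {a} (insert b (xs ! j))" if "i < j" "j < 5" for i j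
    using sorted_wrt_nth_less[OF xs(3) that(1)] that len by simp
  have mem: "xs ! i \<in> c" if "i < 5" for i using xs(1) nth_mem[of i xs] that len by simp
  have flip: "curtain_separates (xs ! j) (insert a (xs ! i)) {b}" if "i < j" "j < 5" for i j
    by (rule curtain_before_flip[OF less[OF that] disjoint_separatingD(2)[OF c(1) mem[OF that(2)]]])
  have neq: "xs ! i \<noteq> xs ! j" if "i < j" "j < 5" for i j
    using nth_eq_iff_index_eq[OF xs(2), of i j] that len by simp
  show ?thesis
    using that[of "xs ! 0" "xs ! 1" "xs ! 2" "xs ! 3" "xs ! 4"] mem less flip neq by simp
qed

text \<open>Take a point \<open>p\<close> of \<gamma> on the middle curtain and let \<alpha> be the
  perpendicular from its foot on \<sigma> to \<open>p\<close>. All of \<sigma> projects to the start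
  of \<alpha>, and one of the two halves of \<gamma> at \<open>p\<close> projects to its end. Two of
  the curtains cross both \<sigma> and that half, so \<open>L_separated_bridge_short\<close> bounds
  the length of \<alpha>.\<close>

lemma bottleneck:
  assumes c: "L_family L c {a, a'} {b, b'}" "5 \<le> card c"
    and \<sigma>: "geodesic {0..m} \<sigma>" "0 \<le> m" "\<sigma> 0 = a" "\<sigma> m = b"
    and \<gamma>: "geodesic {0..n} \<gamma>" "0 \<le> n" "\<gamma> 0 = a'" "\<gamma> n = b'"
  shows "\<exists>s\<in>{0..m}. \<exists>t\<in>{0..n}. d (\<sigma> s) (\<gamma> t) \<le> 2 * real L + 2"
proof -
  have "disjoint_separating c {a'} {b'}" using L_family_disjoint_separating[OF c(1)] by simp
  from five_curtains[OF this L_familyD(1)[OF c(1)] c(2)]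
  obtain h1 h2 h3 h4 h5 where mem: "h1 \<in> c" "h2 \<in> c" "h3 \<in> c" "h4 \<in> c" "h5 \<in> c"
    and neq: "h1 \<noteq> h2" "h4 \<noteq> h5"
    and h12: "curtain_separates h1 {a'} (insert b' h3)" "curtain_separates h2 {a'} (insert b' h3)"
    and h45: "curtain_separates h4 (insert a' h3) {b'}" "curtain_separates h5 (insert a' h3) {b'}"
    by metis
  have im: "connectedin mtopology (\<sigma> ` {0..m})" "connectedin mtopology (\<gamma> ` S)"
    if "is_interval S" "S \<subseteq> {0..n}" for S
    using geodesic_image_connected[OF \<sigma>(1)] geodesic_image_connected[OF \<gamma>(1) that(2,1)]
    by (simp_all add: is_interval_cc)
  have ends: "a \<in> \<sigma> ` {0..m}" "b \<in> \<sigma> ` {0..m}" using \<sigma>(2-4) by force+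
  have \<sigma>_meets: "\<exists>s\<in>{0..m}. \<sigma> s \<in> h" if "h \<in> c" for h
  proof -
    have "\<sigma> ` {0..m} \<inter> h \<noteq> {}"
      by (rule curtain_separates_crossing[OF L_familyD(3)[OF c(1) that]])
        (use ends im(1)[of "{}"] in \<open>auto simp: is_interval_empty\<close>)
    then show ?thesis by blast
  qed
  have \<gamma>_meets: "\<exists>t\<in>{u..v}. \<gamma> t \<in> h"
    if "curtain_separates h S T" "\<gamma> u \<in> S" "\<gamma> v \<in> T" "0 \<le> u" "u \<le> v" "v \<le> n" for h S T u v
  proof -
    have "u \<in> {u..v}" "v \<in> {u..v}" "{u..v} \<subseteq> {0..n}" using that by auto
    then have "\<gamma> ` {u..v} \<inter> S \<noteq> {}" "\<gamma> ` {u..v} \<inter> T \<noteq> {}" using that(2,3) by blast+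
    from curtain_separates_crossing[OF that(1) im(2)[OF is_interval_cc \<open>{u..v} \<subseteq> {0..n}\<close>] this]
    have "\<gamma> ` {u..v} \<inter> h \<noteq> {}" .
    then show ?thesis by blast
  qed
  obtain t where t: "t \<in> {0..n}" "\<gamma> t \<in> h3"
    using \<gamma>_meets[OF L_familyD(3)[OF c(1) mem(3)], of 0 n] \<gamma> by auto
  define p where "p = \<gamma> t"
  have M: "p \<in> M" "a' \<in> M" "b' \<in> M" using geodesicD(3)[OF \<gamma>(1)] t \<gamma>(2-4) by (auto simp: p_def)
  have ne: "{0..m} \<noteq> {}" using \<sigma>(2) by simp
  define s where "s = nearest_param {0..m} \<sigma> p"
  have s: "s \<in> {0..m}" using nearest_param_in[OF \<sigma>(1) ne M(1)] by (simp add: s_def)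
  have q: "\<sigma> s \<in> M" using geodesicD(3)[OF \<sigma>(1) s] .
  define l where "l = d (\<sigma> s) p"
  obtain \<alpha> where \<alpha>: "geodesic {0..l} \<alpha>" "\<alpha> 0 = \<sigma> s" "\<alpha> l = p"
    using obtain_geodesic[OF q M(1)] l_def by metis
  have l: "0 \<le> l" by (simp add: l_def)
  have start: "nearest_param {0..l} \<alpha> (\<sigma> u) = 0" if "u \<in> {0..m}" for u
    using nearest_param_perpendicular[OF \<sigma>(1) ne M(1) \<alpha>(1) l _ \<alpha>(3) that] \<alpha>(2) by (simp add: s_def)
  note rev = geodesic_reverse[OF \<alpha>(1)]
  let ?\<rho> = "\<lambda>t. \<alpha> (l - t)"
  have lne: "{0..l} \<noteq> {}" using l by simp
  have \<rho>0: "?\<rho> 0 = p" using \<alpha>(3) by simp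
  \<comment> \<open>If \<open>x\<close> projects to \<open>p\<close>, so does the whole segment from
    \<open>x\<close> to \<open>p\<close>; applied to an endpoint of \<gamma>, this covers half of
    \<gamma>.\<close>
  have endpoint: "nearest_param {0..l} \<alpha> (\<gamma> u) = l"
    if x: "x \<in> M" "nearest_param {0..l} ?\<rho> x = 0" and u: "u \<in> {0..n}" "d x (\<gamma> u) + d (\<gamma> u) p \<le> d x p" for x u
  proof -
    have uM: "\<gamma> u \<in> M" using geodesicD(3)[OF \<gamma>(1) u(1)] .
    have "nearest_param {0..l} ?\<rho> (\<gamma> u) = nearest_param {0..l} ?\<rho> x"
      by (rule nearest_param_on_segment[OF rev lne x(1) uM]) (use x(2) u(2) \<rho>0 in simp)
    then show ?thesis using nearest_param_reverse[OF \<alpha>(1) l uM] x(2) by simp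
  qed
  have dist: "d (\<gamma> u) (\<gamma> v) = \<bar>u - v\<bar>" if "u \<in> {0..n}" "v \<in> {0..n}" for u v
    using geodesicD(4)[OF \<gamma>(1) that] .
  have "d a' (?\<rho> 0) + d (?\<rho> 0) b' = d a' b'"
    unfolding \<rho>0 p_def \<gamma>(3,4)[symmetric] using dist[of 0 t] dist[of t n] dist[of 0 n] t(1) \<gamma>(2) by simp
  \<comment> \<open>The angles of \<gamma> with the perpendicular are not both acute, but either may
    be; therefore two curtains are kept on each side of \<open>h3\<close>.\<close>
  from nearest_param_start_or[OF rev l M(2,3) this]
  have "l \<le> 2 * real L + 2"
  proof
    assume a: "nearest_param {0..l} ?\<rho> a' = 0"
    have e: "nearest_param {0..l} \<alpha> (\<gamma> u) = l" if "u \<in> {0..t}" for u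
      by (rule endpoint[OF M(2) a]) (use that t(1) \<gamma>(2) dist[of 0 u] dist[of u t] dist[of 0 t] in \<open>auto simp: p_def \<gamma>(3)[symmetric]\<close>)
    have b1: "\<exists>u\<in>{0..t}. \<gamma> u \<in> h1" by (rule \<gamma>_meets[OF h12(1)]) (use \<gamma>(3) t in auto)
    have b2: "\<exists>u\<in>{0..t}. \<gamma> u \<in> h2" by (rule \<gamma>_meets[OF h12(2)]) (use \<gamma>(3) t in auto)
    obtain u1 u2 s1 s2 where "u1 \<in> {0..t}" "\<gamma> u1 \<in> h1" "u2 \<in> {0..t}" "\<gamma> u2 \<in> h2"
      "s1 \<in> {0..m}" "\<sigma> s1 \<in> h1" "s2 \<in> {0..m}" "\<sigma> s2 \<in> h2"
      using b1 b2 \<sigma>_meets mem(1,2) by metis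
    then show ?thesis
      using L_separated_bridge_short[OF L_familyD(2)[OF c(1) mem(1,2) neq(1)] \<alpha>(1) l] e start by metis
  next
    assume b: "nearest_param {0..l} ?\<rho> b' = 0"
    have e: "nearest_param {0..l} \<alpha> (\<gamma> u) = l" if "u \<in> {t..n}" for u
      by (rule endpoint[OF M(3) b]) (use that t(1) \<gamma>(2) dist[of n u] dist[of u t] dist[of n t] in \<open>auto simp: p_def \<gamma>(4)[symmetric]\<close>)
    have b1: "\<exists>u\<in>{t..n}. \<gamma> u \<in> h4" by (rule \<gamma>_meets[OF h45(1)]) (use \<gamma>(4) t in auto)
    have b2: "\<exists>u\<in>{t..n}. \<gamma> u \<in> h5" by (rule \<gamma>_meets[OF h45(2)]) (use \<gamma>(4) t in auto)
    obtain u1 u2 s1 s2 where "u1 \<in> {t..n}" "\<gamma> u1 \<in> h4" "u2 \<in> {t..n}" "\<gamma> u2 \<in> h5"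
      "s1 \<in> {0..m}" "\<sigma> s1 \<in> h4" "s2 \<in> {0..m}" "\<sigma> s2 \<in> h5"
      using b1 b2 \<sigma>_meets mem(4,5) by metis
    then show ?thesis
      using L_separated_bridge_short[OF L_familyD(2)[OF c(1) mem(4,5) neq(2)] \<alpha>(1) l] e start by metis
  qed
  then show ?thesis using s t(1) unfolding l_def p_def by blast
qed

section \<open>Isometries\<close>

definition isometry :: "('a \<Rightarrow> 'a) \<Rightarrow> bool" where
  "isometry f \<longleftrightarrow> f ` M = M \<and> (\<forall>x\<in>M. \<forall>y\<in>M. d (f x) (f y) = d x y)"

lemma isometryD:
  assumes "isometry f"
  shows "f ` M = M" "\<And>x. x \<in> M \<Longrightarrow> f x \<in> M" "\<And>x y. x \<in> M \<Longrightarrow> y \<in> M \<Longrightarrow> d (f x) (f y) = d x y"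
  using assms unfolding isometry_def by blast+

lemma isometry_inj: "isometry f \<Longrightarrow> inj_on f M"
proof (rule inj_onI)
  fix x y assume f: "isometry f" and xy: "x \<in> M" "y \<in> M" "f x = f y"
  have "d x y = d (f x) (f y)" using isometryD(3)[OF f xy(1,2)] by simp
  also have "\<dots> = 0" using xy isometryD(2)[OF f] by simp
  finally show "x = y" using zero xy by simp
qed

lemma isometry_inverse:
  assumes f: "isometry f"
  shows "isometry (inv_into M f)" "\<And>x. x \<in> M \<Longrightarrow> inv_into M f (f x) = x"
    "\<And>x. x \<in> M \<Longrightarrow> f (inv_into M f x) = x"
proof -
  have inM: "inv_into M f x \<in> M" "f (inv_into M f x) = x" if "x \<in> M" for x
    using that isometryD(1)[OF f] inv_into_into[of x f M] f_inv_into_f[of x f M] by auto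
  then show "f (inv_into M f x) = x" if "x \<in> M" for x using that by blast
  show left: "inv_into M f (f x) = x" if "x \<in> M" for x using inv_into_f_f[OF isometry_inj[OF f] that] .
  show "isometry (inv_into M f)"
    unfolding isometry_def
  proof (intro conjI ballI)
    show "inv_into M f ` M = M" using inM(1) left isometryD(2)[OF f] by (metis image_subset_iff subsetI subset_antisym image_eqI)
    show "d (inv_into M f x) (inv_into M f y) = d x y" if "x \<in> M" "y \<in> M" for x y
      using isometryD(3)[OF f inM(1)[OF that(1)] inM(1)[OF that(2)]] inM(2) that by simp
  qed
qed

context
  fixes f assumes f: "isometry f"
begin

lemma isometry_geodesic:
  assumes "geodesic I \<alpha>" shows "geodesic I (\<lambda>t. f (\<alpha> t))"
  using assms isometryD[OF f] unfolding geodesic_def by (auto simp: Pi_iff)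

lemma isometry_nearest_param:
  assumes g: "geodesic I \<alpha>" "I \<noteq> {}" and x: "x \<in> M"
  shows "nearest_param I (\<lambda>t. f (\<alpha> t)) (f x) = nearest_param I \<alpha> x"
proof (rule nearest_param_unique[OF isometry_geodesic[OF g(1)] isometryD(2)[OF f x] nearest_param_in[OF g x]])
  show "d (f x) (f (\<alpha> (nearest_param I \<alpha> x))) \<le> d (f x) (f (\<alpha> s))" if "s \<in> I" for s
    using nearest_param_le[OF g x that] isometryD(3)[OF f x] geodesicD(3)[OF g(1)] nearest_param_in[OF g x] that
    by simp
qed

lemma isometry_proj_preimage:
  assumes g: "geodesic I \<alpha>" "I \<noteq> {}"
  shows "proj_preimage I (\<lambda>t. f (\<alpha> t)) J = f ` proj_preimage I \<alpha> J"
proof (intro equalityI subsetI)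
  fix y assume "y \<in> proj_preimage I (\<lambda>t. f (\<alpha> t)) J"
  then have y: "y \<in> M" "nearest_param I (\<lambda>t. f (\<alpha> t)) y \<in> J"
    using proj_preimage_iff[OF isometry_geodesic[OF g(1)] g(2)] by blast+
  then obtain x where x: "x \<in> M" "y = f x" using isometryD(1)[OF f] by blast
  then have "x \<in> proj_preimage I \<alpha> J"
    using proj_preimage_iff[OF g] y isometry_nearest_param[OF g x(1)] by simp
  then show "y \<in> f ` proj_preimage I \<alpha> J" using x by blast
next
  fix y assume "y \<in> f ` proj_preimage I \<alpha> J"
  then obtain x where x: "x \<in> M" "nearest_param I \<alpha> x \<in> J" "y = f x" using proj_preimage_iff[OF g] by blast
  then show "y \<in> proj_preimage I (\<lambda>t. f (\<alpha> t)) J"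
    using proj_preimage_iff[OF isometry_geodesic[OF g(1)] g(2)] isometry_nearest_param[OF g x(1)] isometryD(2)[OF f]
    by simp
qed

lemma isometry_curtain_separates:
  assumes "curtain_separates k S T" shows "curtain_separates (f ` k) (f ` S) (f ` T)"
proof -
  obtain A B where w: "wall k A B" "S \<subseteq> A" "T \<subseteq> B" using assms by (rule curtain_separatesE)
  obtain I \<alpha> r where c: "curtain_at I \<alpha> r k"
    and AB: "A = minus_halfspace I \<alpha> r \<and> B = plus_halfspace I \<alpha> r \<or>
      A = plus_halfspace I \<alpha> r \<and> B = minus_halfspace I \<alpha> r"
    using w(1) unfolding wall_def by blast
  have g: "geodesic I \<alpha>" and int: "{r - 1/2 .. r + 1/2} \<subseteq> interior I"
    and k: "k = dual_curtain I \<alpha> r" using c unfolding curtain_at_def by blast+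
  have "r \<in> I" using int interior_subset by fastforce
  then have ne: "I \<noteq> {}" by blast
  let ?\<beta> = "\<lambda>t. f (\<alpha> t)"
  have "curtain_at I ?\<beta> r (f ` k)"
    unfolding curtain_at_def k dual_curtain_def
    using isometry_geodesic[OF g] int isometry_proj_preimage[OF g ne] by simp
  moreover have "minus_halfspace I ?\<beta> r = f ` minus_halfspace I \<alpha> r" "plus_halfspace I ?\<beta> r = f ` plus_halfspace I \<alpha> r"
    unfolding minus_halfspace_def plus_halfspace_def using isometry_proj_preimage[OF g ne] by simp_all
  ultimately have "wall (f ` k) (f ` A) (f ` B)" unfolding wall_def using AB by blast
  then show ?thesis by (rule curtain_separatesI) (use w in auto)
qed

lemma isometry_curtain: "curtain k \<Longrightarrow> curtain (f ` k)"
  using curtain_imp_wall[of k] curtain_separatesI[of k _ _ "{}" "{}"]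
    isometry_curtain_separates[of k "{}" "{}"] curtain_separates_curtain by blast

lemma isometry_curtain_chain:
  assumes "curtain_chain c" shows "curtain_chain ((`) f ` c)"
proof -
  obtain J :: "int set" and h where h: "\<forall>i\<in>J. \<forall>k\<in>J. {i..k} \<subseteq> J" "c = h ` J" "\<forall>i\<in>J. curtain (h i)"
    "\<forall>i\<in>J. i - 1 \<in> J \<longrightarrow> i + 1 \<in> J \<longrightarrow> curtain_separates (h i) (h (i - 1)) (h (i + 1))"
    using assms unfolding curtain_chain_def by blast
  show ?thesis
    unfolding curtain_chain_def
  proof (intro exI[of _ J] exI[of _ "\<lambda>i. f ` h i"] conjI ballI impI)
    show "{i..k} \<subseteq> J" if "i \<in> J" "k \<in> J" for i k using h(1) that by blast
    show "(`) f ` c = (\<lambda>i. f ` h i) ` J" using h(2) by (simp add: image_image)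
    show "curtain (f ` h i)" if "i \<in> J" for i using h(3) that isometry_curtain by blast
    show "curtain_separates (f ` h i) (f ` h (i - 1)) (f ` h (i + 1))"
      if "i \<in> J" "i - 1 \<in> J" "i + 1 \<in> J" for i
      using h(4) that isometry_curtain_separates by blast
  qed
qed

lemma isometry_image_inj: "(\<And>k. k \<in> c \<Longrightarrow> k \<subseteq> M) \<Longrightarrow> inj_on ((`) f) c"
  by (rule inj_onI) (metis inj_on_image_eq_iff[OF isometry_inj[OF f]])

end

lemma isometry_L_separated:
  assumes f: "isometry f" and L: "L_separated L h h'" shows "L_separated L (f ` h) (f ` h')"
  unfolding L_separated_def
proof (intro conjI allI impI)
  have c: "curtain h" "curtain h'" "h \<inter> h' = {}" using L by (simp_all add: L_separated_def)
  have sub: "h \<subseteq> M" "h' \<subseteq> M" using c curtain_subset by auto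
  show "curtain (f ` h)" "curtain (f ` h')" using c isometry_curtain[OF f] by auto
  show "f ` h \<inter> f ` h' = {}" using inj_on_image_Int[OF isometry_inj[OF f] sub] c(3) by simp
  \<comment> \<open>A chain that meets both images is pulled back by the inverse; the pullback has
    the same cardinality because curtains are subsets of \<open>M\<close>.\<close>
  define g where "g = inv_into M f"
  note inv = isometry_inverse[OF f, folded g_def]
  fix e assume e: "curtain_chain e" "\<forall>k\<in>e. k \<inter> f ` h \<noteq> {} \<and> k \<inter> f ` h' \<noteq> {}"
  have meet: "g ` k \<inter> z \<noteq> {}" if kz: "k \<inter> f ` z \<noteq> {}" "z \<subseteq> M" for k z
  proof -
    obtain x where x: "x \<in> z" "f x \<in> k" using kz(1) by blast
    then have "g (f x) = x" using inv(2) kz(2) by blast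
    then show ?thesis using x by (metis IntI empty_iff imageI)
  qed
  have "curtain_chain ((`) g ` e)" by (rule isometry_curtain_chain[OF inv(1) e(1)])
  moreover have "\<forall>k\<in>(`) g ` e. k \<inter> h \<noteq> {} \<and> k \<inter> h' \<noteq> {}"
    using e(2) meet[OF _ sub(1)] meet[OF _ sub(2)] by simp
  ultimately have fin: "finite ((`) g ` e)" "card ((`) g ` e) \<le> L" using L unfolding L_separated_def by blast+
  have inj: "inj_on ((`) g) e"
    using curtain_subset curtain_chain_curtain[OF e(1)] by (intro isometry_image_inj[OF inv(1)]) blast
  show "finite e" using finite_imageD[OF fin(1) inj] .
  show "card e \<le> L" using card_image[OF inj] fin(2) by simp
qed

lemma isometry_L_family:
  assumes f: "isometry f" and c: "L_family L c S T"
  shows "L_family L ((`) f ` c) (f ` S) (f ` T)" "card ((`) f ` c) = card c"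
proof -
  have "k \<subseteq> M" if "k \<in> c" for k
    using curtain_subset[OF curtain_separates_curtain[OF L_familyD(3)[OF c that]]] .
  then have "inj_on ((`) f) c" by (rule isometry_image_inj[OF f])
  then show "card ((`) f ` c) = card c" by (rule card_image)
  show "L_family L ((`) f ` c) (f ` S) (f ` T)"
    unfolding L_family_def
  proof (intro conjI ballI impI)
    show "finite ((`) f ` c)" using L_familyD(1)[OF c] by simp
    show "L_separated L h h'" if hh: "h \<in> (`) f ` c" "h' \<in> (`) f ` c" "h \<noteq> h'" for h h'
    proof -
      obtain k k' where "h = f ` k" "h' = f ` k'" "k \<in> c" "k' \<in> c" using hh by blast
      moreover from this hh(3) have "k \<noteq> k'" by blast
      ultimately show ?thesis using L_familyD(2)[OF c] isometry_L_separated[OF f] by simp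
    qed
    show "curtain_separates h (f ` S) (f ` T)" if "h \<in> (`) f ` c" for h
      using that L_familyD(3)[OF c] isometry_curtain_separates[OF f] by blast
  qed
qed

lemma isometry_max_separating_le:
  assumes f: "isometry f" and xy: "x \<in> M" "y \<in> M"
  shows "max_separating L {x} {y} \<le> max_separating L {f x} {f y}"
proof -
  obtain c where c: "L_family L c {x} {y}" "card c = max_separating L {x} {y}"
    using max_separating_attained[of x "{x}" y "{y}" L] xy by auto
  have "card ((`) f ` c) \<le> max_separating L {f x} {f y}"
    by (rule max_separating_ge[of "f x" _ "f y"])
      (use isometryD(2)[OF f] xy isometry_L_family(1)[OF f c(1)] in auto)
  then show ?thesis using isometry_L_family(2)[OF f c(1)] c(2) by simp
qed

lemma isometry_L_dist:
  assumes f: "isometry f" and xy: "x \<in> M" "y \<in> M"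
  shows "L_dist L (f x) (f y) = L_dist L x y"
proof -
  have fM: "f x \<in> M" "f y \<in> M" using isometryD(2)[OF f] xy by auto
  have "f x = f y \<longleftrightarrow> x = y" using isometry_inj[OF f] xy by (auto dest: inj_onD)
  moreover have "max_separating L {f x} {f y} = max_separating L {x} {y}"
    using isometry_max_separating_le[OF f xy, of L]
      isometry_max_separating_le[OF isometry_inverse(1)[OF f] fM, of L] isometry_inverse(2)[OF f] xy
    by simp
  ultimately show ?thesis by (simp add: L_dist_eq fM xy)
qed

lemma isometry_curtain_dist:
  "isometry f \<Longrightarrow> x \<in> M \<Longrightarrow> y \<in> M \<Longrightarrow> curtain_dist lam (f x) (f y) = curtain_dist lam x y"
  by (simp add: curtain_dist_def isometry_L_dist)

end

section \<open>From Gromov products in the curtain model to CAT(0) geodesics\<close>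

context curtain_model
begin

text \<open>At a suitable level, five curtains separate \<open>w\<close> and \<open>y\<close> from
  \<open>x0\<close> and \<open>x\<close>, so the geodesic from \<open>y\<close> to \<open>x\<close>
  comes within \<open>2 * L + 2\<close> of the one from \<open>w\<close> to \<open>x0\<close>.
  Counting gives \<open>L \<le> 2 * d w x0\<close>, and the bound is
  \<open>d w x0 + 2 * (2 * d w x0) + 2\<close>. It does not involve \<open>x\<close> and
  \<open>y\<close>, which will run to infinity.\<close>

lemma near_geodesic:
  assumes M: "w \<in> M" "x \<in> M" "x0 \<in> M" "y \<in> M" and gp: "gp w x0 y + 3 * error < gp w x x0"
  shows "\<exists>p\<in>M. d x p + d p y = d x y \<and> d w p \<le> 5 * d w x0 + 2"
proof -
  obtain L where L: "max_separating L {w} {x0, y} + L + 10 < max_separating L {w} {x, x0}"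
    using exists_separating_level[OF assms] by blast
  have "real (max_separating L {w} {x, x0}) \<le> 2 * d w x0 + 1"
    by (rule max_separating_le[of w "{w}" x0]) (use M in auto)
  then have Lb: "real L \<le> 2 * d w x0" using L by linarith
  obtain c where c: "L_family L c {w} {x, x0}" "card c = max_separating L {w} {x, x0}"
    using max_separating_attained[of w "{w}" x0 "{x, x0}" L] M by auto
  obtain c1 c2 where s: "L_family L c1 {y, w} {x, x0}" "L_family L c2 {w} {y, x, x0}"
    "card c \<le> card c1 + card c2 + 1" using L_family_split[OF c(1) M(4)] by blast
  have "card c2 \<le> max_separating L {w} {x0, y}"
    by (rule max_separating_ge[of w _ y]) (use M L_family_mono[OF s(2)] in auto)
  then have "5 \<le> card c1" using s(3) c(2) L by simp
  moreover have "L_family L c1 {w, y} {x0, x}" using s(1) by (simp add: insert_commute)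
  moreover obtain \<sigma> where \<sigma>: "geodesic {0..d w x0} \<sigma>" "\<sigma> 0 = w" "\<sigma> (d w x0) = x0" using obtain_geodesic[OF M(1,3)] .
  moreover obtain \<gamma> where \<gamma>: "geodesic {0..d y x} \<gamma>" "\<gamma> 0 = y" "\<gamma> (d y x) = x" using obtain_geodesic[OF M(4,2)] .
  ultimately obtain s t where st: "s \<in> {0..d w x0}" "t \<in> {0..d y x}" "d (\<sigma> s) (\<gamma> t) \<le> 2 * real L + 2"
    using bottleneck[of L c1 w y x0 x "d w x0" \<sigma> "d y x" \<gamma>] by auto
  have pM: "\<gamma> t \<in> M" "\<sigma> s \<in> M" using geodesicD(3)[OF \<gamma>(1) st(2)] geodesicD(3)[OF \<sigma>(1) st(1)] by auto
  have "d y (\<gamma> t) = t" "d (\<gamma> t) x = d y x - t"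
    using geodesicD(4)[OF \<gamma>(1), of 0 t] geodesicD(4)[OF \<gamma>(1), of t "d y x"] st(2) \<gamma>(2,3) by auto
  then have "d x (\<gamma> t) + d (\<gamma> t) y = d x y" using commute[of x "\<gamma> t"] commute[of y "\<gamma> t"] commute[of x y] by linarith
  moreover have "d w (\<sigma> s) = s" using geodesicD(4)[OF \<sigma>(1), of 0 s] st(1) \<sigma>(2) by auto
  then have "d w (\<gamma> t) \<le> 5 * d w x0 + 2"
    using triangle[OF M(1) pM(2,1)] st(1,3) Lb by auto
  ultimately show ?thesis using pM(1) by blast
qed

end


section \<open>A quasimorphism criterion for being virtually cyclic\<close>

text \<open>Finitely many cosets of the powers of \<open>g\<close> cover the group; as the group is
  infinite, so is the set of powers, and \<open>g\<close> has infinite order.\<close>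

lemma (in group) virtually_Z_if_infinite_cyclic_cover:
  assumes g: "g \<in> carrier G" and F: "finite F" "F \<subseteq> carrier G" and inf: "infinite (carrier G)"
    and cover: "\<And>x. x \<in> carrier G \<Longrightarrow> \<exists>j::int. g [^] j \<otimes> x \<in> F"
  shows "virtually_Z G"
proof -
  define K where "K = range (\<lambda>j::int. g [^] j)"
  interpret pow: group_hom integer_group G "\<lambda>j. g [^] j"
    using hom_integer_group_pow[OF g] by (simp add: group_hom_def group_hom_axioms_def)
  have K: "subgroup K G" using pow.img_is_subgroup by (simp add: K_def)
  have fin_index: "finite (rcosets K)"
  proof (rule finite_subset)
    show "rcosets K \<subseteq> (\<lambda>y. K #> y) ` F"
    proof
      fix R assume "R \<in> rcosets K"
      then obtain x where x: "x \<in> carrier G" "R = K #> x" unfolding RCOSETS_def by blast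
      obtain j :: int where j: "g [^] j \<otimes> x \<in> F" using cover x(1) by blast
      have "g [^] j \<otimes> x \<in> K #> x" unfolding r_coset_def K_def by blast
      from repr_independence[OF this x(1) K] show "R \<in> (\<lambda>y. K #> y) ` F" using j x(2) by blast
    qed
  qed (use F in simp)
  have "infinite K"
  proof
    assume "finite K"
    have "carrier G \<subseteq> (\<lambda>(k, y). inv k \<otimes> y) ` (K \<times> F)"
    proof
      fix x assume x: "x \<in> carrier G"
      obtain j :: int where j: "g [^] j \<otimes> x \<in> F" using cover x by blast
      have "inv (g [^] j) \<otimes> (g [^] j \<otimes> x) = x" using g x by (simp add: m_assoc[symmetric])
      then show "x \<in> (\<lambda>(k, y). inv k \<otimes> y) ` (K \<times> F)"
        using j by (intro image_eqI[of _ _ "(g [^] j, g [^] j \<otimes> x)"]) (auto simp: K_def)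
    qed
    then show False using inf F(1) \<open>finite K\<close> finite_subset by blast
  qed
  then have inj: "inj (\<lambda>j::int. g [^] j)"
    using infinite_cyclic_subgroup_int[OF g] carrier_subgroup_generated_by_singleton[OF g]
    unfolding K_def by (auto simp: inj_on_def)
  have "(\<lambda>j::int. g [^] j) \<in> iso integer_group (G\<lparr>carrier := K\<rparr>)"
    unfolding iso_def hom_def bij_betw_def using inj by (auto simp: K_def int_pow_mult g)
  then have "integer_group \<cong> G\<lparr>carrier := K\<rparr>" unfolding is_iso_def by blast
  then have "G\<lparr>carrier := K\<rparr> \<cong> integer_group" by (rule group.iso_sym[OF group_integer_group])
  then show ?thesis unfolding virtually_Z_def using K fin_index by blast
qed

text \<open>By properness some \<open>g\<close> in \<open>P\<close> has
  \<open>\<bar>f g\<bar> > E + 1\<close>. Left multiplication by \<open>g\<close> shifts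
  \<open>f\<close> by \<open>f g\<close> up to \<open>E\<close>, so powers of \<open>g\<close> carry
  any element into a fixed sublevel set, which is finite. Only the left factor has to lie in
  \<open>P\<close>.\<close>

lemma (in group) virtually_Z_if_proper_quasimorphism:
  fixes f :: "'a \<Rightarrow> real"
  assumes P: "P \<subseteq> carrier G" "infinite P"
    and quasi: "\<And>k x. k \<in> P \<Longrightarrow> x \<in> carrier G \<Longrightarrow> \<bar>f (k \<otimes> x) - f k - f x\<bar> \<le> E"
    and proper: "\<And>R. finite {x \<in> carrier G. \<bar>f x\<bar> \<le> R}"
  shows "virtually_Z G"
proof -
  have "\<exists>g\<in>P. E + 1 < \<bar>f g\<bar>"
  proof (rule ccontr)
    assume "\<not> ?thesis"
    then have "P \<subseteq> {x \<in> carrier G. \<bar>f x\<bar> \<le> E + 1}" using P(1) by fastforce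
    then show False using proper P(2) finite_subset by blast
  qed
  then obtain g where g: "g \<in> P" "E + 1 < \<bar>f g\<bar>" by blast
  then have gc: "g \<in> carrier G" using P(1) by blast
  \<comment> \<open>The sign is chosen so that \<open>g\<close> shifts \<open>F\<close> upwards by
    about \<open>a > 0\<close>.\<close>
  define F where "F x = sgn (f g) * f x" for x
  define a where "a = \<bar>f g\<bar>"
  have s: "\<bar>sgn (f g)\<bar> = 1" using quasi[OF g(1) gc] g(2) by (auto simp: abs_sgn_eq)
  have F_abs: "\<bar>F x\<bar> = \<bar>f x\<bar>" for x using s by (simp add: F_def abs_mult)
  have step: "\<bar>F (g \<otimes> x) - F x - a\<bar> \<le> E" if "x \<in> carrier G" for x
  proof -
    have "F (g \<otimes> x) - F x - a = sgn (f g) * (f (g \<otimes> x) - f g - f x)"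
      by (simp add: F_def a_def algebra_simps abs_sgn mult.commute)
    then show ?thesis using quasi[OF g(1) that] s by (simp add: abs_mult)
  qed
  have a: "E + 1 < a" "0 \<le> E" using g(2) quasi[OF g(1) gc] by (auto simp: a_def)
  \<comment> \<open>Induction on the excess over \<open>a + E\<close>. As long as
    \<open>\<bar>F x\<bar>\<close> exceeds \<open>a + E\<close>, a shift towards 0 cannot overshoot,
    and it gains at least \<open>a - E > 1\<close>.\<close>
  have "\<exists>j::int. \<bar>F (g [^] j \<otimes> x)\<bar> \<le> a + E" if "x \<in> carrier G" "\<bar>F x\<bar> \<le> real n + a + E" for x n
    using that
  proof (induction n arbitrary: x)
    case 0
    then show ?case by (intro exI[of _ 0]) simp
  next
    case (Suc n)
    have shift: ?case if y: "g [^] (i::int) \<otimes> x = y" "\<bar>F y\<bar> \<le> real n + a + E" for i y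
    proof -
      have yc: "y \<in> carrier G" using Suc.prems(1) gc y(1)[symmetric] by simp
      obtain j :: int where "\<bar>F (g [^] j \<otimes> y)\<bar> \<le> a + E" using Suc.IH[OF yc y(2)] by blast
      moreover have "g [^] j \<otimes> y = g [^] (j + i) \<otimes> x"
        using Suc.prems(1) gc by (simp add: y(1)[symmetric] m_assoc[symmetric] int_pow_mult)
      ultimately show ?thesis by metis
    qed
    consider "\<bar>F x\<bar> \<le> a + E" | "a + E < F x" | "F x < - (a + E)" by linarith
    then show ?case
    proof cases
      case 1
      then show ?thesis using Suc.prems(1) by (intro exI[of _ 0]) simp
    next
      case 2
      define y where "y = inv g \<otimes> x"
      have y: "y \<in> carrier G" "g \<otimes> y = x" using Suc.prems(1) gc by (simp_all add: y_def m_assoc[symmetric])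
      have "\<bar>F y\<bar> \<le> real n + a + E" using step[OF y(1)] y(2) 2 a Suc.prems(2) by auto
      moreover have "g [^] (- 1 :: int) \<otimes> x = y" using gc by (simp add: y_def int_pow_neg)
      ultimately show ?thesis by (rule shift[rotated])
    next
      case 3
      have "\<bar>F (g \<otimes> x)\<bar> \<le> real n + a + E" using step[OF Suc.prems(1)] 3 a Suc.prems(2) by auto
      moreover have "g [^] (1 :: int) \<otimes> x = g \<otimes> x" using gc by simp
      ultimately show ?thesis by (rule shift[rotated])
    qed
  qed
  moreover have "\<exists>n. \<bar>F x\<bar> \<le> real n + a + E" for x
    using real_arch_simple[of "\<bar>F x\<bar> - a - E"] by (auto simp: algebra_simps)
  ultimately have "\<exists>j::int. \<bar>F (g [^] j \<otimes> x)\<bar> \<le> a + E" if "x \<in> carrier G" for x using that by blast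
  then have "\<exists>j::int. g [^] j \<otimes> x \<in> {x \<in> carrier G. \<bar>f x\<bar> \<le> a + E}" if "x \<in> carrier G" for x
    using that gc by (simp add: F_abs)
  then show ?thesis
    using P finite_subset by (intro virtually_Z_if_infinite_cyclic_cover[OF gc proper]) auto
qed

section \<open>The boundary of the curtain model\<close>

locale pointed_curtain_model = curtain_model +
  fixes w assumes base: "w \<in> M"
begin

text \<open>Independent indices and two sequences: for \<open>u = v\<close> this is the
  Cauchy-Gromov condition, and for different sequences transitivity follows directly from
  \<open>gp_hyperbolic\<close>.\<close>

definition divergent_product :: "(nat \<Rightarrow> 'a) \<Rightarrow> (nat \<Rightarrow> 'a) \<Rightarrow> bool" where
  "divergent_product u v \<longleftrightarrow> (\<forall>B. \<exists>N. \<forall>n\<ge>N. \<forall>m\<ge>N. B \<le> gp w (u n) (v m))"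

lemma gp_sym: "x \<in> M \<Longrightarrow> y \<in> M \<Longrightarrow> gp w x y = gp w y x"
  unfolding gromov_product_def using D_sym[of x y] by simp

lemma divergent_product_sym:
  assumes "range u \<subseteq> M" "range v \<subseteq> M" "divergent_product u v" shows "divergent_product v u"
proof -
  have "gp w (v n) (u m) = gp w (u m) (v n)" for n m using assms(1,2) by (intro gp_sym) auto
  then show ?thesis using assms(3) unfolding divergent_product_def by metis
qed

lemma divergent_product_trans:
  assumes M: "range u \<subseteq> M" "range v \<subseteq> M" "range x \<subseteq> M"
    and uv: "divergent_product u v" and vx: "divergent_product v x"
  shows "divergent_product u x"
  unfolding divergent_product_def
proof
  fix B
  obtain N1 where N1: "\<And>n m. n \<ge> N1 \<Longrightarrow> m \<ge> N1 \<Longrightarrow> B + 3 * error \<le> gp w (u n) (v m)"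
    using uv unfolding divergent_product_def by meson
  obtain N2 where N2: "\<And>n m. n \<ge> N2 \<Longrightarrow> m \<ge> N2 \<Longrightarrow> B + 3 * error \<le> gp w (v n) (x m)"
    using vx unfolding divergent_product_def by meson
  show "\<exists>N. \<forall>n\<ge>N. \<forall>m\<ge>N. B \<le> gp w (u n) (x m)"
  proof (intro exI[of _ "max N1 N2"] allI impI)
    fix n m assume nm: "max N1 N2 \<le> n" "max N1 N2 \<le> m"
    have "min (gp w (u n) (v n)) (gp w (v n) (x m)) \<le> gp w (u n) (x m) + 3 * error"
      using M by (intro gp_hyperbolic base) auto
    then show "B \<le> gp w (u n) (x m)" using N1[of n n] N2[of n m] nm by auto
  qed
qed

lemma cauchy_gromov_iff:
  "u \<in> cauchy_gromov M D w \<longleftrightarrow> range u \<subseteq> M \<and> divergent_product u u"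
proof -
  have "filterlim (\<lambda>(n, m). gp w (u n) (u m)) at_top (sequentially \<times>\<^sub>F sequentially) \<longleftrightarrow>
      (\<forall>B. \<exists>N. \<forall>m\<ge>N. \<forall>n\<ge>N. B \<le> gp w (u n) (u m))"
    unfolding filterlim_at_top eventually_prod_sequentially by simp
  also have "\<dots> \<longleftrightarrow> divergent_product u u" unfolding divergent_product_def by meson
  finally show ?thesis unfolding cauchy_gromov_def by simp
qed

text \<open>The definition controls only the diagonal \<open>gp w (u n) (v n)\<close>; the Cauchy
  property of \<open>u\<close> and hyperbolicity extend this to independent indices.\<close>

lemma gromov_equiv_iff:
  "(u, v) \<in> gromov_equiv M D w \<longleftrightarrow> range u \<subseteq> M \<and> range v \<subseteq> M \<and>
     divergent_product u u \<and> divergent_product v v \<and> divergent_product u v"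
  (is "?L \<longleftrightarrow> ?R")
proof
  assume L: ?L
  then have M: "range u \<subseteq> M" "range v \<subseteq> M" and c: "divergent_product u u" "divergent_product v v"
    and lim: "filterlim (\<lambda>n. gp w (u n) (v n)) at_top sequentially"
    unfolding gromov_equiv_def by (auto simp: cauchy_gromov_iff)
  have "divergent_product u v"
    unfolding divergent_product_def
  proof
    fix B
    obtain N1 where N1: "\<And>n m. n \<ge> N1 \<Longrightarrow> m \<ge> N1 \<Longrightarrow> B + 3 * error \<le> gp w (u n) (u m)"
      using c(1) unfolding divergent_product_def by meson
    obtain N2 where N2: "\<And>n. n \<ge> N2 \<Longrightarrow> B + 3 * error \<le> gp w (u n) (v n)"
      using lim unfolding filterlim_at_top eventually_sequentially by meson
    show "\<exists>N. \<forall>n\<ge>N. \<forall>m\<ge>N. B \<le> gp w (u n) (v m)"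
    proof (intro exI[of _ "max N1 N2"] allI impI)
      fix n m assume nm: "max N1 N2 \<le> n" "max N1 N2 \<le> m"
      have "min (gp w (u n) (u m)) (gp w (u m) (v m)) \<le> gp w (u n) (v m) + 3 * error"
        using M by (intro gp_hyperbolic base) auto
      then show "B \<le> gp w (u n) (v m)" using N1[of n m] N2[of m] nm by auto
    qed
  qed
  then show ?R using M c by blast
next
  assume R: ?R
  have "filterlim (\<lambda>n. gp w (u n) (v n)) at_top sequentially"
    unfolding filterlim_at_top eventually_sequentially
    using R unfolding divergent_product_def by meson
  then show ?L using R unfolding gromov_equiv_def by (simp add: cauchy_gromov_iff)
qed

lemma equiv_gromov_equiv: "equiv (cauchy_gromov M D w) (gromov_equiv M D w)"
proof (rule equivI)
  show "gromov_equiv M D w \<subseteq> cauchy_gromov M D w \<times> cauchy_gromov M D w"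
    unfolding gromov_equiv_def by blast
  show "refl_on (cauchy_gromov M D w) (gromov_equiv M D w)"
    by (rule refl_onI) (auto simp: gromov_equiv_iff cauchy_gromov_iff)
  show "sym (gromov_equiv M D w)"
    by (rule symI) (auto simp: gromov_equiv_iff intro: divergent_product_sym)
  show "trans (gromov_equiv M D w)"
    by (rule transI) (unfold gromov_equiv_iff, blast intro: divergent_product_trans)
qed

lemma boundary_class:
  assumes "\<xi> \<in> gromov_boundary M D w"
  shows "\<xi> \<noteq> {}" "\<And>u v. u \<in> \<xi> \<Longrightarrow> v \<in> \<xi> \<Longrightarrow> (u, v) \<in> gromov_equiv M D w"
    "\<And>u v. u \<in> \<xi> \<Longrightarrow> (u, v) \<in> gromov_equiv M D w \<Longrightarrow> v \<in> \<xi>"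
    "\<And>u. u \<in> \<xi> \<Longrightarrow> \<xi> = gromov_equiv M D w `` {u}"
    "\<And>u. u \<in> \<xi> \<Longrightarrow> range u \<subseteq> M"
proof -
  have q: "\<xi> \<in> cauchy_gromov M D w // gromov_equiv M D w" using assms by (simp add: gromov_boundary_def)
  then show "\<xi> \<noteq> {}" using in_quotient_imp_non_empty[OF equiv_gromov_equiv] by blast
  show e: "(u, v) \<in> gromov_equiv M D w" if "u \<in> \<xi>" "v \<in> \<xi>" for u v
    using in_quotient_imp_in_rel[OF equiv_gromov_equiv q] that by blast
  show c: "v \<in> \<xi>" if "u \<in> \<xi>" "(u, v) \<in> gromov_equiv M D w" for u v
    using in_quotient_imp_closed[OF equiv_gromov_equiv q that] .
  show "\<xi> = gromov_equiv M D w `` {u}" if "u \<in> \<xi>" for u using e c that by blast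
  show "range u \<subseteq> M" if "u \<in> \<xi>" for u using e[OF that that] by (simp add: gromov_equiv_iff)
qed

lemma equiv_classI:
  assumes "u \<in> cauchy_gromov M D w"
  shows "gromov_equiv M D w `` {u} \<in> gromov_boundary M D w" "u \<in> gromov_equiv M D w `` {u}"
  unfolding gromov_boundary_def
  using quotientI[OF assms] equiv_class_self[OF equiv_gromov_equiv assms] by auto

text \<open>One late pair with product below \<open>B\<close> bounds all late pairs: products within
  each sequence are large, and exchanging the two members of the pair costs \<open>3 * error\<close>
  each.\<close>

lemma not_divergent_bounded:
  assumes M: "range u \<subseteq> M" "range v \<subseteq> M" and c: "divergent_product u u" "divergent_product v v"
    and uv: "(u, v) \<notin> gromov_equiv M D w"
  shows "\<exists>B N. \<forall>n\<ge>N. \<forall>m\<ge>N. gp w (u n) (v m) \<le> B"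
proof -
  have "\<not> divergent_product u v" using assms gromov_equiv_iff by blast
  then obtain B where B: "\<And>N. \<exists>n\<ge>N. \<exists>m\<ge>N. gp w (u n) (v m) < B"
    unfolding divergent_product_def by (meson not_le)
  define B' where "B' = B + 6 * error"
  obtain N1 where N1: "\<And>n m. n \<ge> N1 \<Longrightarrow> m \<ge> N1 \<Longrightarrow> B' \<le> gp w (u n) (u m)"
    using c(1) unfolding divergent_product_def by meson
  obtain N2 where N2: "\<And>n m. n \<ge> N2 \<Longrightarrow> m \<ge> N2 \<Longrightarrow> B' \<le> gp w (v n) (v m)"
    using c(2) unfolding divergent_product_def by meson
  obtain n' m' where n': "n' \<ge> max N1 N2" "m' \<ge> max N1 N2" "gp w (u n') (v m') < B"
    using B by meson
  have "gp w (u n) (v m) \<le> B'" if "n \<ge> max N1 N2" "m \<ge> max N1 N2" for n m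
  proof (rule ccontr)
    assume B': "\<not> gp w (u n) (v m) \<le> B'"
    have "min (gp w (u n') (u n)) (gp w (u n) (v m)) \<le> gp w (u n') (v m) + 3 * error"
      "min (gp w (u n') (v m)) (gp w (v m) (v m')) \<le> gp w (u n') (v m') + 3 * error"
      using M by (intro gp_hyperbolic base; auto)+
    then show False
      using B' N1[of n' n] N2[of m m'] n' that error_nonneg unfolding B'_def by auto
  qed
  then show ?thesis by blast
qed

lemma isometry_divergent_product:
  assumes f: "isometry f" and M: "range u \<subseteq> M" "range v \<subseteq> M" and uv: "divergent_product u v"
  shows "divergent_product (\<lambda>n. f (u n)) (\<lambda>n. f (v n))"
  unfolding divergent_product_def
proof
  fix B
  have fw: "f w \<in> M" using isometryD(2)[OF f base] .
  \<comment> \<open>The product of the images is unchanged when based at \<open>f w\<close>; moving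
    the base point to \<open>w\<close> costs at most \<open>D w (f w)\<close>.\<close>
  have le: "gp w x y - D w (f w) \<le> gp w (f x) (f y)" if "x \<in> M" "y \<in> M" for x y
  proof -
    have fM: "f x \<in> M" "f y \<in> M" using isometryD(2)[OF f] that by auto
    note i = isometry_curtain_dist[OF f, of _ _ lam]
    show ?thesis
      unfolding gromov_product_def
      using D_triangle[OF fw base fM(1)] D_triangle[OF fw base fM(2)] D_sym[OF fw base]
        i[OF base that(1)] i[OF base that(2)] i[OF that] by (simp add: field_simps)
  qed
  obtain N where N: "\<And>n m. n \<ge> N \<Longrightarrow> m \<ge> N \<Longrightarrow> B + D w (f w) \<le> gp w (u n) (v m)"
    using uv unfolding divergent_product_def by meson
  have "u n \<in> M" "v n \<in> M" for n using M by auto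
  then show "\<exists>N. \<forall>n\<ge>N. \<forall>m\<ge>N. B \<le> gp w (f (u n)) (f (v m))"
    using N le by (intro exI[of _ N]) (smt (verit, best))
qed

lemma isometry_gromov_equiv:
  assumes f: "isometry f" and uv: "(u, v) \<in> gromov_equiv M D w"
  shows "(\<lambda>n. f (u n), \<lambda>n. f (v n)) \<in> gromov_equiv M D w"
proof -
  have "range (\<lambda>n. f (u n)) \<subseteq> M" if "range u \<subseteq> M" for u :: "nat \<Rightarrow> 'a"
    using that isometryD(2)[OF f] by auto
  then show ?thesis using uv isometry_divergent_product[OF f] unfolding gromov_equiv_iff by blast
qed

text \<open>A fixed point \<open>x0\<close> far out towards \<xi> has a much larger product with
  late \<open>u n\<close> than with late \<open>v m\<close>, which is what
  \<open>near_geodesic\<close> asks for. The resulting constant depends on \<open>x0\<close> alone,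
  hence is the same for all \<open>u\<close> and \<open>v\<close>.\<close>

lemma geodesics_near_base:
  assumes \<xi>: "\<xi> \<in> gromov_boundary M D w" and \<eta>: "\<eta> \<in> gromov_boundary M D w" and ne: "\<xi> \<noteq> \<eta>"
  shows "\<exists>C. \<forall>u\<in>\<xi>. \<forall>v\<in>\<eta>. \<exists>N. \<forall>n\<ge>N. \<forall>m\<ge>N. \<exists>p\<in>M. d (u n) p + d p (v m) = d (u n) (v m) \<and> d w p \<le> C"
proof -
  obtain u0 v0 where u0: "u0 \<in> \<xi>" and v0: "v0 \<in> \<eta>" using boundary_class(1) \<xi> \<eta> by blast
  have e: "range u0 \<subseteq> M" "range v0 \<subseteq> M" "divergent_product u0 u0" "divergent_product v0 v0"
    using boundary_class(2)[OF \<xi> u0 u0] boundary_class(2)[OF \<eta> v0 v0] by (simp_all add: gromov_equiv_iff)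
  have "(u0, v0) \<notin> gromov_equiv M D w"
    using boundary_class(3)[OF \<xi> u0] boundary_class(4)[OF \<xi>] boundary_class(4)[OF \<eta> v0] ne by metis
  from not_divergent_bounded[OF e this] obtain B N where
    B: "\<And>n m. n \<ge> N \<Longrightarrow> m \<ge> N \<Longrightarrow> gp w (u0 n) (v0 m) \<le> B" by meson
  \<comment> \<open>Three times \<open>3 * error\<close>: for passing from \<open>u0\<close> to
    \<open>u\<close>, for passing from \<open>v0\<close> to \<open>v\<close>, and for the gap
    required by \<open>near_geodesic\<close>.\<close>
  define B2 where "B2 = B + 9 * error + 2"
  obtain N0 where N0: "\<And>n m. n \<ge> N0 \<Longrightarrow> m \<ge> N0 \<Longrightarrow> B2 \<le> gp w (u0 n) (u0 m)"
    using e(3) unfolding divergent_product_def by meson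
  define n0 where "n0 = max N N0"
  define x0 where "x0 = u0 n0"
  have x0: "x0 \<in> M" using e(1) by (auto simp: x0_def)
  show ?thesis
  proof (intro exI[of _ "5 * d w x0 + 2"] ballI)
    fix u v assume u: "u \<in> \<xi>" and v: "v \<in> \<eta>"
    have uM: "range u \<subseteq> M" "range v \<subseteq> M" using boundary_class(5)[OF \<xi> u] boundary_class(5)[OF \<eta> v] by auto
    then have uvM: "u n \<in> M" "v n \<in> M" "u0 n \<in> M" "v0 n \<in> M" for n using e(1,2) by auto
    have "divergent_product u0 u" "divergent_product v v0"
      using boundary_class(2)[OF \<xi> u0 u] boundary_class(2)[OF \<eta> v v0] by (simp_all add: gromov_equiv_iff)
    then obtain N1 N2 where N1: "\<And>n m. n \<ge> N1 \<Longrightarrow> m \<ge> N1 \<Longrightarrow> B2 \<le> gp w (u0 n) (u m)"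
      and N2: "\<And>n m. n \<ge> N2 \<Longrightarrow> m \<ge> N2 \<Longrightarrow> B + 3 * error + 1 \<le> gp w (v n) (v0 m)"
      unfolding divergent_product_def by meson
    define K where "K = max (max N n0) (max N1 N2)"
    show "\<exists>N. \<forall>n\<ge>N. \<forall>m\<ge>N. \<exists>p\<in>M. d (u n) p + d p (v m) = d (u n) (v m) \<and> d w p \<le> 5 * d w x0 + 2"
    proof (intro exI[of _ K] allI impI)
      fix n m assume nm: "K \<le> n" "K \<le> m"
      have "B2 \<le> gp w x0 (u0 n)" using N0[of n0 n] nm unfolding x0_def K_def n0_def by auto
      moreover have "B2 \<le> gp w (u0 n) (u n)" using N1[of n n] nm unfolding K_def by auto
      moreover have "min (gp w x0 (u0 n)) (gp w (u0 n) (u n)) \<le> gp w x0 (u n) + 3 * error"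
        by (intro gp_hyperbolic base x0 uvM)
      ultimately have 1: "B2 - 3 * error \<le> gp w x0 (u n)" by linarith
      have "min (gp w x0 (v m)) (gp w (v m) (v0 m)) \<le> gp w x0 (v0 m) + 3 * error"
        by (intro gp_hyperbolic base x0 uvM)
      moreover have "gp w x0 (v0 m) \<le> B" using B[of n0 m] nm unfolding x0_def K_def n0_def by auto
      moreover have "B + 3 * error + 1 \<le> gp w (v m) (v0 m)" using N2[of m m] nm unfolding K_def by auto
      ultimately have 2: "gp w x0 (v m) < B + 3 * error + 1" by linarith
      have "gp w x0 (v m) + 3 * error < gp w (u n) x0"
        using 1 2 gp_sym[OF x0 uvM(1)[of n]] unfolding B2_def by linarith
      from near_geodesic[OF base uvM(1) x0 uvM(2) this]
      show "\<exists>p\<in>M. d (u n) p + d p (v m) = d (u n) (v m) \<and> d w p \<le> 5 * d w x0 + 2" .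
    qed
  qed
qed

end

section \<open>Subgroups with two limit points\<close>

locale two_ended_action = pointed_curtain_model M d lam w + geometric_action G M d \<phi>
  for M :: "'a set" and d lam w and G :: "('g, 'm) monoid_scheme" (structure) and \<phi> +
  fixes H and \<xi> \<eta>
  assumes H: "subgroup H G"
    and limit_set: "limit_set M (curtain_dist lam) w \<phi> H = {\<xi>, \<eta>}"
    and distinct_ends: "\<xi> \<noteq> \<eta>"
begin

lemma act_isometry: "k \<in> carrier G \<Longrightarrow> isometry (\<phi> k)"
  unfolding isometry_def using surj_prop isometric by simp

lemma H_carrier: "k \<in> H \<Longrightarrow> k \<in> carrier G"
  using subgroup.mem_carrier[OF H] .

lemma H_isometry: "k \<in> H \<Longrightarrow> isometry (\<phi> k)"
  using act_isometry H_carrier by blast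

lemma act_closed: "k \<in> H \<Longrightarrow> x \<in> M \<Longrightarrow> \<phi> k x \<in> M"
  using isometryD(2)[OF H_isometry] .

lemma H_inv: "k \<in> H \<Longrightarrow> inv k \<in> H"
  using subgroup.m_inv_closed[OF H] .

lemma act_mult: "k \<in> H \<Longrightarrow> k' \<in> H \<Longrightarrow> x \<in> M \<Longrightarrow> \<phi> (k \<otimes> k') x = \<phi> k (\<phi> k' x)"
  using composition_rule H_carrier by simp

lemma act_inv: "k \<in> H \<Longrightarrow> x \<in> M \<Longrightarrow> \<phi> (inv k) (\<phi> k x) = x"
  "k \<in> H \<Longrightarrow> x \<in> M \<Longrightarrow> \<phi> k (\<phi> (inv k) x) = x"
proof -
  show 1: "\<phi> (inv k) (\<phi> k x) = x" if "k \<in> H" "x \<in> M" for k x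
    using orbit_sym_aux[OF H_carrier[OF that(1)] that(2) refl] .
  interpret group G using group_hom unfolding group_hom_def by blast
  show "k \<in> H \<Longrightarrow> x \<in> M \<Longrightarrow> \<phi> k (\<phi> (inv k) x) = x"
    using 1[OF H_inv, of k x] H_carrier[of k] by simp
qed

lemma ends_boundary: "\<zeta> \<in> {\<xi>, \<eta>} \<Longrightarrow> \<zeta> \<in> gromov_boundary M D w"
  using limit_set[symmetric] unfolding limit_set_def by blast

lemmas end_class = boundary_class[OF ends_boundary]

text \<open>Translating by \<open>k\<close> turns an orbit sequence with elements \<open>h n\<close>
  into one with elements \<open>k \<otimes> h n\<close>, so it maps limit points to limit
  points.\<close>

lemma act_end:
  assumes k: "k \<in> H" and \<zeta>: "\<zeta> \<in> {\<xi>, \<eta>}" and u: "u \<in> \<zeta>"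
  shows "\<exists>\<zeta>'\<in>{\<xi>, \<eta>}. (\<lambda>n. \<phi> k (u n)) \<in> \<zeta>'"
proof -
  let ?ku = "\<lambda>n. \<phi> k (u n)"
  have "\<zeta> \<in> limit_set M D w \<phi> H" using \<zeta> limit_set by simp
  then obtain y z h where y: "y \<in> \<zeta>" "z \<in> M" "range h \<subseteq> H" "(y, \<lambda>n. \<phi> (h n) z) \<in> gromov_equiv M D w"
    unfolding limit_set_def by blast
  have ku: "(?ku, ?ku) \<in> gromov_equiv M D w"
    using isometry_gromov_equiv[OF H_isometry[OF k] end_class(2)[OF \<zeta> u u]] .
  then have c: "?ku \<in> cauchy_gromov M D w" by (simp add: gromov_equiv_def)
  let ?\<zeta> = "gromov_equiv M D w `` {?ku}"
  have "(?ku, \<lambda>n. \<phi> k (y n)) \<in> gromov_equiv M D w"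
    using isometry_gromov_equiv[OF H_isometry[OF k] end_class(2)[OF \<zeta> u y(1)]] .
  then have ky: "(\<lambda>n. \<phi> k (y n)) \<in> ?\<zeta>" by blast
  have hH: "h n \<in> H" for n using y(3) by auto
  have "(\<lambda>n. \<phi> k (y n), \<lambda>n. \<phi> k (\<phi> (h n) z)) \<in> gromov_equiv M D w"
    using isometry_gromov_equiv[OF H_isometry[OF k] y(4)] .
  then have "(\<lambda>n. \<phi> k (y n), \<lambda>n. \<phi> (k \<otimes> h n) z) \<in> gromov_equiv M D w"
    using act_mult[OF k hH y(2)] by simp
  moreover have "range (\<lambda>n. k \<otimes> h n) \<subseteq> H" using subgroup.m_closed[OF H k hH] by blast
  ultimately have "\<exists>h'. range h' \<subseteq> H \<and> (\<lambda>n. \<phi> k (y n), \<lambda>n. \<phi> (h' n) z) \<in> gromov_equiv M D w"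
    by (intro exI[of _ "\<lambda>n. k \<otimes> h n"] conjI)
  then have "\<exists>y\<in>?\<zeta>. \<exists>z\<in>M. \<exists>h'. range h' \<subseteq> H \<and> (y, \<lambda>n. \<phi> (h' n) z) \<in> gromov_equiv M D w"
    by (intro bexI[OF _ ky] bexI[OF _ y(2)])
  then have "?\<zeta> \<in> limit_set M D w \<phi> H"
    unfolding limit_set_def using equiv_classI(1)[OF c] by simp
  then have "?\<zeta> \<in> {\<xi>, \<eta>}" by (simp only: limit_set)
  then show ?thesis by (intro bexI[of _ ?\<zeta>] equiv_classI(2)[OF c])
qed

lemma ends_disjoint: "u \<in> \<xi> \<Longrightarrow> u \<notin> \<eta>"
  using end_class(4)[of \<xi> u] end_class(4)[of \<eta> u] distinct_ends by blast

lemma geodesics_near_orbit: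
  "\<exists>C. \<forall>k\<in>H. \<forall>u\<in>\<xi>. \<forall>v\<in>\<eta>. \<exists>N. \<forall>n\<ge>N. \<forall>m\<ge>N. \<exists>p\<in>M.
     d (u n) p + d p (v m) = d (u n) (v m) \<and> d (\<phi> k w) p \<le> C"
proof -
  obtain C where C: "\<And>u v. u \<in> \<xi> \<Longrightarrow> v \<in> \<eta> \<Longrightarrow>
    \<exists>N. \<forall>n\<ge>N. \<forall>m\<ge>N. \<exists>p\<in>M. d (u n) p + d p (v m) = d (u n) (v m) \<and> d w p \<le> C"
    using geodesics_near_base[OF ends_boundary ends_boundary distinct_ends] by blast
  show ?thesis
  proof (intro exI[of _ C] ballI)
    fix k u v assume k: "k \<in> H" and u: "u \<in> \<xi>" and v: "v \<in> \<eta>"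
    have M: "u n \<in> M" "v n \<in> M" for n using end_class(5)[of \<xi> u] end_class(5)[of \<eta> v] u v by auto
    let ?u = "\<lambda>n. \<phi> (inv k) (u n)" and ?v = "\<lambda>n. \<phi> (inv k) (v n)"
    note ki = H_inv[OF k]
    obtain \<zeta> \<zeta>' where z: "\<zeta> \<in> {\<xi>, \<eta>}" "?u \<in> \<zeta>" "\<zeta>' \<in> {\<xi>, \<eta>}" "?v \<in> \<zeta>'"
      using act_end[OF ki _ u] act_end[OF ki _ v] by blast
    have "\<zeta> \<noteq> \<zeta>'"
    proof
      assume "\<zeta> = \<zeta>'"
      then have "(?u, ?v) \<in> gromov_equiv M D w" using end_class(2)[OF z(1)] z(2,4) by blast
      from isometry_gromov_equiv[OF H_isometry[OF k] this]
      have "(u, v) \<in> gromov_equiv M D w" using act_inv(2)[OF k M(1)] act_inv(2)[OF k M(2)] by simp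
      then have "v \<in> \<xi>" using end_class(3)[of \<xi>] u by blast
      then show False using ends_disjoint v by blast
    qed
    then have "\<exists>N. \<forall>n\<ge>N. \<forall>m\<ge>N. \<exists>p\<in>M. d (?u n) p + d p (?v m) = d (?u n) (?v m) \<and> d w p \<le> C"
    proof (cases "\<zeta> = \<xi>")
      case True
      then show ?thesis using C z \<open>\<zeta> \<noteq> \<zeta>'\<close> by blast
    next
      \<comment> \<open>Here \<open>inv k\<close> exchanges the two ends; the estimate at
        \<open>w\<close> is used for the reversed pair of sequences.\<close>
      case False
      then have "?u \<in> \<eta>" "?v \<in> \<xi>" using z \<open>\<zeta> \<noteq> \<zeta>'\<close> by auto
      from C[OF this(2,1)] obtain N where N: "\<forall>n\<ge>N. \<forall>m\<ge>N. \<exists>p\<in>M.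
        d (?v n) p + d p (?u m) = d (?v n) (?u m) \<and> d w p \<le> C" by blast
      have "d (?v n) p + d p (?u m) = d (?v n) (?u m) \<longleftrightarrow> d (?u m) p + d p (?v n) = d (?u m) (?v n)" for n m p
        using commute[of "?v n" p] commute[of "?u m" p] commute[of "?v n" "?u m"] by linarith
      then show ?thesis using N by metis
    qed
    then obtain N where N: "\<And>n m. n \<ge> N \<Longrightarrow> m \<ge> N \<Longrightarrow> \<exists>p\<in>M. d (?u n) p + d p (?v m) = d (?u n) (?v m) \<and> d w p \<le> C"
      by blast
    show "\<exists>N. \<forall>n\<ge>N. \<forall>m\<ge>N. \<exists>p\<in>M. d (u n) p + d p (v m) = d (u n) (v m) \<and> d (\<phi> k w) p \<le> C"
    proof (intro exI[of _ N] allI impI)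
      fix n m assume "N \<le> n" "N \<le> m"
      then obtain p where p: "p \<in> M" "d (?u n) p + d p (?v m) = d (?u n) (?v m)" "d w p \<le> C" using N by blast
      have kp: "\<phi> k p \<in> M" using act_closed[OF k p(1)] .
      have iso: "d x (\<phi> k p) = d (\<phi> (inv k) x) p" "d (\<phi> k p) x = d p (\<phi> (inv k) x)"
        "d x y = d (\<phi> (inv k) x) (\<phi> (inv k) y)" if "x \<in> M" "y \<in> M" for x y
        using isometryD(3)[OF H_isometry[OF ki]] that kp act_inv(1)[OF k p(1)] by metis+
      have "d (u n) (\<phi> k p) + d (\<phi> k p) (v m) = d (u n) (v m)"
        using iso[OF M(1)[of n] M(2)[of m]] iso[OF M(2)[of m] M(1)[of n]] p(2) by simp
      moreover have "d (\<phi> k w) (\<phi> k p) \<le> C" using isometryD(3)[OF H_isometry[OF k] base p(1)] p(3) by simp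
      ultimately show "\<exists>p\<in>M. d (u n) p + d p (v m) = d (u n) (v m) \<and> d (\<phi> k w) p \<le> C" using kp by blast
    qed
  qed
qed

text \<open>The function \<open>f\<close> is the Busemann function of \<open>\<xi>\<close> along the orbit of \<open>w\<close>, up to a bounded error.\<close>

lemma busemann_function:
  "\<exists>f C. (\<forall>k\<in>H. \<forall>u\<in>\<xi>. \<exists>N. \<forall>n\<ge>N. \<bar>d (u n) (\<phi> k w) - d (u n) w - f k\<bar> \<le> C) \<and>
     (\<forall>k\<in>H. d w (\<phi> k w) \<le> \<bar>f k\<bar> + C)"
proof -
  obtain C where C: "\<And>k u v. k \<in> H \<Longrightarrow> u \<in> \<xi> \<Longrightarrow> v \<in> \<eta> \<Longrightarrow> \<exists>N. \<forall>n\<ge>N. \<forall>m\<ge>N. \<exists>p\<in>M.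
     d (u n) p + d p (v m) = d (u n) (v m) \<and> d (\<phi> k w) p \<le> C"
    using geodesics_near_orbit by blast
  obtain u0 v where u0: "u0 \<in> \<xi>" and v: "v \<in> \<eta>" using end_class(1)[of \<xi>] end_class(1)[of \<eta>] by blast
  have vM: "v n \<in> M" for n using end_class(5)[of \<eta> v] v by auto
  have one: "\<one> \<in> H" "\<phi> \<one> w = w"
    using subgroup.one_closed[OF H] id_eq_one base by (auto simp: fun_eq_iff) (metis restrict_apply')
  have near: "\<exists>N. \<forall>n\<ge>N. \<forall>m\<ge>N. (\<exists>p\<in>M. d (u n) p + d p (v m) = d (u n) (v m) \<and> d (\<phi> k w) p \<le> C) \<and>
      (\<exists>q\<in>M. d (u n) q + d q (v m) = d (u n) (v m) \<and> d w q \<le> C)" if ku: "k \<in> H" "u \<in> \<xi>" for k u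
  proof -
    obtain N1 where N1: "\<forall>n\<ge>N1. \<forall>m\<ge>N1. \<exists>p\<in>M. d (u n) p + d p (v m) = d (u n) (v m) \<and> d (\<phi> k w) p \<le> C"
      using C[OF ku v] by blast
    obtain N2 where N2: "\<forall>n\<ge>N2. \<forall>m\<ge>N2. \<exists>p\<in>M. d (u n) p + d p (v m) = d (u n) (v m) \<and> d w p \<le> C"
      using C[OF one(1) ku(2) v] one(2) by auto
    show ?thesis by (intro exI[of _ "max N1 N2"]) (use N1 N2 in simp)
  qed
  \<comment> \<open>A point \<open>z\<close> within \<open>C\<close> of a geodesic from
    \<open>x\<close> to \<open>y\<close> satisfies the triangle inequality with a defect of at most
    \<open>2 * C\<close>.\<close>
  have defect: "d x z + d z y \<le> d x y + 2 * C \<and> d x y \<le> d x z + d z y"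
    if xyz: "x \<in> M" "y \<in> M" "z \<in> M" "\<exists>p\<in>M. d x p + d p y = d x y \<and> d z p \<le> C" for x y z
  proof -
    obtain p where p: "p \<in> M" "d x p + d p y = d x y" "d z p \<le> C" using xyz(4) by blast
    then show ?thesis
      using triangle[OF xyz(1) p(1) xyz(3)] triangle[OF xyz(3) p(1) xyz(2)] triangle[OF xyz(1,3,2)]
        commute[of z p] by linarith
  qed
  define e where "e u k n = d (u n) (\<phi> k w) - d (u n) w" for u k and n :: nat
  \<comment> \<open>For a fixed late \<open>v l\<close>, the distance from \<open>u n\<close> to
    \<open>v l\<close> cancels, and \<open>e u k n\<close> equals
    \<open>d w (v l) - d (\<phi> k w) (v l)\<close> up to \<open>2 * C\<close>. This does not depend
    on \<open>u\<close> or \<open>n\<close>, so two values differ by at most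
    \<open>4 * C\<close>.\<close>
  have close: "\<exists>N. \<forall>n\<ge>N. \<forall>m\<ge>N. \<bar>e u k n - e u0 k m\<bar> \<le> 4 * C" if k: "k \<in> H" and u: "u \<in> \<xi>" for k u
  proof -
    obtain N1 N0 where N: "\<forall>n\<ge>N1. \<forall>m\<ge>N1. (\<exists>p\<in>M. d (u n) p + d p (v m) = d (u n) (v m) \<and> d (\<phi> k w) p \<le> C) \<and>
        (\<exists>q\<in>M. d (u n) q + d q (v m) = d (u n) (v m) \<and> d w q \<le> C)"
      "\<forall>n\<ge>N0. \<forall>m\<ge>N0. (\<exists>p\<in>M. d (u0 n) p + d p (v m) = d (u0 n) (v m) \<and> d (\<phi> k w) p \<le> C) \<and>
        (\<exists>q\<in>M. d (u0 n) q + d q (v m) = d (u0 n) (v m) \<and> d w q \<le> C)"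
      using near[OF k u] near[OF k u0] by blast
    have uM: "u n \<in> M" "u0 n \<in> M" for n using end_class(5)[of \<xi> u] end_class(5)[of \<xi> u0] u u0 by auto
    show ?thesis
    proof (intro exI[of _ "max N1 N0"] allI impI)
      fix n m assume nm: "max N1 N0 \<le> n" "max N1 N0 \<le> m"
      define l where "l = max N1 N0"
      have l: "N1 \<le> n" "N1 \<le> l" "N0 \<le> m" "N0 \<le> l" using nm by (auto simp: l_def)
      have kw: "\<phi> k w \<in> M" using act_closed[OF k base] .
      show "\<bar>e u k n - e u0 k m\<bar> \<le> 4 * C"
        using defect[OF uM(1) vM kw N(1)[rule_format, OF l(1,2), THEN conjunct1]]
          defect[OF uM(1) vM base N(1)[rule_format, OF l(1,2), THEN conjunct2]]
          defect[OF uM(2) vM kw N(2)[rule_format, OF l(3,4), THEN conjunct1]]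
          defect[OF uM(2) vM base N(2)[rule_format, OF l(3,4), THEN conjunct2]]
        unfolding e_def by linarith
    qed
  qed
  have "\<forall>k\<in>H. \<exists>N. \<forall>m\<ge>N. \<bar>e u0 k m - e u0 k N\<bar> \<le> 4 * C"
    using close[OF _ u0] by (meson order_refl)
  then obtain K where K: "\<And>k m. k \<in> H \<Longrightarrow> K k \<le> m \<Longrightarrow> \<bar>e u0 k m - e u0 k (K k)\<bar> \<le> 4 * C"
    by metis
  \<comment> \<open>A late value of \<open>e u0 k\<close> replaces its limit; with
    \<open>close\<close> it is within \<open>8 * C\<close> of the late values for any other sequence
    in \<xi>.\<close>
  define f where "f k = e u0 k (K k)" for k
  have C0: "0 \<le> C"
  proof -
    obtain N where "\<forall>n\<ge>N. \<forall>m\<ge>N. \<exists>q\<in>M. d (u0 n) q + d q (v m) = d (u0 n) (v m) \<and> d w q \<le> C"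
      using near[OF one(1) u0] by blast
    then obtain q where "d w q \<le> C" by blast
    then show ?thesis using nonneg[of w q] by linarith
  qed
  have 1: "\<exists>N. \<forall>n\<ge>N. \<bar>e u k n - f k\<bar> \<le> 8 * C" if k: "k \<in> H" and u: "u \<in> \<xi>" for k u
  proof -
    obtain N where N: "\<And>n m. n \<ge> N \<Longrightarrow> m \<ge> N \<Longrightarrow> \<bar>e u k n - e u0 k m\<bar> \<le> 4 * C" using close[OF k u] by blast
    have "\<bar>e u k n - f k\<bar> \<le> 8 * C" if "n \<ge> N" for n
      using N[OF that, of "max N (K k)"] K[OF k, of "max N (K k)"] unfolding f_def by linarith
    then show ?thesis by blast
  qed
  \<comment> \<open>Points \<open>p\<close> and \<open>q\<close> near \<open>\<phi> k w\<close> and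
    \<open>w\<close> have the same endpoints \<open>u0 n\<close> and \<open>v n\<close>, so their
    distance is the difference of their distances from \<open>u0 n\<close>. Replacing the orbit
    points by \<open>p\<close> and \<open>q\<close> twice costs \<open>4 * C\<close>, and
    \<open>f\<close> replaces \<open>e\<close> at a cost of \<open>8 * C\<close>.\<close>
  have 2: "d w (\<phi> k w) \<le> \<bar>f k\<bar> + 12 * C" if k: "k \<in> H" for k
  proof -
    have kw: "\<phi> k w \<in> M" using act_closed[OF k base] .
    obtain N where N: "\<forall>n\<ge>N. \<forall>m\<ge>N. (\<exists>p\<in>M. d (u0 n) p + d p (v m) = d (u0 n) (v m) \<and> d (\<phi> k w) p \<le> C) \<and>
        (\<exists>q\<in>M. d (u0 n) q + d q (v m) = d (u0 n) (v m) \<and> d w q \<le> C)"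
      using near[OF k u0] by blast
    obtain N' where N': "\<And>n. n \<ge> N' \<Longrightarrow> \<bar>e u0 k n - f k\<bar> \<le> 8 * C" using 1[OF k u0] by blast
    define n where "n = max N N'"
    have n: "n \<ge> N" "n \<ge> N'" by (auto simp: n_def)
    obtain p q where p: "p \<in> M" "d (u0 n) p + d p (v n) = d (u0 n) (v n)" "d (\<phi> k w) p \<le> C"
      and q: "q \<in> M" "d (u0 n) q + d q (v n) = d (u0 n) (v n)" "d w q \<le> C"
      using N n(1) by blast
    have uM: "u0 n \<in> M" using end_class(5)[of \<xi> u0] u0 by auto
    have "d p q = \<bar>d (u0 n) p - d (u0 n) q\<bar>" by (rule between_dist[OF uM vM p(1) q(1) p(2) q(2)])
    moreover have "d w (\<phi> k w) \<le> d w q + d p q + d (\<phi> k w) p"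
      using triangle[OF base q(1) kw] triangle[OF q(1) p(1) kw] commute[of q p] commute[of p "\<phi> k w"] by linarith
    moreover have "\<bar>d (u0 n) p - d (u0 n) (\<phi> k w)\<bar> \<le> d (\<phi> k w) p" "\<bar>d (u0 n) q - d (u0 n) w\<bar> \<le> d w q"
      using triangle[OF uM p(1) kw] triangle[OF uM kw p(1)] triangle[OF uM q(1) base] triangle[OF uM base q(1)]
        commute[of p "\<phi> k w"] commute[of q w] by linarith+
    moreover have "\<bar>e u0 k n - f k\<bar> \<le> 8 * C" using N'[OF n(2)] .
    ultimately show ?thesis using p(3) q(3) unfolding e_def by linarith
  qed
  show ?thesis
  proof (intro exI[of _ f] exI[of _ "12 * C"] conjI ballI)
    fix k u assume "k \<in> H" "u \<in> \<xi>"
    from 1[OF this] obtain N where "\<And>n. n \<ge> N \<Longrightarrow> \<bar>e u k n - f k\<bar> \<le> 8 * C" by blast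
    then show "\<exists>N. \<forall>n\<ge>N. \<bar>d (u n) (\<phi> k w) - d (u n) w - f k\<bar> \<le> 12 * C"
      using C0 unfolding e_def by (intro exI[of _ N]) fastforce
  qed (use 2 in blast)
qed

text \<open>The stabilizer of \<xi> in \<open>H\<close>, expressed through representing sequences so
  that no action on the boundary has to be set up.\<close>

definition H_plus :: "'g set" where
  "H_plus = {k \<in> H. \<forall>u\<in>\<xi>. (\<lambda>n. \<phi> k (u n)) \<in> \<xi>}"

lemma H_plus_inv:
  assumes k: "k \<in> H_plus" and u: "u \<in> \<xi>" shows "(\<lambda>n. \<phi> (inv k) (u n)) \<in> \<xi>"
proof -
  have kH: "k \<in> H" and ku: "(\<lambda>n. \<phi> k (u n)) \<in> \<xi>" using k u by (auto simp: H_plus_def)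
  have M: "u n \<in> M" for n using end_class(5)[of \<xi> u] u by auto
  have "(\<lambda>n. \<phi> k (u n), u) \<in> gromov_equiv M D w" using end_class(2)[of \<xi>] ku u by blast
  from isometry_gromov_equiv[OF H_isometry[OF H_inv[OF kH]] this]
  have "(u, \<lambda>n. \<phi> (inv k) (u n)) \<in> gromov_equiv M D w" using act_inv(1)[OF kH M] by simp
  then show ?thesis using end_class(3)[of \<xi>] u by blast
qed

text \<open>Elements outside \<open>H_plus\<close> carry \<xi> to \<eta>, so any two of them differ
  by an element of the stabilizer; this is the bound 2 on its index.\<close>

lemma H_plus_coset:
  assumes a: "a \<in> H" "a \<notin> H_plus" and b: "b \<in> H" "b \<notin> H_plus"
  shows "inv a \<otimes> b \<in> H_plus"
proof -
  have swap: "(\<lambda>n. \<phi> k (u n)) \<in> \<eta>" if k: "k \<in> H" "k \<notin> H_plus" and u: "u \<in> \<xi>" for k u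
  proof -
    obtain u' where u': "u' \<in> \<xi>" "(\<lambda>n. \<phi> k (u' n)) \<notin> \<xi>" using k by (auto simp: H_plus_def)
    then have "(\<lambda>n. \<phi> k (u' n)) \<in> \<eta>" using act_end[OF k(1), of \<xi>] by blast
    moreover have "(\<lambda>n. \<phi> k (u' n), \<lambda>n. \<phi> k (u n)) \<in> gromov_equiv M D w"
      using isometry_gromov_equiv[OF H_isometry[OF k(1)]] end_class(2)[of \<xi>] u u'(1) by blast
    ultimately show ?thesis using end_class(3)[of \<eta>] by blast
  qed
  have "(\<lambda>n. \<phi> (inv a \<otimes> b) (u n)) \<in> \<xi>" if u: "u \<in> \<xi>" for u
  proof -
    have M: "u n \<in> M" for n using end_class(5)[of \<xi> u] u by auto
    have "(\<lambda>n. \<phi> a (u n), \<lambda>n. \<phi> b (u n)) \<in> gromov_equiv M D w"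
      using end_class(2)[of \<eta>] swap[OF a u] swap[OF b u] by blast
    from isometry_gromov_equiv[OF H_isometry[OF H_inv[OF a(1)]] this]
    have "(u, \<lambda>n. \<phi> (inv a \<otimes> b) (u n)) \<in> gromov_equiv M D w"
      using act_inv(1)[OF a(1) M] act_mult[OF H_inv[OF a(1)] b(1) M] by simp
    then show ?thesis using end_class(3)[of \<xi>] u by blast
  qed
  then show ?thesis unfolding H_plus_def using subgroup.m_closed[OF H H_inv[OF a(1)] b(1)] by blast
qed

text \<open>The product of a point with itself is its \<open>D\<close>-distance from
  \<open>w\<close>, which is bounded on a finite orbit, while it is unbounded along a sequence that
  tends to \<xi>.\<close>

lemma infinite_H: "infinite H"
proof
  assume fin: "finite H"
  have "\<xi> \<in> limit_set M D w \<phi> H" using limit_set by simp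
  then obtain y z h where y: "y \<in> \<xi>" "z \<in> M" "range h \<subseteq> H" "(y, \<lambda>n. \<phi> (h n) z) \<in> gromov_equiv M D w"
    unfolding limit_set_def by blast
  define b where "b = Max ((\<lambda>k. D w (\<phi> k z)) ` H)"
  have "divergent_product (\<lambda>n. \<phi> (h n) z) (\<lambda>n. \<phi> (h n) z)" using y(4) by (simp add: gromov_equiv_iff)
  then obtain N where "\<forall>n\<ge>N. \<forall>m\<ge>N. b + 1 \<le> gp w (\<phi> (h n) z) (\<phi> (h m) z)"
    unfolding divergent_product_def by meson
  then have "b + 1 \<le> gp w (\<phi> (h N) z) (\<phi> (h N) z)" by blast
  moreover have "D w (\<phi> (h N) z) \<le> b" unfolding b_def using fin y(3) by (intro Max_ge) auto
  ultimately show False by (simp add: gromov_product_def D_self)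
qed

lemma H_virtually_Z: "virtually_Z (G\<lparr>carrier := H\<rparr>)"
proof -
  interpret group G using group_hom unfolding group_hom_def by blast
  interpret HG: group "G\<lparr>carrier := H\<rparr>" using subgroup.subgroup_is_group[OF H is_group] .
  obtain f C where f: "\<And>k u. k \<in> H \<Longrightarrow> u \<in> \<xi> \<Longrightarrow> \<exists>N. \<forall>n\<ge>N. \<bar>d (u n) (\<phi> k w) - d (u n) w - f k\<bar> \<le> C"
    and proper: "\<And>k. k \<in> H \<Longrightarrow> d w (\<phi> k w) \<le> \<bar>f k\<bar> + C"
    using busemann_function by blast
  obtain u where u: "u \<in> \<xi>" using end_class(1)[of \<xi>] by blast
  have M: "u n \<in> M" for n using end_class(5)[of \<xi> u] u by auto
  show ?thesis
  proof (rule HG.virtually_Z_if_proper_quasimorphism[of H_plus f "3 * C"])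
    show "H_plus \<subseteq> carrier (G\<lparr>carrier := H\<rparr>)" by (auto simp: H_plus_def)
    show "infinite H_plus"
    proof
      assume fin: "finite H_plus"
      show False
      proof (cases "H \<subseteq> H_plus")
        case True
        then show ?thesis using fin infinite_H finite_subset by blast
      next
        case False
        then obtain a where a: "a \<in> H" "a \<notin> H_plus" by blast
        have "b \<in> (\<lambda>k. a \<otimes> k) ` H_plus" if b: "b \<in> H - H_plus" for b
        proof (rule image_eqI[of _ _ "inv a \<otimes> b"])
          show "b = a \<otimes> (inv a \<otimes> b)" using a b H_carrier by (simp add: m_assoc[symmetric])
          show "inv a \<otimes> b \<in> H_plus" using H_plus_coset a b by blast
        qed
        then have "H \<subseteq> H_plus \<union> (\<lambda>k. a \<otimes> k) ` H_plus" by blast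
        then show ?thesis using fin infinite_H finite_subset by blast
      qed
    qed
    show "finite {x \<in> carrier (G\<lparr>carrier := H\<rparr>). \<bar>f x\<bar> \<le> R}" for R
    proof (rule finite_subset)
      show "{x \<in> carrier (G\<lparr>carrier := H\<rparr>). \<bar>f x\<bar> \<le> R} \<subseteq> {g \<in> carrier G. d (\<phi> g w) w \<le> \<bar>R + C\<bar> + 1}"
        using proper H_carrier commute[of w] by fastforce
      show "finite {g \<in> carrier G. d (\<phi> g w) w \<le> \<bar>R + C\<bar> + 1}"
        by (rule properly_discontinuous[OF base]) simp
    qed
    fix k x assume k: "k \<in> H_plus" and "x \<in> carrier (G\<lparr>carrier := H\<rparr>)"
    then have x: "x \<in> H" and kH: "k \<in> H" by (auto simp: H_plus_def)
    have kx: "k \<otimes> x \<in> H" using subgroup.m_closed[OF H kH x] .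
    \<comment> \<open>Cocycle identity: moving by \<open>inv k\<close>, the estimate for
      \<open>k \<otimes> x\<close> along \<open>u\<close> is the sum of the one for \<open>k\<close>
      along \<open>u\<close> and the one for \<open>x\<close> along the translated sequence. The
      latter still tends to \<xi> as \<open>k\<close> lies in \<open>H_plus\<close>; this is why
      \<open>f\<close> must serve all sequences in \<xi>. Each estimate contributes one
      \<open>C\<close>.\<close>
    obtain N1 N2 N3 where
      N: "\<forall>n\<ge>N1. \<bar>d (u n) (\<phi> (k \<otimes> x) w) - d (u n) w - f (k \<otimes> x)\<bar> \<le> C"
        "\<forall>n\<ge>N2. \<bar>d (u n) (\<phi> k w) - d (u n) w - f k\<bar> \<le> C"
        "\<forall>n\<ge>N3. \<bar>d (\<phi> (inv k) (u n)) (\<phi> x w) - d (\<phi> (inv k) (u n)) w - f x\<bar> \<le> C"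
      using f[OF kx u] f[OF kH u] f[OF x H_plus_inv[OF k u]] by blast
    define n where "n = max N1 (max N2 N3)"
    have iso: "d (\<phi> (inv k) (u n)) y = d (u n) (\<phi> k y)" if "y \<in> M" for y
      using isometryD(3)[OF H_isometry[OF kH] act_closed[OF H_inv[OF kH] M] that] act_inv(2)[OF kH M] by simp
    have "n \<ge> N1" "n \<ge> N2" "n \<ge> N3" by (auto simp: n_def)
    then show "\<bar>f (k \<otimes>\<^bsub>G\<lparr>carrier := H\<rparr>\<^esub> x) - f k - f x\<bar> \<le> 3 * C"
      using N[rule_format, of n] iso[OF act_closed[OF x base]] iso[OF base] act_mult[OF kH x base] by simp
  qed
qed

end

theorem theorem1p9:
  fixes G :: "('g, 'm) monoid_scheme"
    and X :: "'a set" and d :: "'a \<Rightarrow> 'a \<Rightarrow> real"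
    and \<phi> :: "'g \<Rightarrow> 'a \<Rightarrow> 'a"
    and lam :: "nat \<Rightarrow> real"
    and w :: 'a and H :: "'g set"
  assumes "CAT0_space X d"
    and "geometric_action G X d \<phi>"
    and "curtain_weights lam"
    and "w \<in> X"
    and "subgroup H G"
    and "card (limit_set X (Metric_space.curtain_dist X d lam) w \<phi> H) = 2"
  shows "virtually_Z (G\<lparr>carrier := H\<rparr>)"
proof -
  obtain \<xi> \<eta> where "limit_set X (Metric_space.curtain_dist X d lam) w \<phi> H = {\<xi>, \<eta>}" "\<xi> \<noteq> \<eta>"
    using assms(6) by (auto simp: card_2_iff)
  then interpret two_ended_action X d lam w G \<phi> H \<xi> \<eta>
    using assms(1-5)
    by (simp add: two_ended_action_def two_ended_action_axioms_def pointed_curtain_model_def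
        pointed_curtain_model_axioms_def curtain_model_def curtain_model_axioms_def)
  show ?thesis by (rule H_virtually_Z)
qed

end
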